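(* Assume that $f\in L^2(\Omega)$ and that, in addition to the standing assumptions, $\kappa_j \in C^1(\overline{\Omega}_j \times \mathbb{R})$ for every $j=0,1,\dots,m_\Gamma$. Let $p\ge 1$ be an integer. Let $u\in H^1_0(\Omega)$ be a weak solution, i.e. $a(u;u,w)=\ell(w)$ for all $w\in H^1_0(\Omega)$, and suppose $u \in H^{p+1}_\Gamma(\Omega)$. Then there exist $h_0>0$ and $C>0$, with $C$ independent of $h$, such that for every admissible mesh $\mathcal T_h$ with mesh size $h<h_0$ and every SGFEM approximation $u_{h,E}\in V^p_{h,E}$, i.e. every $u_{h,E}\in V^p_{h,E}$ satisfying $$a(u_{h,E};u_{h,E},w_{h,E})=\ell(w_{h,E})\quad\text{for all } w_{h,E}\in V^p_{h,E},$$ one has $$\|u - u_{h,E}\| + h\, |u - u_{h,E}|_1 \le C h^{p+1} \Bigg(\sum_{j=0}^{m_\Gamma} |u|^2_{p+1,\Omega_j}\Bigg)^{1/2}.$$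
   Context: Problem data. $\Omega=(0,L)\subset\mathbb{R}$; interfaces $\Gamma=\{\gamma_1<\dots<\gamma_{m_\Gamma}\}\subset\Omega$; $\Omega_0=(0,\gamma_1)$, $\Omega_j=(\gamma_j,\gamma_{j+1})$ for $1\le j\le m_\Gamma-1$, $\Omega_{m_\Gamma}=(\gamma_{m_\Gamma},L)$. For each $j=0,\dots,m_\Gamma$ there are constants $0<\kappa_{j,\min}\le\kappa_{j,\max}<\infty$ and $C_{L,j}$, and a function $\kappa_j\in C(\overline\Omega_j\times\mathbb{R})$ with values in $[\kappa_{j,\min},\kappa_{j,\max}]$ such that $|\kappa_j(x,\zeta_1)-\kappa_j(x,\zeta_2)|\le C_{L,j}|\zeta_1-\zeta_2|$ for all $x\in\Omega_j$, $\zeta_1,\zeta_2\in\mathbb{R}$. Forms: $a(v;u,w)=\sum_{j=0}^{m_\Gamma}\int_{\Omega_j}\kappa_j(x,v(x))u'(x)w'(x)\,dx$ and $\ell(w)=\int_\Omega f(x)w(x)\,dx$. Norms. $\|\cdot\|$ is the $L^2(\Omega)$ norm; $|v|_1=\|v'\|$; $|v|_{k,K}=\|v^{(k)}\|_{L^2(K)}$. For integer $k\ge 2$, $H^k_\Gamma(\Omega)=\{w\in H^1_0(\Omega): w|_{\Omega_j}\in H^k(\Omega_j),\ j=0,\dots,m_\Gamma\}$. Mesh. An admissible mesh is a partition $0=x_0<x_1<\dots<x_N=L$ with $x_i\notin\Gamma$ for all $i$, elements $\mathcal T_h=\{(x_{i-1},x_i): i=1,\dots,N\}$, mesh size $h=\max_i(x_i-x_{i-1})$,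 such that every element contains at most one point of $\Gamma$. $\mathcal T_{h,\Gamma}\subset\mathcal T_h$ is the set of elements containing a point of $\Gamma$. Spaces. $V_h^p\subset H^1_0(\Omega)$ is the space of continuous functions vanishing on $\partial\Omega$ that are polynomials of degree at most $p$ on each element. For $\tau=(x_l,x_r)\in\mathcal T_{h,\Gamma}$ containing $\gamma\in\Gamma$, let $w_\tau$ be defined on $\overline\tau$ as the affine interpolant at $x_l,x_r$ of $x\mapsto|x-\gamma|$ minus $|x-\gamma|$, and $w_\tau=0$ outside $\tau$. The enriched (SGFEM) space is $V_{h,E}^p=V_h^p+V_{h,E}$, where $V_{h,E}$ is the span of all products $w_\tau\varphi_k$, $\tau\in\mathcal T_{h,\Gamma}$, with $\varphi_k$ ranging over the $p+1$ nodal Lagrange basis functions of degree $p$ associated with $\tau$. *)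

theory Defs
  imports "HOL-Analysis.Analysis"
begin

text \<open>
  Elements of Lebesgue and Sobolev spaces are represented by functions on the whole line; only
  their values almost everywhere on the interval \<open>S\<close> matter.
\<close>

definition L2 :: "real set \<Rightarrow> (real \<Rightarrow> real) set" where
  "L2 S = {v. set_borel_measurable lebesgue S v \<and> set_integrable lebesgue S (\<lambda>t. (v t)\<^sup>2)}"

definition L2_norm :: "real set \<Rightarrow> (real \<Rightarrow> real) \<Rightarrow> real" where
  "L2_norm S v = sqrt (LINT t:S|lebesgue. (v t)\<^sup>2)"

text \<open>
  Sobolev spaces on an open interval are set up with \<open>C\<^sup>1\<close> test functions of compact support, as in
  Brezis, Functional Analysis, Sobolev Spaces and Partial Differential Equations, Chapter 8.
  Test functions are extended by zero to the whole line.
\<close>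

definition test_functions :: "real set \<Rightarrow> (real \<Rightarrow> real) set" where
  "test_functions S =
    {\<phi>. \<phi> C1_differentiable_on UNIV \<and> (\<exists>K. compact K \<and> K \<subseteq> S \<and> (\<forall>t. t \<notin> K \<longrightarrow> \<phi> t = 0))}"

definition is_weak_deriv :: "real set \<Rightarrow> (real \<Rightarrow> real) \<Rightarrow> (real \<Rightarrow> real) \<Rightarrow> bool" where
  "is_weak_deriv S v g \<longleftrightarrow> v \<in> L2 S \<and> g \<in> L2 S \<and>
    (\<forall>\<phi>\<in>test_functions S.
      (LINT t:S|lebesgue. v t * deriv \<phi> t) = - (LINT t:S|lebesgue. g t * \<phi> t))"

text \<open>The weak derivative is unique up to null sets; the choice below picks a representative.\<close>

definition weak_deriv :: "real set \<Rightarrow> (real \<Rightarrow> real) \<Rightarrow> real \<Rightarrow> real" where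
  "weak_deriv S v = (SOME g. is_weak_deriv S v g)"

primrec sobolev :: "nat \<Rightarrow> real set \<Rightarrow> (real \<Rightarrow> real) set" where
  "sobolev 0 S = L2 S"
| "sobolev (Suc k) S = {v \<in> L2 S. \<exists>g\<in>sobolev k S. is_weak_deriv S v g}"

definition sobolev_seminorm :: "nat \<Rightarrow> real set \<Rightarrow> (real \<Rightarrow> real) \<Rightarrow> real" where
  "sobolev_seminorm k S v = L2_norm S ((weak_deriv S ^^ k) v)"

definition H1_norm :: "real set \<Rightarrow> (real \<Rightarrow> real) \<Rightarrow> real" where
  "H1_norm S v = sqrt ((L2_norm S v)\<^sup>2 + (sobolev_seminorm 1 S v)\<^sup>2)"

text \<open>The closure of the test functions in the first-order Sobolev space.\<close>

definition H10 :: "real set \<Rightarrow> (real \<Rightarrow> real) set" where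
  "H10 S = {v \<in> sobolev 1 S. \<forall>\<epsilon>>0. \<exists>\<phi>\<in>test_functions S. H1_norm S (\<lambda>t. v t - \<phi> t) < \<epsilon>}"

text \<open>
  The interfaces are \<open>\<gamma> 1 < \<dots> < \<gamma> m\<close>; other values of \<open>\<gamma>\<close> are never used. The subdomains are
  \<open>subdomain L m \<gamma> j\<close> for \<open>j \<le> m\<close>.
\<close>

definition breakpoint :: "real \<Rightarrow> nat \<Rightarrow> (nat \<Rightarrow> real) \<Rightarrow> nat \<Rightarrow> real" where
  "breakpoint L m \<gamma> j = (if j = 0 then 0 else if j \<le> m then \<gamma> j else L)"

definition subdomain :: "real \<Rightarrow> nat \<Rightarrow> (nat \<Rightarrow> real) \<Rightarrow> nat \<Rightarrow> real set" where
  "subdomain L m \<gamma> j = {breakpoint L m \<gamma> j <..< breakpoint L m \<gamma> (Suc j)}"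

definition H_Gamma :: "nat \<Rightarrow> real \<Rightarrow> nat \<Rightarrow> (nat \<Rightarrow> real) \<Rightarrow> (real \<Rightarrow> real) set" where
  "H_Gamma k L m \<gamma> = {w \<in> H10 {0<..<L}. \<forall>j\<le>m. w \<in> sobolev k (subdomain L m \<gamma> j)}"

text \<open>
  \<open>C\<^sup>1\<close> up to the boundary: continuously differentiable in the open set \<open>S\<close>, the function and its
  derivative extending continuously to the closure.
\<close>

definition C1_on_closure :: "'a::real_normed_vector set \<Rightarrow> ('a \<Rightarrow> real) \<Rightarrow> bool" where
  "C1_on_closure S f \<longleftrightarrow> continuous_on (closure S) f \<and>
    (\<exists>D :: 'a \<Rightarrow> 'a \<Rightarrow>\<^sub>L real. continuous_on (closure S) D \<and>
      (\<forall>z\<in>S. (f has_derivative blinfun_apply (D z)) (at z)))"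

definition diffusion_form ::
  "real \<Rightarrow> nat \<Rightarrow> (nat \<Rightarrow> real) \<Rightarrow> (nat \<Rightarrow> real \<times> real \<Rightarrow> real) \<Rightarrow>
    (real \<Rightarrow> real) \<Rightarrow> (real \<Rightarrow> real) \<Rightarrow> (real \<Rightarrow> real) \<Rightarrow> real" where
  "diffusion_form L m \<gamma> \<kappa> v u w =
    (\<Sum>j\<le>m. LINT t:subdomain L m \<gamma> j|lebesgue.
      \<kappa> j (t, v t) * weak_deriv {0<..<L} u t * weak_deriv {0<..<L} w t)"

definition load_form :: "real \<Rightarrow> (real \<Rightarrow> real) \<Rightarrow> (real \<Rightarrow> real) \<Rightarrow> real" where
  "load_form L f w = (LINT t:{0<..<L}|lebesgue. f t * w t)"

definition element :: "(nat \<Rightarrow> real) \<Rightarrow> nat \<Rightarrow> real set" where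
  "element x i = {x (i - 1)<..<x i}"

definition admissible_mesh :: "real \<Rightarrow> real set \<Rightarrow> nat \<Rightarrow> (nat \<Rightarrow> real) \<Rightarrow> bool" where
  "admissible_mesh L \<Gamma> N x \<longleftrightarrow>
    x 0 = 0 \<and> x N = L \<and> (\<forall>i\<in>{1..N}. x (i - 1) < x i) \<and> (\<forall>i\<le>N. x i \<notin> \<Gamma>) \<and>
    (\<forall>i\<in>{1..N}. \<forall>g\<in>\<Gamma> \<inter> element x i. \<forall>g'\<in>\<Gamma> \<inter> element x i. g = g')"

definition mesh_size :: "nat \<Rightarrow> (nat \<Rightarrow> real) \<Rightarrow> real" where
  "mesh_size N x = Max ((\<lambda>i. x i - x (i - 1)) ` {1..N})"

definition interface_elements :: "real set \<Rightarrow> nat \<Rightarrow> (nat \<Rightarrow> real) \<Rightarrow> nat set" where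
  "interface_elements \<Gamma> N x = {i \<in> {1..N}. \<Gamma> \<inter> element x i \<noteq> {}}"

definition fem_space :: "nat \<Rightarrow> real \<Rightarrow> nat \<Rightarrow> (nat \<Rightarrow> real) \<Rightarrow> (real \<Rightarrow> real) set" where
  "fem_space p L N x = {v. continuous_on {0..L} v \<and> v 0 = 0 \<and> v L = 0 \<and>
    (\<forall>i\<in>{1..N}. \<exists>q :: real poly. degree q \<le> p \<and> (\<forall>t\<in>element x i. v t = poly q t))}"

definition enrichment :: "real \<Rightarrow> real \<Rightarrow> real \<Rightarrow> real \<Rightarrow> real" where
  "enrichment a b g t = (if t \<in> {a..b}
    then (\<bar>a - g\<bar> * (b - t) + \<bar>b - g\<bar> * (t - a)) / (b - a) - \<bar>t - g\<bar> else 0)"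

text \<open>
  Lagrange basis of degree \<open>p \<ge> 1\<close> on \<open>[a, b]\<close> for equispaced nodes. The enrichment space below
  does not depend on the choice of the \<open>p + 1\<close> distinct nodes.
\<close>

definition lagrange_node :: "nat \<Rightarrow> real \<Rightarrow> real \<Rightarrow> nat \<Rightarrow> real" where
  "lagrange_node p a b k = a + (real k / real p) * (b - a)"

definition lagrange_basis :: "nat \<Rightarrow> real \<Rightarrow> real \<Rightarrow> nat \<Rightarrow> real \<Rightarrow> real" where
  "lagrange_basis p a b k t = (\<Prod>l\<in>{..p} - {k}.
    (t - lagrange_node p a b l) / (lagrange_node p a b k - lagrange_node p a b l))"

text \<open>
  The span of finitely many products, written out as linear combinations. On an admissible mesh
  \<open>\<Gamma> \<inter> element x i\<close> is a singleton for every interface element.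
\<close>

definition enrichment_space ::
  "nat \<Rightarrow> real set \<Rightarrow> nat \<Rightarrow> (nat \<Rightarrow> real) \<Rightarrow> (real \<Rightarrow> real) set" where
  "enrichment_space p \<Gamma> N x = range (\<lambda>c :: nat \<Rightarrow> nat \<Rightarrow> real. \<lambda>t.
    \<Sum>i\<in>interface_elements \<Gamma> N x. \<Sum>k\<le>p. c i k *
      (enrichment (x (i - 1)) (x i) (the_elem (\<Gamma> \<inter> element x i)) t *
       lagrange_basis p (x (i - 1)) (x i) k t))"

definition sgfem_space ::
  "nat \<Rightarrow> real \<Rightarrow> real set \<Rightarrow> nat \<Rightarrow> (nat \<Rightarrow> real) \<Rightarrow> (real \<Rightarrow> real) set" where
  "sgfem_space p L \<Gamma> N x =
    {\<lambda>t. v t + e t | v e. v \<in> fem_space p L N x \<and> e \<in> enrichment_space p \<Gamma> N x}"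

end

theory Submission
  imports Defs "HOL-Real_Asymp.Real_Asymp"
begin

text \<open>
  Write \<open>e = u - uh\<close>, \<open>A = \<kappa>(\<cdot>, uh)\<close> and \<open>d = (\<kappa>(\<cdot>, u) - \<kappa>(\<cdot>, uh)) u'\<close>. The difference of the fluxes is
  \<open>F = A e' + d\<close> with \<open>\<bar>d\<bar> \<le> \<beta> \<bar>e\<bar>\<close>, because \<open>u'\<close> is bounded, and \<open>F\<close> is orthogonal to the derivatives of
  all discrete functions. In one dimension the adjoint of the linearised problem, with the discrete
  coefficient \<open>A\<close>, is an explicitly solvable first-order system. The derivative of its solution
  oscillates on a cell of the mesh refined by the interfaces by at most the integral of a function whose
  \<open>L\<^sup>2\<close> norm is controlled by \<open>\<parallel>e\<parallel>\<close>; this needs only the energy bound for \<open>uh'\<close>. Testing with the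
  cell means, which are derivatives of discrete functions, gives \<open>\<parallel>e\<parallel> \<le> K h \<parallel>e'\<parallel>\<close>. For small \<open>h\<close> this
  absorbs the lower-order term in the coercivity estimate, so \<open>\<parallel>e'\<parallel> \<le> C \<parallel>u' - v'\<parallel>\<close> for every discrete \<open>v\<close>.
  Every continuous function that vanishes at the end points and is a polynomial of degree at most \<open>p\<close> on
  each refined cell is discrete, and \<open>v'\<close> can be taken to be a cellwise polynomial approximation of \<open>u'\<close>
  with the correct cell means.
\<close>

section \<open>Bounded functions continuous off a finite set\<close>

text \<open>The coefficient is linearised at \<open>uh\<close> and not at \<open>u\<close> because
  \<kappa>(., u) u' - \<kappa>(., uh) uh' = A e' + d then holds exactly: there is no quadratic
  remainder, hence no maximum-norm bound for uh' is called for. The price is that A is known only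
  through uh. On one refined cell its oscillation is at most a constant times the integral of 1 +
  |uh'|: the C1 hypothesis handles the change of position, the Lipschitz condition the change of
  value. The energy bound controls the L2 norm of this integrand uniformly in the mesh. It also
  bounds uh itself, so the C1 constant can be taken over a compact range of values. Across an
  interface A jumps, so the cells must be cut there, and it is the enrichment that keeps functions
  with a kink at the cut in the discrete space. A cellwise constant function is the derivative of a
  discrete function only if its integral over the whole interval is 0. This is why the adjoint
  solution is normalised to make \<open>\<sigma> / A\<close> a function of mean zero.\<close>

definition pc :: "real \<Rightarrow> real \<Rightarrow> (real \<Rightarrow> real) \<Rightarrow> bool" where
  "pc a b f \<longleftrightarrow> (\<exists>Y B. finite Y \<and> continuous_on ({a..b} - Y) f \<and> (\<forall>t\<in>{a..b} - Y. \<bar>f t\<bar> \<le> B))"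

lemma pcI:
  assumes "finite Y" "continuous_on ({a..b} - Y) f" "\<And>t. t \<in> {a..b} - Y \<Longrightarrow> \<bar>f t\<bar> \<le> B"
  shows "pc a b f"
  using assms unfolding pc_def by blast

lemma pc_continuous: "continuous_on {a..b} f \<Longrightarrow> pc a b f"
proof -
  assume f: "continuous_on {a..b} f"
  then have "bounded (f ` {a..b})"
    by (intro compact_imp_bounded compact_continuous_image) auto
  then obtain B where "\<forall>t\<in>{a..b}. \<bar>f t\<bar> \<le> B"
    by (auto simp: bounded_iff)
  with f show ?thesis
    by (intro pcI[where Y = "{}" and B = B]) auto
qed

lemma pc_const [simp, intro]: "pc a b (\<lambda>t. c)"
  by (rule pc_continuous) auto

lemma pc_mono: "pc a b f \<Longrightarrow> a \<le> c \<Longrightarrow> d \<le> b \<Longrightarrow> pc c d f"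
proof -
  assume "pc a b f" "a \<le> c" "d \<le> b"
  then obtain Y B where Y: "finite Y" "continuous_on ({a..b} - Y) f" "\<forall>t\<in>{a..b} - Y. \<bar>f t\<bar> \<le> B"
    unfolding pc_def by blast
  then show ?thesis
    using \<open>a \<le> c\<close> \<open>d \<le> b\<close>
    by (intro pcI[where Y = Y and B = B]) (auto intro: continuous_on_subset)
qed

lemma pc_binop:
  assumes "pc a b f" "pc a b g"
    and op: "\<And>S. continuous_on S f \<Longrightarrow> continuous_on S g \<Longrightarrow> continuous_on S (\<lambda>t. h (f t) (g t))"
    and bd: "\<And>x y B C. \<bar>x\<bar> \<le> B \<Longrightarrow> \<bar>y\<bar> \<le> C \<Longrightarrow> \<bar>h x y\<bar> \<le> H B C"
  shows "pc a b (\<lambda>t. h (f t) (g t))"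
proof -
  obtain Y B where Y: "finite Y" "continuous_on ({a..b} - Y) f" "\<forall>t\<in>{a..b} - Y. \<bar>f t\<bar> \<le> B"
    using assms(1) unfolding pc_def by blast
  obtain Z C where Z: "finite Z" "continuous_on ({a..b} - Z) g" "\<forall>t\<in>{a..b} - Z. \<bar>g t\<bar> \<le> C"
    using assms(2) unfolding pc_def by blast
  show ?thesis
    using Y Z
    by (intro pcI[where Y = "Y \<union> Z" and B = "H B C"] op bd) (auto intro: continuous_on_subset)
qed

lemma pc_add [intro]: "pc a b f \<Longrightarrow> pc a b g \<Longrightarrow> pc a b (\<lambda>t. f t + g t)"
  by (rule pc_binop[where H = "\<lambda>B C. B + C"]) (auto intro: continuous_intros)

lemma pc_diff [intro]: "pc a b f \<Longrightarrow> pc a b g \<Longrightarrow> pc a b (\<lambda>t. f t - g t)"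
  by (rule pc_binop[where H = "\<lambda>B C. B + C"]) (auto intro: continuous_intros)

lemma pc_mult [intro]: "pc a b f \<Longrightarrow> pc a b g \<Longrightarrow> pc a b (\<lambda>t. f t * g t)"
  by (rule pc_binop[where H = "\<lambda>B C. \<bar>B\<bar> * \<bar>C\<bar>"])
    (auto intro!: continuous_intros mult_mono simp: abs_mult)

lemma pc_minus [intro]: "pc a b f \<Longrightarrow> pc a b (\<lambda>t. - f t)"
  using pc_diff[of a b "\<lambda>_. 0" f] by simp

lemma pc_power2 [intro]: "pc a b f \<Longrightarrow> pc a b (\<lambda>t. (f t)\<^sup>2)"
  using pc_mult[of a b f f] by (simp add: power2_eq_square)

lemma pc_abs [intro]: "pc a b f \<Longrightarrow> pc a b (\<lambda>t. \<bar>f t\<bar>)"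
  using pc_binop[of a b f f "\<lambda>x y. \<bar>x\<bar>" "\<lambda>B C. B"] by (auto intro: continuous_intros)

lemma pc_sum [intro]: "(\<And>i. i \<in> I \<Longrightarrow> pc a b (f i)) \<Longrightarrow> pc a b (\<lambda>t. \<Sum>i\<in>I. f i t)"
  by (induction I rule: infinite_finite_induct) auto

text \<open>Glued functions are 0 at the breakpoints, so a positive lower bound for the denominator
  is available only off a finite set \<open>Z\<close>; this set joins the exceptional points of the
  quotient.\<close>

lemma pc_divide:
  assumes "pc a b f" "pc a b g" "finite Z" "0 < c" "\<And>t. t \<in> {a..b} - Z \<Longrightarrow> c \<le> g t"
  shows "pc a b (\<lambda>t. f t / g t)"
proof -
  obtain Y B where Y: "finite Y" "continuous_on ({a..b} - Y) g"
    using assms(2) unfolding pc_def by blast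
  have pos: "0 < g t" if "t \<in> {a..b} - Z" for t
    using assms(4) assms(5)[OF that] by linarith
  have "pc a b (\<lambda>t. inverse (g t))"
  proof (rule pcI[where Y = "Y \<union> Z" and B = "inverse c"])
    show "continuous_on ({a..b} - (Y \<union> Z)) (\<lambda>t. inverse (g t))"
    proof (rule continuous_on_inverse)
      show "continuous_on ({a..b} - (Y \<union> Z)) g"
        using Y(2) by (rule continuous_on_subset) auto
      show "\<forall>t\<in>{a..b} - (Y \<union> Z). g t \<noteq> 0"
        using pos by fastforce
    qed
    show "\<bar>inverse (g t)\<bar> \<le> inverse c" if "t \<in> {a..b} - (Y \<union> Z)" for t
      using assms(4) assms(5)[of t] pos[of t] that by (auto intro: le_imp_inverse_le)
  qed (use assms Y in auto)
  from pc_mult[OF assms(1) this] show ?thesis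
    by (simp add: divide_inverse)
qed

text \<open>Off the finite set the function is bounded and measurable on a set of finite measure.
  Boundedness is built into \<open>pc\<close> for this reason, and because it survives
  products.\<close>

lemma pc_absolutely_integrable:
  assumes "pc a b f" shows "f absolutely_integrable_on {a..b}"
proof -
  obtain Y B where Y: "finite Y" "continuous_on ({a..b} - Y) f" "\<forall>t\<in>{a..b} - Y. \<bar>f t\<bar> \<le> B"
    using assms unfolding pc_def by blast
  have bor: "{a..b} - Y \<in> sets borel"
    using Y(1) by (auto intro: borel_closed finite_imp_closed)
  have lm: "{a..b} - Y \<in> lmeasurable"
    using bor by (intro bounded_set_imp_lmeasurable) auto
  have "f absolutely_integrable_on ({a..b} - Y)"
  proof (rule measurable_bounded_by_integrable_imp_absolutely_integrable)
    show "f \<in> borel_measurable (lebesgue_on ({a..b} - Y))"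
      using Y(2) bor by (intro continuous_imp_measurable_on_sets_lebesgue) auto
    show "{a..b} - Y \<in> sets lebesgue" using bor by auto
    show "(\<lambda>_. B) integrable_on ({a..b} - Y)"
      using lm integrable_on_const by blast
  qed (use Y in auto)
  then show ?thesis
    by (rule absolutely_integrable_spike_set)
      (auto intro: negligible_subset[OF negligible_finite[OF Y(1)]])
qed

lemma pc_integrable: "pc a b f \<Longrightarrow> f integrable_on {a..b}"
  using pc_absolutely_integrable absolutely_integrable_on_def by blast

lemma pc_integrable_sub: "pc a b f \<Longrightarrow> a \<le> c \<Longrightarrow> d \<le> b \<Longrightarrow> f integrable_on {c..d}"
  by (rule pc_integrable[OF pc_mono])

lemma integral_mono_finite:
  fixes f g :: "real \<Rightarrow> real"
  assumes "f integrable_on S" "g integrable_on S" "finite Z" "\<And>t. t \<in> S - Z \<Longrightarrow> f t \<le> g t"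
  shows "integral S f \<le> integral S g"
proof -
  \<comment> \<open>Changing \<open>f\<close> to \<open>g\<close> on the finite set leaves the
    integral alone and makes the inequality hold everywhere.\<close>
  let ?f = "\<lambda>t. if t \<in> Z then g t else f t"
  have "integral S f = integral S ?f"
    by (rule integral_spike[OF negligible_finite[OF assms(3)]]) auto
  moreover have "?f integrable_on S"
    by (rule integrable_spike[OF assms(1) negligible_finite[OF assms(3)]]) auto
  ultimately show ?thesis
    using assms by (auto intro!: integral_le)
qed

lemma integral_nonneg_finite:
  fixes f :: "real \<Rightarrow> real"
  assumes "f integrable_on S" "finite Z" "\<And>t. t \<in> S - Z \<Longrightarrow> 0 \<le> f t"
  shows "0 \<le> integral S f"
  using integral_mono_finite[OF integrable_0 assms(1,2)] assms(3) by simp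

lemma integral_cong_finite:
  fixes f g :: "real \<Rightarrow> real"
  assumes "finite Z" "\<And>t. t \<in> S - Z \<Longrightarrow> f t = g t"
  shows "integral S f = integral S g"
  using integral_spike[OF negligible_finite[OF assms(1)], of S g f] assms(2) by simp

section \<open>Cauchy-Schwarz inequality and the L2 norm on the interval\<close>

lemma integral_Cauchy_Schwarz:
  fixes f g :: "real \<Rightarrow> real"
  assumes f: "(\<lambda>t. (f t)\<^sup>2) integrable_on S" and g: "(\<lambda>t. (g t)\<^sup>2) integrable_on S"
    and fg: "(\<lambda>t. f t * g t) integrable_on S"
  shows "(integral S (\<lambda>t. f t * g t))\<^sup>2 \<le> integral S (\<lambda>t. (f t)\<^sup>2) * integral S (\<lambda>t. (g t)\<^sup>2)"
proof -
  define p where "p = integral S (\<lambda>t. (f t)\<^sup>2)"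
  define q where "q = integral S (\<lambda>t. f t * g t)"
  define r where "r = integral S (\<lambda>t. (g t)\<^sup>2)"
  \<comment> \<open>The integral of (f - x g)^2, expanded as a quadratic polynomial in x.\<close>
  have quad: "0 \<le> p - 2 * x * q + x\<^sup>2 * r" for x
  proof -
    have h: "((\<lambda>t. (f t)\<^sup>2 - (2 * x) * (f t * g t) + x\<^sup>2 * (g t)\<^sup>2) has_integral (p - (2 * x) * q + x\<^sup>2 * r)) S"
      unfolding p_def q_def r_def
      by (intro has_integral_add has_integral_diff has_integral_mult_right integrable_integral assms)
    have "0 \<le> (f t)\<^sup>2 - (2 * x) * (f t * g t) + x\<^sup>2 * (g t)\<^sup>2" for t
      using zero_le_power2[of "f t - x * g t"] by (simp add: power2_eq_square algebra_simps)
    with has_integral_nonneg[OF h] show ?thesis by simp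
  qed
  have r0: "0 \<le> r" and p0: "0 \<le> p"
    unfolding r_def p_def using assms by (auto intro: integral_nonneg)
  show ?thesis
    unfolding p_def[symmetric] q_def[symmetric] r_def[symmetric]
  proof (cases "r = 0")
    case True
    have "q = 0"
    proof (rule ccontr)
      assume "q \<noteq> 0"
      \<comment> \<open>This x turns p - 2 x q into -1.\<close>
      then show False using quad[of "(p + 1) / (2 * q)"] True by simp
    qed
    then show "q\<^sup>2 \<le> p * r" using True by simp
  next
    case False
    then have "0 < r" using r0 by simp
    \<comment> \<open>x = q / r is the minimiser of the quadratic.\<close>
    have "0 \<le> (p - 2 * (q / r) * q + (q / r)\<^sup>2 * r) * r"
      using quad[of "q / r"] r0 by (rule mult_nonneg_nonneg)
    also have "\<dots> = p * r - q\<^sup>2"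
      using \<open>0 < r\<close> by (simp add: power2_eq_square field_simps)
    finally show "q\<^sup>2 \<le> p * r" by simp
  qed
qed

lemma integral_abs_square_le:
  fixes f :: "real \<Rightarrow> real"
  assumes "a \<le> b" "(\<lambda>t. (f t)\<^sup>2) integrable_on {a..b}" "(\<lambda>t. \<bar>f t\<bar>) integrable_on {a..b}"
  shows "(integral {a..b} (\<lambda>t. \<bar>f t\<bar>))\<^sup>2 \<le> (b - a) * integral {a..b} (\<lambda>t. (f t)\<^sup>2)"
  using integral_Cauchy_Schwarz[of "\<lambda>_. 1" "{a..b}" "\<lambda>t. \<bar>f t\<bar>"] assms integrable_const_ivl[of 1 a b]
  by simp

text \<open>A gauge integral over the closed interval, so that changes on null sets and splitting at
  nodes are cheap; \<open>L2_norm_eq_nrm\<close> identifies it with \<open>L2_norm\<close>. If the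
  square is not integrable the integral is 0 by default, so \<open>nrm_nonneg\<close> holds for
  every function.\<close>

definition nrm :: "real \<Rightarrow> (real \<Rightarrow> real) \<Rightarrow> real" where
  "nrm L f = sqrt (integral {0..L} (\<lambda>t. (f t)\<^sup>2))"

lemma nrm_square: "pc 0 L f \<Longrightarrow> (nrm L f)\<^sup>2 = integral {0..L} (\<lambda>t. (f t)\<^sup>2)"
  unfolding nrm_def by (intro real_sqrt_pow2 integral_nonneg pc_integrable) auto

lemma nrm_nonneg [simp]: "0 \<le> nrm L f"
  unfolding nrm_def by (cases "(\<lambda>t. (f t)\<^sup>2) integrable_on {0..L}")
    (auto intro: integral_nonneg simp: not_integrable_integral)

lemma nrm_Cauchy_Schwarz:
  assumes "pc 0 L f" "pc 0 L g"
  shows "\<bar>integral {0..L} (\<lambda>t. f t * g t)\<bar> \<le> nrm L f * nrm L g"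
proof (rule abs_le_square_iff[THEN iffD2, of _ "nrm L f * nrm L g", unfolded abs_of_nonneg[OF mult_nonneg_nonneg[OF nrm_nonneg nrm_nonneg]]])
  show "(integral {0..L} (\<lambda>t. f t * g t))\<^sup>2 \<le> (nrm L f * nrm L g)\<^sup>2"
    using integral_Cauchy_Schwarz[of f "{0..L}" g] assms
    by (auto simp: power_mult_distrib nrm_square intro: pc_integrable)
qed

lemma nrm_triangle:
  assumes "pc 0 L f" "pc 0 L g"
  shows "nrm L (\<lambda>t. f t + g t) \<le> nrm L f + nrm L g"
proof (rule power2_le_imp_le)
  have "(nrm L (\<lambda>t. f t + g t))\<^sup>2 = integral {0..L} (\<lambda>t. (f t)\<^sup>2 + 2 * (f t * g t) + (g t)\<^sup>2)"
    using assms by (subst nrm_square) (auto intro!: integral_cong simp: power2_eq_square algebra_simps)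
  also have "\<dots> = (nrm L f)\<^sup>2 + 2 * integral {0..L} (\<lambda>t. f t * g t) + (nrm L g)\<^sup>2"
    unfolding nrm_square[OF assms(1)] nrm_square[OF assms(2)]
    by (rule integral_unique)
      (intro has_integral_add has_integral_mult_right integrable_integral pc_integrable pc_power2 pc_mult assms)
  also have "\<dots> \<le> (nrm L f + nrm L g)\<^sup>2"
    using nrm_Cauchy_Schwarz[OF assms] by (simp add: power2_sum)
  finally show "(nrm L (\<lambda>t. f t + g t))\<^sup>2 \<le> (nrm L f + nrm L g)\<^sup>2" .
qed simp

lemma nrm_mono:
  assumes "pc 0 L f" "pc 0 L g" "finite Z" "\<And>t. t \<in> {0..L} - Z \<Longrightarrow> \<bar>f t\<bar> \<le> \<bar>g t\<bar>"
  shows "nrm L f \<le> nrm L g"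
  unfolding nrm_def
  using assms by (intro real_sqrt_le_mono integral_mono_finite[where Z = Z] pc_integrable pc_power2)
    (auto simp: abs_le_square_iff)

lemma nrm_scale: "pc 0 L f \<Longrightarrow> nrm L (\<lambda>t. c * f t) = \<bar>c\<bar> * nrm L f"
  by (simp add: nrm_def power_mult_distrib real_sqrt_mult)

lemma nrm_abs [simp]: "nrm L (\<lambda>t. \<bar>f t\<bar>) = nrm L f"
  by (simp add: nrm_def)

lemma nrm_const: "0 \<le> L \<Longrightarrow> nrm L (\<lambda>t. c) = \<bar>c\<bar> * sqrt L"
  by (simp add: nrm_def real_sqrt_mult)

lemma integral_abs_le_nrm:
  assumes "0 \<le> L" "pc 0 L f" "0 \<le> s" "s \<le> t" "t \<le> L"
  shows "integral {s..t} (\<lambda>r. \<bar>f r\<bar>) \<le> sqrt L * nrm L f"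
proof -
  have "integral {s..t} (\<lambda>r. \<bar>f r\<bar>) \<le> integral {0..L} (\<lambda>r. \<bar>f r\<bar>)"
    using assms by (intro integral_subset_le pc_integrable[OF pc_mono[of 0 L]] pc_integrable) auto
  also have "\<dots> = integral {0..L} (\<lambda>r. 1 * \<bar>f r\<bar>)" by simp
  also have "\<dots> \<le> nrm L (\<lambda>_. 1) * nrm L (\<lambda>r. \<bar>f r\<bar>)"
    using assms by (intro order_trans[OF abs_ge_self nrm_Cauchy_Schwarz]) auto
  finally show ?thesis using assms by (simp add: nrm_const)
qed

section \<open>Piecewise continuously differentiable functions\<close>

definition pwC1 :: "real \<Rightarrow> real \<Rightarrow> (real \<Rightarrow> real) \<Rightarrow> (real \<Rightarrow> real) \<Rightarrow> bool" where
  "pwC1 a b f f' \<longleftrightarrow> continuous_on {a..b} f \<and> pc a b f' \<and>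
    (\<exists>Y. finite Y \<and> (\<forall>t\<in>{a<..<b} - Y. (f has_real_derivative f' t) (at t)))"

lemma pwC1D:
  assumes "pwC1 a b f f'"
  shows pwC1_cont: "continuous_on {a..b} f" and pwC1_pc': "pc a b f'" and pwC1_pc: "pc a b f"
  using assms pc_continuous by (auto simp: pwC1_def)

lemma pwC1_mono: "pwC1 a b f f' \<Longrightarrow> a \<le> c \<Longrightarrow> d \<le> b \<Longrightarrow> pwC1 c d f f'"
  unfolding pwC1_def by (auto intro: continuous_on_subset pc_mono) 

text \<open>Continuity of \<open>f\<close> on the closed interval carries the fundamental theorem
  across the exceptional points, where \<open>f'\<close> may take any value.\<close>

lemma pwC1_has_integral:
  assumes "pwC1 a b f f'" "a \<le> c" "c \<le> d" "d \<le> b"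
  shows "(f' has_integral (f d - f c)) {c..d}"
proof -
  obtain Y where Y: "finite Y" "\<forall>t\<in>{a<..<b} - Y. (f has_real_derivative f' t) (at t)"
    using assms(1) unfolding pwC1_def by blast
  show ?thesis
  proof (rule fundamental_theorem_of_calculus_interior_strong[OF Y(1) assms(3)])
    show "continuous_on {c..d} f"
      using pwC1_cont[OF assms(1)] assms by (auto intro: continuous_on_subset)
    show "(f has_vector_derivative f' x) (at x)" if "x \<in> {c<..<d} - Y" for x
      using Y(2) assms that by (auto simp flip: has_real_derivative_iff_has_vector_derivative)
  qed
qed

lemma pwC1_integral:
  assumes "pwC1 a b f f'" "a \<le> c" "c \<le> d" "d \<le> b"
  shows "integral {c..d} f' = f d - f c"
  using pwC1_has_integral[OF assms] by (rule integral_unique)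

text \<open>The source of new \<open>pwC1\<close> functions: both the integrating factor of the
  adjoint problem and the discrete test functions are built from primitives of members of
  \<open>pc\<close>.\<close>

lemma pwC1_indefinite:
  assumes "pc a b g"
  shows "pwC1 a b (\<lambda>t. integral {a..t} g) g"
proof -
  obtain Y B where Y: "finite Y" "continuous_on ({a..b} - Y) g"
    using assms unfolding pc_def by blast
  have "((\<lambda>t. integral {a..t} g) has_real_derivative g t) (at t)" if t: "t \<in> {a<..<b} - Y" for t
  proof -
    have "((\<lambda>t. integral {a..t} g) has_vector_derivative g t) (at t within ({a..b} - Y))"
      using Y t by (intro integral_has_vector_derivative_continuous_at pc_integrable assms)
        (auto simp: continuous_on_eq_continuous_within)
    moreover have "at t within ({a..b} - Y) = at t"
    proof (rule at_within_open_subset[of t "{a<..<b} - Y"])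
      show "open ({a<..<b} - Y)" using Y(1) by (intro open_Diff finite_imp_closed) auto
    qed (use t in auto)
    ultimately show ?thesis
      by (simp add: has_real_derivative_iff_has_vector_derivative)
  qed
  then show ?thesis
    unfolding pwC1_def using assms Y(1)
    by (auto intro!: indefinite_integral_continuous_1 pc_integrable exI[of _ Y])
qed

lemma pwC1_binop:
  assumes f: "pwC1 a b f f'" and g: "pwC1 a b g g'"
    and c: "continuous_on {a..b} f \<Longrightarrow> continuous_on {a..b} g \<Longrightarrow> continuous_on {a..b} h"
    and p: "pc a b f \<Longrightarrow> pc a b g \<Longrightarrow> pc a b f' \<Longrightarrow> pc a b g' \<Longrightarrow> pc a b h'"
    and d: "\<And>t. (f has_real_derivative f' t) (at t) \<Longrightarrow> (g has_real_derivative g' t) (at t) \<Longrightarrow>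
      (h has_real_derivative h' t) (at t)"
  shows "pwC1 a b h h'"
proof -
  obtain Y where Y: "finite Y" "\<forall>t\<in>{a<..<b} - Y. (f has_real_derivative f' t) (at t)"
    using f unfolding pwC1_def by blast
  obtain Z where Z: "finite Z" "\<forall>t\<in>{a<..<b} - Z. (g has_real_derivative g' t) (at t)"
    using g unfolding pwC1_def by blast
  show ?thesis
    unfolding pwC1_def
    using Y Z by (intro conjI c p exI[of _ "Y \<union> Z"] pwC1_cont[OF f] pwC1_cont[OF g]
        pwC1_pc'[OF f] pwC1_pc'[OF g] pwC1_pc[OF f] pwC1_pc[OF g] ballI d) auto
qed

lemma pwC1_add: "pwC1 a b f f' \<Longrightarrow> pwC1 a b g g' \<Longrightarrow> pwC1 a b (\<lambda>t. f t + g t) (\<lambda>t. f' t + g' t)"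
  by (erule (1) pwC1_binop) (auto intro!: continuous_intros derivative_eq_intros)

lemma pwC1_diff: "pwC1 a b f f' \<Longrightarrow> pwC1 a b g g' \<Longrightarrow> pwC1 a b (\<lambda>t. f t - g t) (\<lambda>t. f' t - g' t)"
  by (erule (1) pwC1_binop) (auto intro!: continuous_intros derivative_eq_intros)

lemma pwC1_mult:
  "pwC1 a b f f' \<Longrightarrow> pwC1 a b g g' \<Longrightarrow> pwC1 a b (\<lambda>t. f t * g t) (\<lambda>t. f' t * g t + f t * g' t)"
  by (erule (1) pwC1_binop) (auto intro!: continuous_intros derivative_eq_intros)

lemma pwC1_exp: "pwC1 a b f f' \<Longrightarrow> pwC1 a b (\<lambda>t. exp (f t)) (\<lambda>t. exp (f t) * f' t)"
  by (rule pwC1_binop[of _ _ f f' f f'])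
    (auto intro!: continuous_intros derivative_eq_intros pc_mult intro: pc_continuous dest: pwC1_cont)

lemma pwC1_const: "pwC1 a b (\<lambda>t. c) (\<lambda>t. 0)"
  unfolding pwC1_def by (auto intro!: exI[of _ "{}"])

text \<open>The bound depends only on the enclosing interval, so a cell contributes a single number
  for all pairs of its points.\<close>

lemma pwC1_osc:
  assumes "pwC1 a b f f'" "a \<le> c" "d \<le> b" "s \<in> {c..d}" "t \<in> {c..d}"
  shows "\<bar>f t - f s\<bar> \<le> integral {c..d} (\<lambda>r. \<bar>f' r\<bar>)"
proof -
  have *: "\<bar>f t - f s\<bar> \<le> integral {c..d} (\<lambda>r. \<bar>f' r\<bar>)" if st: "s \<le> t" "c \<le> s" "t \<le> d" for s t
  proof -
    have i: "f' integrable_on {s..t}" "(\<lambda>r. \<bar>f' r\<bar>) integrable_on {s..t}"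
      using assms st pwC1_pc'[OF assms(1)] by (auto intro!: pc_integrable_sub[of a b] pc_abs)
    have "\<bar>f t - f s\<bar> = \<bar>integral {s..t} f'\<bar>"
      using pwC1_integral[OF assms(1), of s t] assms st by simp
    also have "\<dots> \<le> integral {s..t} (\<lambda>r. \<bar>f' r\<bar>)"
      using integral_norm_bound_integral[OF i] by simp
    also have "\<dots> \<le> integral {c..d} (\<lambda>r. \<bar>f' r\<bar>)"
      using assms st pwC1_pc'[OF assms(1)] i
      by (intro integral_subset_le) (auto intro!: pc_integrable_sub[of a b] pc_abs)
    finally show ?thesis .
  qed
  show ?thesis
    using *[of s t] *[of t s] assms by (cases "s \<le> t") (auto simp: abs_minus_commute)
qed

lemma pwC1_Poincare:
  assumes "0 \<le> L" "pwC1 0 L f f'" "f 0 = 0"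
  shows "t \<in> {0..L} \<Longrightarrow> \<bar>f t\<bar> \<le> sqrt L * nrm L f'" and "nrm L f \<le> L * nrm L f'"
proof -
  show *: "\<bar>f t\<bar> \<le> sqrt L * nrm L f'" if "t \<in> {0..L}" for t
    using pwC1_osc[OF assms(2), of 0 t 0 t] that assms
      integral_abs_le_nrm[OF assms(1) pwC1_pc'[OF assms(2)], of 0 t] by auto
  have "nrm L f \<le> nrm L (\<lambda>t. sqrt L * nrm L f')"
    using * assms by (intro nrm_mono[where Z = "{}"] pwC1_pc[OF assms(2)]) (auto simp: abs_mult)
  also have "\<dots> = L * nrm L f'"
    using assms(1) by (simp add: nrm_const abs_mult)
  finally show "nrm L f \<le> L * nrm L f'" .
qed

section \<open>The linearised adjoint problem\<close>

lemma integral_mesh_sum: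
  fixes f :: "real \<Rightarrow> real"
  assumes "f integrable_on {y 0..y M}" "mono_on {..M} y"
  shows "integral {y 0..y M} f = (\<Sum>i<M. integral {y i..y (Suc i)} f)"
  using assms
proof (induction M)
  case (Suc M)
  have le: "y 0 \<le> y M" "y M \<le> y (Suc M)"
    using Suc.prems(2) by (auto intro: mono_onD)
  have "f integrable_on {y 0..y M}"
    using Suc.prems(1) le by (rule_tac integrable_subinterval_real) auto
  moreover have "mono_on {..M} y"
    using Suc.prems(2) by (rule mono_on_subset) auto
  ultimately show ?case
    using Suc.IH Henstock_Kurzweil_Integration.integral_combine[OF le Suc.prems(1)] by simp
qed simp

text \<open>At each point the deviation from the mean is an average of differences of values, hence
  at most the oscillation \<open>I\<close>. For a differentiable \<phi> take \<open>I\<close> to be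
  the integral of |\<phi>'| and \<open>W\<close> that of its square; the hypothesis on
  \<open>I\<close> is then Cauchy-Schwarz. Speaking of oscillations covers also functions of which
  only the increments are controlled.\<close>

lemma cell_mean_estimate:
  fixes \<phi> :: "real \<Rightarrow> real"
  assumes "a < b" "pc a b \<phi>" "finite Z"
    and osc: "\<And>s t. s \<in> {a<..<b} - Z \<Longrightarrow> t \<in> {a<..<b} - Z \<Longrightarrow> \<bar>\<phi> t - \<phi> s\<bar> \<le> I"
    and I: "I\<^sup>2 \<le> (b - a) * W"
  shows "integral {a..b} (\<lambda>t. (\<phi> t - integral {a..b} \<phi> / (b - a))\<^sup>2) \<le> (b - a)\<^sup>2 * W"
proof -
  define c where "c = integral {a..b} \<phi> / (b - a)"
  have fin: "finite (Z \<union> {a, b})" using assms by simp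
  have pt: "\<bar>\<phi> t - c\<bar> \<le> I" if t: "t \<in> {a..b} - (Z \<union> {a, b})" for t
  proof -
    have tt: "t \<in> {a<..<b} - Z" using t by auto
    have "integral {a..b} (\<lambda>s. \<phi> t - \<phi> s) = (b - a) * \<phi> t - integral {a..b} \<phi>"
      using assms by (subst integral_diff) (auto intro: pc_integrable)
    also have "\<dots> = (b - a) * (\<phi> t - c)"
      using assms(1) by (simp add: c_def field_simps)
    finally have *: "integral {a..b} (\<lambda>s. \<phi> t - \<phi> s) = (b - a) * (\<phi> t - c)" .
    have osc': "- I \<le> \<phi> t - \<phi> s \<and> \<phi> t - \<phi> s \<le> I" if "s \<in> {a..b} - (Z \<union> {a, b})" for s
      using osc[OF _ tt, of s] that by (auto simp: abs_le_iff)
    have pcs: "(\<lambda>s. \<phi> t - \<phi> s) integrable_on {a..b}"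
      using assms by (intro pc_integrable pc_diff) auto
    have "integral {a..b} (\<lambda>s. \<phi> t - \<phi> s) \<le> integral {a..b} (\<lambda>s. I)"
      by (intro integral_mono_finite[OF pcs _ fin]) (use osc' in auto)
    moreover have "integral {a..b} (\<lambda>s. - I) \<le> integral {a..b} (\<lambda>s. \<phi> t - \<phi> s)"
      by (intro integral_mono_finite[OF _ pcs fin]) (use osc' in auto)
    ultimately have "(b - a) * (\<phi> t - c) \<le> (b - a) * I" "(b - a) * (- I) \<le> (b - a) * (\<phi> t - c)"
      using assms(1) unfolding * by simp_all
    then have "\<phi> t - c \<le> I" "- I \<le> \<phi> t - c"
      using assms(1) by (simp_all only: mult_le_cancel_left_pos diff_gt_0_iff_gt)
    then show ?thesis by linarith
  qed
  have "integral {a..b} (\<lambda>t. (\<phi> t - c)\<^sup>2) \<le> integral {a..b} (\<lambda>t. I\<^sup>2)"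
  proof (rule integral_mono_finite[OF _ _ fin])
    show "(\<lambda>t. (\<phi> t - c)\<^sup>2) integrable_on {a..b}"
      using assms by (intro pc_integrable pc_power2 pc_diff) auto
    show "(\<phi> t - c)\<^sup>2 \<le> I\<^sup>2" if "t \<in> {a..b} - (Z \<union> {a, b})" for t
      using pt[OF that] by (metis abs_ge_zero power2_abs power_mono)
  qed auto
  also have "\<dots> \<le> (b - a) * ((b - a) * W)"
    using I assms(1) by (simp add: mult_left_mono)
  finally show ?thesis
    by (simp add: c_def power2_eq_square mult.assoc)
qed

text \<open>The adjoint problem \<open>\<sigma>' = b \<sigma> - e\<close>, solved by an integrating factor; the constant \<open>c\<close>
  below makes \<open>\<sigma> / A\<close> the derivative of a function that vanishes at both ends.\<close>

lemma adjoint_solution: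
  fixes L \<kappa>0 \<beta> :: real
  assumes L: "0 < L" and \<kappa>0: "0 < \<kappa>0" and \<beta>: "0 \<le> \<beta>"
    and A: "pc 0 L A" "finite Z" "\<And>t. t \<in> {0..L} - Z \<Longrightarrow> \<kappa>0 \<le> A t"
    and b: "pc 0 L b" "\<And>t. t \<in> {0..L} - Z \<Longrightarrow> \<bar>b t\<bar> \<le> \<beta>"
    and e: "continuous_on {0..L} e"
  obtains \<sigma> where "pwC1 0 L \<sigma> (\<lambda>t. b t * \<sigma> t - e t)"
    "\<And>t. t \<in> {0..L} \<Longrightarrow> \<bar>\<sigma> t\<bar> \<le> 2 * (exp (\<beta> * L))\<^sup>2 * sqrt L * nrm L e"
    "integral {0..L} (\<lambda>t. \<sigma> t / A t) = 0"
proof -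
  \<comment> \<open>\<open>E\<close> is the integrating factor, E' = b E; with J' = e / E the
    function E (c - J) solves the equation for every constant c.\<close>
  define H where "H = (\<lambda>t. integral {0..t} b)"
  define E where "E = (\<lambda>t. exp (H t))"
  define J where "J = (\<lambda>t. integral {0..t} (\<lambda>s. e s / E s))"
  define \<eta> where "\<eta> = exp (\<beta> * L)"
  \<comment> \<open>The mean of J with weight E / A. It makes the integral of \<sigma> / A vanish
    and, being a mean, obeys the same bound as J.\<close>
  define c where "c = integral {0..L} (\<lambda>t. E t / A t * J t) / integral {0..L} (\<lambda>t. E t / A t)"
  define \<sigma> where "\<sigma> = (\<lambda>t. E t * (c - J t))"
  define Q where "Q = \<eta> * sqrt L * nrm L e"
  have Hp: "pwC1 0 L H b"
    unfolding H_def by (rule pwC1_indefinite[OF b(1)])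
  have Ep: "pwC1 0 L E (\<lambda>t. E t * b t)"
    unfolding E_def by (rule pwC1_exp[OF Hp])
  have Epos: "0 < E t" for t by (simp add: E_def)
  have Econt: "continuous_on {0..L} E" by (rule pwC1_cont[OF Ep])
  have eE: "continuous_on {0..L} (\<lambda>s. e s / E s)"
    using Epos by (intro continuous_on_divide e Econt) (auto simp: less_imp_neq[symmetric])
  have Jp: "pwC1 0 L J (\<lambda>s. e s / E s)"
    unfolding J_def by (rule pwC1_indefinite[OF pc_continuous[OF eE]])
  have Hb: "\<bar>H t\<bar> \<le> \<beta> * L" if t: "t \<in> {0..L}" for t
  proof -
    have "\<bar>H t - H 0\<bar> \<le> integral {0..t} (\<lambda>r. \<bar>b r\<bar>)"
      using t by (intro pwC1_osc[OF Hp]) auto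
    also have "\<dots> \<le> integral {0..t} (\<lambda>r. \<beta>)"
      using t by (intro integral_mono_finite[where Z = Z] pc_integrable_sub[of 0 L] pc_abs A(2) b) auto
    also have "\<dots> = \<beta> * t" using t by simp
    also have "\<dots> \<le> \<beta> * L" using t \<beta> by (intro mult_left_mono) auto
    finally show ?thesis by (simp add: H_def)
  qed
  have E2: "E t \<le> \<eta>" "1 / E t \<le> \<eta>" if "t \<in> {0..L}" for t
    using Hb[OF that] by (auto simp: E_def \<eta>_def abs_le_iff simp flip: exp_minus inverse_eq_divide)
  have \<eta>1: "1 \<le> \<eta>" using L \<beta> by (simp add: \<eta>_def)
  have JQ: "\<bar>J t\<bar> \<le> Q" if t: "t \<in> {0..L}" for t
  proof -
    have "\<bar>J t - J 0\<bar> \<le> integral {0..t} (\<lambda>r. \<bar>e r / E r\<bar>)"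
      using t by (intro pwC1_osc[OF Jp]) auto
    also have "\<dots> \<le> integral {0..t} (\<lambda>r. \<eta> * \<bar>e r\<bar>)"
    proof (rule integral_le)
      show "\<bar>e r / E r\<bar> \<le> \<eta> * \<bar>e r\<bar>" if "r \<in> {0..t}" for r
        using mult_right_mono[OF E2(2)[of r], of "\<bar>e r\<bar>"] that t Epos[of r]
        by (simp add: abs_divide)
    qed (use t in \<open>intro pc_integrable_sub[of 0 L] pc_mult pc_abs pc_const pc_continuous e eE; simp\<close>)+
    also have "\<dots> = \<eta> * integral {0..t} (\<lambda>r. \<bar>e r\<bar>)" by simp
    also have "\<dots> \<le> \<eta> * (sqrt L * nrm L e)"
      using t \<eta>1 L e by (intro mult_left_mono integral_abs_le_nrm pc_continuous) auto
    finally show ?thesis by (simp add: Q_def J_def mult.assoc)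
  qed
  have pEA: "pc 0 L (\<lambda>t. E t / A t)"
    by (rule pc_divide[OF pwC1_pc[OF Ep] A(1,2) \<kappa>0 A(3)])
  have Apos: "0 < A t" if "t \<in> {0..L} - Z" for t
    using A(3)[OF that] \<kappa>0 by linarith
  have EAnn: "0 \<le> E t / A t" if "t \<in> {0..L} - Z" for t
    using Apos[OF that] Epos[of t] by simp
  have pEAJ: "pc 0 L (\<lambda>t. E t / A t * J t)"
    by (rule pc_mult[OF pEA pwC1_pc[OF Jp]])
  define D where "D = integral {0..L} (\<lambda>t. E t / A t)"
  have JQ': "J t \<le> Q \<and> - Q \<le> J t" if "t \<in> {0..L}" for t
    using JQ[OF that] by linarith
  have up: "integral {0..L} (\<lambda>t. E t / A t * J t) \<le> integral {0..L} (\<lambda>t. E t / A t * Q)"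
    using JQ' EAnn by (intro integral_mono_finite[OF pc_integrable[OF pEAJ] _ A(2)]
        pc_integrable pc_mult pEA mult_left_mono pc_const; auto)
  have lo: "integral {0..L} (\<lambda>t. E t / A t * - Q) \<le> integral {0..L} (\<lambda>t. E t / A t * J t)"
    using JQ' EAnn by (intro integral_mono_finite[OF _ pc_integrable[OF pEAJ] A(2)]
        pc_integrable pc_mult pEA mult_left_mono pc_const; auto)
  have Dnn: "0 \<le> D"
    unfolding D_def using EAnn by (intro integral_nonneg_finite[OF pc_integrable[OF pEA] A(2)])
  have up': "integral {0..L} (\<lambda>t. E t / A t * J t) \<le> D * Q"
    and lo': "- (D * Q) \<le> integral {0..L} (\<lambda>t. E t / A t * J t)"
    using up lo integral_mult_left[of "{0..L}" "\<lambda>t. E t / A t" Q]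
      integral_mult_left[of "{0..L}" "\<lambda>t. E t / A t" "- Q"]
    by (auto simp: D_def)
  have Q0: "0 \<le> Q" using \<eta>1 L by (simp add: Q_def)
  have cQ: "\<bar>c\<bar> \<le> Q"
  proof (cases "D = 0")
    case True then show ?thesis using Q0 by (simp add: c_def D_def)
  next
    case False
    then have "D > 0" using Dnn by simp
    then show ?thesis using up' lo'
      by (simp add: c_def abs_le_iff divide_le_eq le_divide_eq minus_divide_left mult.commute flip: D_def)
  qed
  \<comment> \<open>If D = 0, the two bounds squeeze the integral on the right to 0, in agreement
    with the default value 0 of the quotient that defines \<open>c\<close>.\<close>
  have cD: "c * D = integral {0..L} (\<lambda>t. E t / A t * J t)"
    using up' lo' by (cases "D = 0") (auto simp: c_def simp flip: D_def)
  have "pwC1 0 L (\<lambda>t. E t * (c - J t)) (\<lambda>t. (E t * b t) * (c - J t) + E t * (0 - e t / E t))"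
    by (intro pwC1_mult pwC1_diff pwC1_const Ep Jp)
  moreover have "(\<lambda>t. (E t * b t) * (c - J t) + E t * (0 - e t / E t)) = (\<lambda>t. b t * \<sigma> t - e t)"
    using Epos by (intro ext) (simp add: \<sigma>_def less_imp_neq[symmetric])
  ultimately have 1: "pwC1 0 L \<sigma> (\<lambda>t. b t * \<sigma> t - e t)"
    by (simp only: \<sigma>_def[symmetric])
  have 2: "\<bar>\<sigma> t\<bar> \<le> 2 * \<eta>\<^sup>2 * sqrt L * nrm L e" if t: "t \<in> {0..L}" for t
  proof -
    have "\<bar>\<sigma> t\<bar> = E t * \<bar>c - J t\<bar>" using Epos[of t] by (simp add: \<sigma>_def abs_mult)
    \<comment> \<open>One factor \<open>\<eta>\<close> bounds E, the other bounds 1 / E and sits in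
      \<open>Q\<close>; the 2 adds the bounds for c and J.\<close>
    also have "\<dots> \<le> \<eta> * (2 * Q)"
      using E2[OF t] JQ[OF t] cQ Epos[of t] \<eta>1 by (intro mult_mono) auto
    finally show ?thesis by (simp add: Q_def power2_eq_square)
  qed
  have "integral {0..L} (\<lambda>t. \<sigma> t / A t) = integral {0..L} (\<lambda>t. c * (E t / A t) - E t / A t * J t)"
    by (intro integral_cong) (simp add: \<sigma>_def algebra_simps diff_divide_distrib)
  also have "\<dots> = c * D - integral {0..L} (\<lambda>t. E t / A t * J t)"
    unfolding D_def by (rule integral_unique)
      (intro has_integral_diff has_integral_mult_right integrable_integral pc_integrable pEA pEAJ)
  finally have 3: "integral {0..L} (\<lambda>t. \<sigma> t / A t) = 0" using cD by simp
  from that[OF 1 _ 3] 2 show ?thesis by (simp add: \<eta>_def)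
qed

text \<open>Used for three partitions: the given mesh, the breakpoints of the coefficient, and the
  common refinement of both.\<close>

definition is_mesh :: "real \<Rightarrow> nat \<Rightarrow> (nat \<Rightarrow> real) \<Rightarrow> bool" where
  "is_mesh L M y \<longleftrightarrow> strict_mono_on {..M} y \<and> y 0 = 0 \<and> y M = L"

lemma is_meshD:
  assumes "is_mesh L M y"
  shows "mono_on {..M} y" "y 0 = 0" "y M = L" "i < M \<Longrightarrow> y i < y (Suc i)"
    "i \<le> M \<Longrightarrow> 0 \<le> y i" "i \<le> M \<Longrightarrow> y i \<le> L"
proof -
  have s: "strict_mono_on {..M} y" using assms by (simp add: is_mesh_def)
  then show m: "mono_on {..M} y" by (rule strict_mono_on_imp_mono_on)
  show "y 0 = 0" "y M = L" using assms by (auto simp: is_mesh_def)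
  then show "i \<le> M \<Longrightarrow> 0 \<le> y i" "i \<le> M \<Longrightarrow> y i \<le> L"
    using mono_onD[OF m, of 0 i] mono_onD[OF m, of i M] by auto
  show "i < M \<Longrightarrow> y i < y (Suc i)" using strict_mono_onD[OF s, of i "Suc i"] by auto
qed

lemma integral_is_mesh:
  fixes f :: "real \<Rightarrow> real"
  assumes "is_mesh L M y" "f integrable_on {0..L}"
  shows "integral {0..L} f = (\<Sum>i<M. integral {y i..y (Suc i)} f)"
  using integral_mesh_sum[of f y M] is_meshD[OF assms(1)] assms(2) by simp

text \<open>Since \<phi> has mean zero, its cell means form a cellwise constant function of total
  integral zero, and \<open>orth\<close> says that F does not see such functions. So \<phi> may be
  replaced by its deviation from the cell means. On each cell the oscillation bound gives a factor
  h, and a second Cauchy-Schwarz inequality sums over the cells. The function \<omega> plays the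
  part of |\<phi>'|.\<close>

lemma mesh_mean_estimate:
  fixes \<phi> \<omega> F :: "real \<Rightarrow> real"
  assumes y: "is_mesh L M y" "\<And>i. i < M \<Longrightarrow> y (Suc i) - y i \<le> h" and h: "0 \<le> h"
    and pc: "pc 0 L \<phi>" "pc 0 L \<omega>" "pc 0 L F" and Z: "finite Z"
    and osc: "\<And>i s t. i < M \<Longrightarrow> s \<in> {y i<..<y (Suc i)} - Z \<Longrightarrow> t \<in> {y i<..<y (Suc i)} - Z \<Longrightarrow>
      \<bar>\<phi> t - \<phi> s\<bar> \<le> integral {y i..y (Suc i)} \<omega>"
    and \<omega>: "\<And>t. t \<in> {0..L} \<Longrightarrow> 0 \<le> \<omega> t"
    and orth: "\<And>\<psi>. (\<Sum>i<M. \<psi> i * (y (Suc i) - y i)) = 0 \<Longrightarrow>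
      (\<Sum>i<M. \<psi> i * integral {y i..y (Suc i)} F) = 0"
    and mean: "integral {0..L} \<phi> = 0"
  shows "\<bar>integral {0..L} (\<lambda>t. F t * \<phi> t)\<bar> \<le> h * nrm L F * nrm L \<omega>"
proof -
  note yD = is_meshD[OF y(1)]
  define m where "m i = integral {y i..y (Suc i)} \<phi> / (y (Suc i) - y i)" for i
  define f where "f i = sqrt (integral {y i..y (Suc i)} (\<lambda>t. (F t)\<^sup>2))" for i
  define w where "w i = sqrt (integral {y i..y (Suc i)} (\<lambda>t. (\<omega> t)\<^sup>2))" for i
  have sub: "pc (y i) (y (Suc i)) g" if "pc 0 L g" "i < M" for i g
    using pc_mono[OF that(1) yD(5)[of i] yD(6)[of "Suc i"]] that(2) by simp
  have L2: "L2_set (\<lambda>i. sqrt (integral {y i..y (Suc i)} (\<lambda>t. (g t)\<^sup>2))) {..<M} = nrm L g" if g: "pc 0 L g" for g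
  proof -
    have "(sqrt (integral {y i..y (Suc i)} (\<lambda>t. (g t)\<^sup>2)))\<^sup>2 = integral {y i..y (Suc i)} (\<lambda>t. (g t)\<^sup>2)"
      if "i < M" for i
      by (intro real_sqrt_pow2 integral_nonneg pc_integrable pc_power2 sub that g) simp
    then show ?thesis
      unfolding L2_set_def nrm_def
      by (simp add: integral_is_mesh[OF y(1) pc_integrable[OF pc_power2[OF g]]])
  qed
  have "(\<Sum>i<M. m i * (y (Suc i) - y i)) = (\<Sum>i<M. integral {y i..y (Suc i)} \<phi>)"
  proof (rule sum.cong)
    show "m i * (y (Suc i) - y i) = integral {y i..y (Suc i)} \<phi>" if "i \<in> {..<M}" for i
      using yD(4)[of i] that by (simp add: m_def)
  qed simp
  also have "\<dots> = 0"
    using integral_is_mesh[OF y(1) pc_integrable[OF pc(1)]] mean by simp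
  finally have z: "(\<Sum>i<M. m i * integral {y i..y (Suc i)} F) = 0"
    by (rule orth)
  have cell: "integral {y i..y (Suc i)} (\<lambda>t. F t * \<phi> t) =
      integral {y i..y (Suc i)} (\<lambda>t. F t * (\<phi> t - m i)) + m i * integral {y i..y (Suc i)} F"
    if i: "i < M" for i
  proof -
    have "((\<lambda>t. F t * \<phi> t - m i * F t) has_integral
      (integral {y i..y (Suc i)} (\<lambda>t. F t * \<phi> t) - m i * integral {y i..y (Suc i)} F)) {y i..y (Suc i)}"
      by (intro has_integral_diff has_integral_mult_right integrable_integral pc_integrable sub
          pc_mult pc i)
    then have "integral {y i..y (Suc i)} (\<lambda>t. F t * \<phi> t - m i * F t) =
      (integral {y i..y (Suc i)} (\<lambda>t. F t * \<phi> t) - m i * integral {y i..y (Suc i)} F)"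
      by (rule integral_unique)
    then show ?thesis by (simp add: algebra_simps)
  qed
  have est: "\<bar>integral {y i..y (Suc i)} (\<lambda>t. F t * (\<phi> t - m i))\<bar> \<le> h * (f i * w i)"
    if i: "i < M" for i
  proof -
    let ?a = "y i" and ?b = "y (Suc i)"
    have ab: "?a < ?b" using yD(4)[OF i] .
    have W: "(integral {?a..?b} \<omega>)\<^sup>2 \<le> (?b - ?a) * integral {?a..?b} (\<lambda>t. (\<omega> t)\<^sup>2)"
    proof -
      have "integral {?a..?b} (\<lambda>t. \<bar>\<omega> t\<bar>) = integral {?a..?b} \<omega>"
        using \<omega> yD(5)[of i] yD(6)[of "Suc i"] i by (intro integral_cong) auto
      then show ?thesis
        using integral_abs_square_le[of ?a ?b \<omega>] ab sub[OF pc(2) i]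
        by (auto intro: pc_integrable)
    qed
    have "(integral {?a..?b} (\<lambda>t. F t * (\<phi> t - m i)))\<^sup>2 \<le>
       integral {?a..?b} (\<lambda>t. (F t)\<^sup>2) * integral {?a..?b} (\<lambda>t. (\<phi> t - m i)\<^sup>2)"
      by (intro integral_Cauchy_Schwarz pc_integrable pc_power2 pc_mult pc_diff pc_const sub pc i)
    also have "\<dots> \<le> integral {?a..?b} (\<lambda>t. (F t)\<^sup>2) * ((?b - ?a)\<^sup>2 * integral {?a..?b} (\<lambda>t. (\<omega> t)\<^sup>2))"
      unfolding m_def
      by (intro mult_left_mono cell_mean_estimate[OF ab sub[OF pc(1) i] Z osc[OF i] W]
          integral_nonneg pc_integrable pc_power2 sub pc i) auto
    also have "\<dots> \<le> integral {?a..?b} (\<lambda>t. (F t)\<^sup>2) * (h\<^sup>2 * integral {?a..?b} (\<lambda>t. (\<omega> t)\<^sup>2))"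
      using ab y(2)[OF i] by (intro mult_left_mono mult_right_mono power_mono
          integral_nonneg pc_integrable pc_power2 sub pc i) auto
    also have "\<dots> = (h * (f i * w i))\<^sup>2"
    proof -
      have "0 \<le> integral {?a..?b} (\<lambda>t. (F t)\<^sup>2)" "0 \<le> integral {?a..?b} (\<lambda>t. (\<omega> t)\<^sup>2)"
        by (intro integral_nonneg pc_integrable pc_power2 sub pc i; simp)+
      then show ?thesis by (simp add: f_def w_def power_mult_distrib)
    qed
    finally have "\<bar>integral {?a..?b} (\<lambda>t. F t * (\<phi> t - m i))\<bar> \<le> \<bar>h * (f i * w i)\<bar>"
      by (simp only: abs_le_square_iff)
    moreover have "0 \<le> f i" "0 \<le> w i"
      unfolding f_def w_def
      by (intro real_sqrt_ge_zero integral_nonneg pc_integrable pc_power2 sub pc i; simp)+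
    ultimately show ?thesis
      using h by (simp add: abs_mult)
  qed
  have "integral {0..L} (\<lambda>t. F t * \<phi> t) = (\<Sum>i<M. integral {y i..y (Suc i)} (\<lambda>t. F t * \<phi> t))"
    by (intro integral_is_mesh[OF y(1)] pc_integrable pc_mult pc)
  also have "\<dots> = (\<Sum>i<M. integral {y i..y (Suc i)} (\<lambda>t. F t * (\<phi> t - m i)))"
    using z by (simp add: cell sum.distrib)
  also have "\<bar>\<dots>\<bar> \<le> (\<Sum>i<M. h * (f i * w i))"
    by (rule order_trans[OF sum_abs]) (auto intro!: sum_mono est)
  also have "\<dots> \<le> h * (\<Sum>i<M. \<bar>f i\<bar> * \<bar>w i\<bar>)"
    unfolding sum_distrib_left[symmetric] using h
    by (intro mult_left_mono sum_mono) (auto simp flip: abs_mult)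
  also have "\<dots> \<le> h * (L2_set f {..<M} * L2_set w {..<M})"
    by (intro mult_left_mono L2_set_mult_ineq h)
  also have "L2_set f {..<M} = nrm L F"
    using L2[OF pc(3)] by (simp add: f_def[abs_def])
  also have "L2_set w {..<M} = nrm L \<omega>"
    using L2[OF pc(2)] by (simp add: w_def[abs_def])
  finally show ?thesis by (simp add: mult.assoc)
qed

text \<open>Origin of the constants: the adjoint coefficient b = (d / e) / A is at most \<beta> /
  \<kappa>0, which gives the exponential in the maximum bound S for \<sigma>. In the oscillation of
  \<sigma> / A on a cell, the term b \<sigma> of \<sigma>' contributes S \<beta> / \<kappa>0^2 and
  the oscillation of A contributes S \<Lambda> / \<kappa>0^2; their sum is P times
  \<open>nrm L e\<close>. The summand 1 / \<kappa>0 stems from the source e of the adjoint equation.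
  The function z stands for the derivative of the discrete solution, R for its energy bound, and
  \<kappa>1 + \<beta> L for the norm of the flux difference relative to e', by the Poincare
  inequality.\<close>

lemma dual_estimate:
  fixes L \<kappa>0 \<kappa>1 \<beta> \<Lambda> R h :: real
  defines "P \<equiv> 2 * (exp (\<beta> / \<kappa>0 * L))\<^sup>2 * sqrt L * ((\<beta> + \<Lambda>) / \<kappa>0\<^sup>2)"
  assumes y: "is_mesh L M y" "\<And>i. i < M \<Longrightarrow> y (Suc i) - y i \<le> h" and L: "0 < L"
    and cs: "0 < \<kappa>0" "0 \<le> \<kappa>1" "0 \<le> \<beta>" "0 \<le> \<Lambda>" "0 \<le> R" "0 \<le> h"
    and e: "pwC1 0 L e e'" "e 0 = 0" "e L = 0"
    and Z: "finite Z"
    and A: "pc 0 L A" "\<And>t. t \<in> {0..L} - Z \<Longrightarrow> \<kappa>0 \<le> A t" "\<And>t. t \<in> {0..L} - Z \<Longrightarrow> A t \<le> \<kappa>1"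
    and z: "pc 0 L z" "nrm L z \<le> R"
    and Aosc: "\<And>i s t. i < M \<Longrightarrow> s \<in> {y i<..<y (Suc i)} - Z \<Longrightarrow> t \<in> {y i<..<y (Suc i)} - Z \<Longrightarrow>
      \<bar>A t - A s\<bar> \<le> \<Lambda> * integral {y i..y (Suc i)} (\<lambda>r. 1 + \<bar>z r\<bar>)"
    and d: "pc 0 L d" "\<And>t. t \<in> {0..L} - Z \<Longrightarrow> \<bar>d t\<bar> \<le> \<beta> * \<bar>e t\<bar>"
    and orth: "\<And>\<psi>. (\<Sum>i<M. \<psi> i * (y (Suc i) - y i)) = 0 \<Longrightarrow>
      (\<Sum>i<M. \<psi> i * integral {y i..y (Suc i)} (\<lambda>t. A t * e' t + d t)) = 0"
  shows "nrm L (\<lambda>t. A t * e' t + d t) \<le> (\<kappa>1 + \<beta> * L) * nrm L e'"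
    and "nrm L e \<le> (\<kappa>1 + \<beta> * L) * (P * (sqrt L + R) + 1 / \<kappa>0) * h * nrm L e'"
proof -
  define F where "F = (\<lambda>t. A t * e' t + d t)"
  define Q where "Q = P * (sqrt L + R) + 1 / \<kappa>0"
  define N where "N = nrm L e"
  define S where "S = 2 * (exp (\<beta> / \<kappa>0 * L))\<^sup>2 * sqrt L * N"
  have ec: "continuous_on {0..L} e" and ep: "pc 0 L e" and e'p: "pc 0 L e'"
    using pwC1D[OF e(1)] by auto
  have Fp: "pc 0 L F"
    unfolding F_def by (intro pc_add pc_mult A e'p d)
  have N0: "0 \<le> N" by (simp add: N_def)
  have S0: "0 \<le> S" using L N0 by (simp add: S_def)
  have P0: "0 \<le> P" using L cs by (simp add: P_def)
  have Q0: "0 \<le> Q" using P0 L cs by (simp add: Q_def)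
  have Apos: "0 < A t" if "t \<in> {0..L} - Z" for t
    using A(2)[OF that] cs by linarith
  show NF: "nrm L (\<lambda>t. A t * e' t + d t) \<le> (\<kappa>1 + \<beta> * L) * nrm L e'"
  proof -
    have "nrm L (\<lambda>t. A t * e' t) \<le> nrm L (\<lambda>t. \<kappa>1 * e' t)"
      using A(3) Apos cs by (intro nrm_mono[OF _ _ Z] pc_mult A e'p)
        (auto simp: abs_mult less_imp_le intro!: mult_right_mono)
    moreover have "nrm L d \<le> nrm L (\<lambda>t. \<beta> * e t)"
      using d cs by (intro nrm_mono[OF _ _ Z] pc_mult d ep) (auto simp: abs_mult)
    moreover have "\<beta> * nrm L e \<le> \<beta> * (L * nrm L e')"
      using pwC1_Poincare(2)[OF _ e(1,2)] L cs by (intro mult_left_mono) auto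
    moreover have "nrm L (\<lambda>t. A t * e' t + d t) \<le> nrm L (\<lambda>t. A t * e' t) + nrm L d"
      by (intro nrm_triangle pc_mult A e'p d)
    ultimately show ?thesis
      using cs by (simp add: nrm_scale e'p ep algebra_simps)
  qed
  \<comment> \<open>The bound for N^2 that remains when the regularisation is removed: h times the
    bound for F times the bound for \<omega>.\<close>
  define X where "X = h * ((\<kappa>1 + \<beta> * L) * nrm L e') * (Q * N)"
  have step: "N\<^sup>2 \<le> X + \<epsilon> * (\<beta> * L * S / \<kappa>0)" if \<epsilon>: "0 < \<epsilon>" for \<epsilon>
  proof -
    text \<open>The regularised quotient \<open>d / e\<close>, piecewise continuous also at the zeros of \<open>e\<close>.\<close>
    define q where "q = (\<lambda>t. d t * e t / ((e t)\<^sup>2 + \<epsilon>\<^sup>2))"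
    define b where "b = (\<lambda>t. q t / A t)"
    define \<rho> where "\<rho> = (\<lambda>t. d t - q t * e t)"
    have den: "0 < (e t)\<^sup>2 + \<epsilon>\<^sup>2" "\<epsilon>\<^sup>2 \<le> (e t)\<^sup>2 + \<epsilon>\<^sup>2" "(e t)\<^sup>2 \<le> (e t)\<^sup>2 + \<epsilon>\<^sup>2" for t
      using \<epsilon> by (auto intro: add_nonneg_pos)
    have qp: "pc 0 L q"
      unfolding q_def using den \<epsilon>
      by (intro pc_divide[where Z = "{}" and c = "\<epsilon>\<^sup>2"] pc_mult pc_add pc_power2 d ep) auto
    have qb: "\<bar>q t\<bar> \<le> \<beta>" if "t \<in> {0..L} - Z" for t
    proof -
      have "\<bar>d t * e t\<bar> \<le> \<beta> * \<bar>e t\<bar> * \<bar>e t\<bar>"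
        using d(2)[OF that] by (simp add: abs_mult mult_right_mono)
      also have "\<dots> = \<beta> * (e t)\<^sup>2" by (simp add: power2_eq_square abs_mult_self_eq mult.assoc)
      also have "\<dots> \<le> \<beta> * ((e t)\<^sup>2 + \<epsilon>\<^sup>2)" using den cs by (intro mult_left_mono) auto
      finally show ?thesis
        using den(1)[of t] by (simp add: q_def abs_divide divide_le_eq)
    qed
    have bp: "pc 0 L b"
      unfolding b_def by (rule pc_divide[OF qp A(1) Z cs(1) A(2)])
    have bb: "\<bar>b t\<bar> \<le> \<beta> / \<kappa>0" if "t \<in> {0..L} - Z" for t
      using qb[OF that] A(2)[OF that] Apos[OF that] cs
      by (auto simp: b_def abs_divide intro!: frac_le)
    have \<rho>p: "pc 0 L \<rho>"
      unfolding \<rho>_def by (intro pc_diff pc_mult d qp ep)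
    \<comment> \<open>The defect equals d \<epsilon>^2 / (e^2 + \<epsilon>^2). With |d| \<le>
      \<beta> |e| it is small, because |e| \<epsilon> is at most e^2 + \<epsilon>^2.\<close>
    have \<rho>b: "\<bar>\<rho> t\<bar> \<le> \<beta> * \<epsilon>" if "t \<in> {0..L} - Z" for t
    proof -
      define X where "X = (e t)\<^sup>2 + \<epsilon>\<^sup>2"
      have "X \<noteq> 0" using den(1)[of t] unfolding X_def by linarith
      then have "\<rho> t = (d t * X - d t * e t * e t) / X"
        by (simp add: \<rho>_def q_def X_def[symmetric] diff_divide_distrib)
      also have "d t * X - d t * e t * e t = d t * \<epsilon>\<^sup>2"
        by (simp add: X_def power2_eq_square algebra_simps)
      finally have eq: "\<rho> t = d t * \<epsilon>\<^sup>2 / ((e t)\<^sup>2 + \<epsilon>\<^sup>2)" by (simp add: X_def)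
      have "\<bar>d t * \<epsilon>\<^sup>2\<bar> \<le> \<beta> * \<bar>e t\<bar> * \<epsilon>\<^sup>2"
        using d(2)[OF that] by (simp add: abs_mult mult_right_mono)
      also have "\<dots> = \<beta> * \<epsilon> * (\<bar>e t\<bar> * \<epsilon>)" by (simp add: power2_eq_square)
      also have "\<dots> \<le> \<beta> * \<epsilon> * ((e t)\<^sup>2 + \<epsilon>\<^sup>2)"
      proof (rule mult_left_mono)
        have "0 \<le> \<bar>e t\<bar> * \<epsilon>" using \<epsilon> by simp
        then show "\<bar>e t\<bar> * \<epsilon> \<le> (e t)\<^sup>2 + \<epsilon>\<^sup>2"
          using sum_squares_bound[of "\<bar>e t\<bar>" \<epsilon>] by (simp add: mult.assoc)
      qed (use cs \<epsilon> in simp)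
      finally show ?thesis
        using den(1)[of t] cs \<epsilon> by (simp add: eq abs_divide divide_le_eq)
    qed
    obtain \<sigma> where \<sigma>: "pwC1 0 L \<sigma> (\<lambda>t. b t * \<sigma> t - e t)"
      "\<And>t. t \<in> {0..L} \<Longrightarrow> \<bar>\<sigma> t\<bar> \<le> S" "integral {0..L} (\<lambda>t. \<sigma> t / A t) = 0"
      using adjoint_solution[OF L cs(1) _ A(1) Z A(2) bp bb ec] cs
      by (auto simp: S_def N_def mult.assoc)
    have \<sigma>p: "pc 0 L \<sigma>" by (rule pwC1_pc[OF \<sigma>(1)])
    define \<phi> where "\<phi> = (\<lambda>t. \<sigma> t / A t)"
    have \<phi>p: "pc 0 L \<phi>"
      unfolding \<phi>_def by (rule pc_divide[OF \<sigma>p A(1) Z cs(1) A(2)])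
    have \<phi>b: "\<bar>\<phi> t\<bar> \<le> S / \<kappa>0" if "t \<in> {0..L} - Z" for t
      using \<sigma>(2)[of t] A(2)[OF that] Apos[OF that] cs that S0
      by (auto simp: \<phi>_def abs_divide intro!: frac_le)
    text \<open>Integrating \<open>(e \<sigma>)'\<close> over the interval gives \<open>\<integral> e\<^sup>2 = \<integral> F \<phi>\<close> up to the regularisation error.\<close>
    have ident: "N\<^sup>2 = integral {0..L} (\<lambda>t. F t * \<phi> t) - integral {0..L} (\<lambda>t. \<rho> t * \<phi> t)"
    proof -
      have "((\<lambda>t. e' t * \<sigma> t + e t * (b t * \<sigma> t - e t)) has_integral 0) {0..L}"
        using pwC1_has_integral[OF pwC1_mult[OF e(1) \<sigma>(1)], of 0 L] e L by simp
      then have h1: "((\<lambda>t. (e' t * \<sigma> t + e t * (b t * \<sigma> t - e t)) + (e t)\<^sup>2) has_integral (0 + N\<^sup>2)) {0..L}"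
        unfolding N_def nrm_square[OF ep]
        by (intro has_integral_add integrable_integral pc_integrable pc_power2 ep)
      have h2: "((\<lambda>t. F t * \<phi> t - \<rho> t * \<phi> t) has_integral
        (integral {0..L} (\<lambda>t. F t * \<phi> t) - integral {0..L} (\<lambda>t. \<rho> t * \<phi> t))) {0..L}"
        by (intro has_integral_diff integrable_integral pc_integrable pc_mult Fp \<rho>p \<phi>p)
      have h3: "F t * \<phi> t - \<rho> t * \<phi> t = (e' t * \<sigma> t + e t * (b t * \<sigma> t - e t)) + (e t)\<^sup>2"
        if "t \<in> {0..L} - Z" for t
      proof -
        have "F t - \<rho> t = A t * e' t + q t * e t"
          by (simp add: F_def \<rho>_def)
        then have "F t * \<phi> t - \<rho> t * \<phi> t = (A t * e' t + q t * e t) * \<phi> t"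
          by (simp only: left_diff_distrib[symmetric])
        also have "\<dots> = e' t * (A t * \<phi> t) + e t * (q t * \<phi> t)"
          by (simp add: algebra_simps)
        also have "A t * \<phi> t = \<sigma> t"
          using Apos[OF that] by (simp add: \<phi>_def)
        also have "q t * \<phi> t = b t * \<sigma> t"
          by (simp add: \<phi>_def b_def)
        finally show ?thesis by (simp add: algebra_simps power2_eq_square)
      qed
      show ?thesis
        using has_integral_unique[OF h2 has_integral_spike_finite[OF Z h3 h1]] by simp
    qed
    \<comment> \<open>A substitute for |\<phi>'|: the first summand pays for b \<sigma> and for the
      oscillation of A, the second for the source e.\<close>
    define \<omega> where "\<omega> = (\<lambda>t. P * N * (1 + \<bar>z t\<bar>) + 1 / \<kappa>0 * \<bar>e t\<bar>)"
    have \<omega>p: "pc 0 L \<omega>"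
      unfolding \<omega>_def by (intro pc_add pc_mult pc_abs pc_const z ep)
    have \<phi>osc: "\<bar>\<phi> t - \<phi> s\<bar> \<le> integral {y i..y (Suc i)} \<omega>"
      if i: "i < M" and s: "s \<in> {y i<..<y (Suc i)} - Z" and t: "t \<in> {y i<..<y (Suc i)} - Z" for i s t
    proof -
      note yD = is_meshD[OF y(1)]
      have yi: "0 \<le> y i" "y i \<le> y (Suc i)" "y (Suc i) \<le> L"
        using yD(4,5)[of i] yD(6)[of "Suc i"] i by auto
      have sub: "g integrable_on {y i..y (Suc i)}" if "pc 0 L g" for g
        using pc_integrable_sub[OF that yi(1,3)] .
      have sL: "s \<in> {0..L} - Z" and tL: "t \<in> {0..L} - Z" using s t yi by auto
      note Ast = Apos[OF sL] Apos[OF tL] A(2)[OF sL] A(2)[OF tL]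
      define I where "I = integral {y i..y (Suc i)} (\<lambda>r. 1 + \<bar>z r\<bar>)"
      define K where "K = integral {y i..y (Suc i)} (\<lambda>r. \<bar>e r\<bar>)"
      have I0: "0 \<le> I"
        unfolding I_def by (intro integral_nonneg sub pc_add pc_abs pc_const z) simp
      have int1: "\<bar>\<sigma> t - \<sigma> s\<bar> \<le> \<beta> / \<kappa>0 * S * I + K"
      proof -
        have "\<bar>\<sigma> t - \<sigma> s\<bar> \<le> integral {y i..y (Suc i)} (\<lambda>r. \<bar>b r * \<sigma> r - e r\<bar>)"
          using s t yi by (intro pwC1_osc[OF \<sigma>(1)]) auto
        also have "\<dots> \<le> integral {y i..y (Suc i)} (\<lambda>r. \<beta> / \<kappa>0 * S * (1 + \<bar>z r\<bar>) + \<bar>e r\<bar>)"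
        proof (rule integral_mono_finite[OF _ _ Z])
          show "(\<lambda>r. \<bar>b r * \<sigma> r - e r\<bar>) integrable_on {y i..y (Suc i)}"
            by (intro sub pc_abs pc_diff pc_mult bp \<sigma>p ep)
          show "(\<lambda>r. \<beta> / \<kappa>0 * S * (1 + \<bar>z r\<bar>) + \<bar>e r\<bar>) integrable_on {y i..y (Suc i)}"
            by (intro sub pc_abs pc_add pc_mult pc_const z ep)
          fix r assume r: "r \<in> {y i..y (Suc i)} - Z"
          then have rL: "r \<in> {0..L} - Z" using yi by auto
          have "\<bar>b r\<bar> * \<bar>\<sigma> r\<bar> \<le> \<beta> / \<kappa>0 * S"
            using bb[OF rL] \<sigma>(2)[of r] rL cs by (intro mult_mono) auto
          also have "\<dots> \<le> \<beta> / \<kappa>0 * S * (1 + \<bar>z r\<bar>)"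
            using cs S0 mult_left_mono[of 1 "1 + \<bar>z r\<bar>" "\<beta> / \<kappa>0 * S"] by simp
          finally have "\<bar>b r * \<sigma> r\<bar> \<le> \<beta> / \<kappa>0 * S * (1 + \<bar>z r\<bar>)" by (simp add: abs_mult)
          then show "\<bar>b r * \<sigma> r - e r\<bar> \<le> \<beta> / \<kappa>0 * S * (1 + \<bar>z r\<bar>) + \<bar>e r\<bar>"
            by linarith
        qed
        also have "\<dots> = \<beta> / \<kappa>0 * S * I + K"
          unfolding I_def K_def
          by (rule integral_unique)
            (intro has_integral_add has_integral_mult_right integrable_integral sub pc_add pc_abs pc_const z ep)
        finally show ?thesis .
      qed
      have int2: "integral {y i..y (Suc i)} \<omega> = P * N * I + 1 / \<kappa>0 * K"
        unfolding I_def K_def \<omega>_def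
        by (rule integral_unique)
          (intro has_integral_add has_integral_mult_right integrable_integral sub pc_add pc_abs pc_const z ep)
      \<comment> \<open>The increment of a quotient, split so that each summand contains the
        increment of one factor only.\<close>
      have "\<phi> t - \<phi> s = (\<sigma> t - \<sigma> s) / A t + \<sigma> s * (A s - A t) / (A s * A t)"
        using Ast by (simp add: \<phi>_def field_simps)
      also have "\<bar>\<dots>\<bar> \<le> \<bar>\<sigma> t - \<sigma> s\<bar> / A t + \<bar>\<sigma> s\<bar> * \<bar>A s - A t\<bar> / (A s * A t)"
        using Ast by (intro order_trans[OF abs_triangle_ineq]) (simp add: abs_mult abs_divide)
      also have "\<dots> \<le> (\<beta> / \<kappa>0 * S * I + K) / \<kappa>0 + S * (\<Lambda> * I) / (\<kappa>0 * \<kappa>0)"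
      proof (intro add_mono frac_le mult_mono)
        show "\<bar>A s - A t\<bar> \<le> \<Lambda> * I"
          using Aosc[OF i t s] by (simp add: I_def)
        show "0 \<le> \<beta> / \<kappa>0 * S * I + K" using int1 by linarith
        show "0 \<le> S * (\<Lambda> * I)" using S0 I0 cs by simp
      qed (use Ast cs int1 \<sigma>(2)[of s] sL S0 in auto)
      also have "\<dots> = S * ((\<beta> + \<Lambda>) / \<kappa>0\<^sup>2) * I + 1 / \<kappa>0 * K"
        using cs by (simp add: field_simps power2_eq_square)
      also have "S * ((\<beta> + \<Lambda>) / \<kappa>0\<^sup>2) = P * N"
        by (simp add: S_def P_def)
      finally show ?thesis by (simp add: int2)
    qed
    have \<omega>n: "nrm L \<omega> \<le> Q * N"
    proof -
      have "nrm L (\<lambda>t. 1 + \<bar>z t\<bar>) \<le> nrm L (\<lambda>t. 1) + nrm L (\<lambda>t. \<bar>z t\<bar>)"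
        by (intro nrm_triangle pc_abs pc_const z)
      also have "\<dots> \<le> sqrt L + R"
        using z(2) L by (simp add: nrm_const)
      finally have n1: "nrm L (\<lambda>t. 1 + \<bar>z t\<bar>) \<le> sqrt L + R" .
      have "nrm L \<omega> \<le> nrm L (\<lambda>t. P * N * (1 + \<bar>z t\<bar>)) + nrm L (\<lambda>t. 1 / \<kappa>0 * \<bar>e t\<bar>)"
        unfolding \<omega>_def by (intro nrm_triangle pc_add pc_mult pc_abs pc_const z ep)
      also have "\<dots> = P * N * nrm L (\<lambda>t. 1 + \<bar>z t\<bar>) + 1 / \<kappa>0 * N"
        using P0 N0 cs
        by (subst (1 2) nrm_scale) (auto simp: N_def intro!: pc_add pc_abs z ep)
      also have "\<dots> \<le> P * N * (sqrt L + R) + 1 / \<kappa>0 * N"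
        using P0 N0 by (intro add_right_mono mult_left_mono n1) auto
      finally show ?thesis using P0 N0 by (simp add: Q_def algebra_simps)
    qed
    have "integral {0..L} (\<lambda>t. F t * \<phi> t) \<le> h * nrm L F * nrm L \<omega>"
      using orth P0 N0 cs \<sigma>(3)
      by (intro order_trans[OF abs_ge_self mesh_mean_estimate[OF y cs(6) \<phi>p \<omega>p Fp Z \<phi>osc]])
        (auto simp: \<omega>_def F_def \<phi>_def)
    also have "\<dots> \<le> X"
      unfolding X_def using NF \<omega>n cs Q0 N0 L
      by (intro mult_mono mult_nonneg_nonneg) (auto simp: F_def)
    finally have 1: "integral {0..L} (\<lambda>t. F t * \<phi> t) \<le> X" .
    have "integral {0..L} (\<lambda>t. - (\<rho> t * \<phi> t)) \<le> integral {0..L} (\<lambda>t. \<beta> * \<epsilon> * (S / \<kappa>0))"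
    proof (rule integral_mono_finite[OF _ _ Z])
      fix t assume t: "t \<in> {0..L} - Z"
      have "\<bar>\<rho> t * \<phi> t\<bar> \<le> \<beta> * \<epsilon> * (S / \<kappa>0)"
        unfolding abs_mult using \<rho>b[OF t] \<phi>b[OF t] cs \<epsilon> by (intro mult_mono) auto
      then show "- (\<rho> t * \<phi> t) \<le> \<beta> * \<epsilon> * (S / \<kappa>0)" by linarith
    qed (auto intro!: pc_integrable pc_minus pc_mult \<rho>p \<phi>p)
    then have 2: "- integral {0..L} (\<lambda>t. \<rho> t * \<phi> t) \<le> \<epsilon> * (\<beta> * L * S / \<kappa>0)"
      using L by (simp add: mult_ac)
    show ?thesis using ident 1 2 by linarith
  qed
  have NX: "N\<^sup>2 \<le> X"
  proof (rule field_le_epsilon)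
    fix \<epsilon> :: real assume \<epsilon>: "0 < \<epsilon>"
    \<comment> \<open>The parameter will be \<epsilon> / (T + 1), as T may be 0.\<close>
    define T where "T = \<beta> * L * S / \<kappa>0"
    have T0: "0 \<le> T" using cs L S0 by (simp add: T_def)
    have "N\<^sup>2 \<le> X + \<epsilon> / (T + 1) * T"
      using step[of "\<epsilon> / (T + 1)"] \<epsilon> T0 by (simp add: T_def)
    also have "\<epsilon> / (T + 1) * T \<le> \<epsilon>"
      using \<epsilon> T0 by (simp add: field_simps)
    finally show "N\<^sup>2 \<le> X + \<epsilon>" by simp
  qed
  show "nrm L e \<le> (\<kappa>1 + \<beta> * L) * (P * (sqrt L + R) + 1 / \<kappa>0) * h * nrm L e'"
  proof (cases "N = 0")
    case True
    then show ?thesis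
      using Q0 cs L by (auto simp: N_def[symmetric] Q_def[symmetric] intro!: mult_nonneg_nonneg)
  next
    case False
    then have "0 < N" using N0 by simp
    have "N * N \<le> (\<kappa>1 + \<beta> * L) * Q * h * nrm L e' * N"
      using NX by (simp add: X_def power2_eq_square mult_ac)
    then have "N \<le> (\<kappa>1 + \<beta> * L) * Q * h * nrm L e'"
      using \<open>0 < N\<close> by (simp only: mult_le_cancel_right_pos)
    then show ?thesis by (simp add: N_def Q_def)
  qed
qed

text \<open>Here g is the approximation error u' - v', so that e' - g = v' - uh' is the derivative
  of a discrete function, and the second hypothesis on g is Galerkin orthogonality. From A e'^2 = F
  (e' - g) + F g - d e', coercivity leaves \<open>nrm L F * nrm L g\<close> and a term with d. The
  latter is at most \<beta> K h times the square of \<open>nrm L e'\<close> and is absorbed by half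
  of the coercivity constant, which gives the factor 2 / \<kappa>0. The factor K + 1 comes from
  adding h \<open>nrm L e'\<close> to the duality bound for \<open>nrm L e\<close>.\<close>

lemma quasi_optimality:
  fixes L \<kappa>0 \<kappa>1 \<beta> \<Lambda> R h :: real
  defines "P \<equiv> 2 * (exp (\<beta> / \<kappa>0 * L))\<^sup>2 * sqrt L * ((\<beta> + \<Lambda>) / \<kappa>0\<^sup>2)"
  defines "K \<equiv> (\<kappa>1 + \<beta> * L) * (P * (sqrt L + R) + 1 / \<kappa>0)"
  assumes y: "is_mesh L M y" "\<And>i. i < M \<Longrightarrow> y (Suc i) - y i \<le> h" and L: "0 < L"
    and cs: "0 < \<kappa>0" "0 \<le> \<kappa>1" "0 \<le> \<beta>" "0 \<le> \<Lambda>" "0 \<le> R" "0 \<le> h"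
    and e: "pwC1 0 L e e'" "e 0 = 0" "e L = 0"
    and Z: "finite Z"
    and A: "pc 0 L A" "\<And>t. t \<in> {0..L} - Z \<Longrightarrow> \<kappa>0 \<le> A t" "\<And>t. t \<in> {0..L} - Z \<Longrightarrow> A t \<le> \<kappa>1"
    and z: "pc 0 L z" "nrm L z \<le> R"
    and Aosc: "\<And>i s t. i < M \<Longrightarrow> s \<in> {y i<..<y (Suc i)} - Z \<Longrightarrow> t \<in> {y i<..<y (Suc i)} - Z \<Longrightarrow>
      \<bar>A t - A s\<bar> \<le> \<Lambda> * integral {y i..y (Suc i)} (\<lambda>r. 1 + \<bar>z r\<bar>)"
    and d: "pc 0 L d" "\<And>t. t \<in> {0..L} - Z \<Longrightarrow> \<bar>d t\<bar> \<le> \<beta> * \<bar>e t\<bar>"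
    and orth: "\<And>\<psi>. (\<Sum>i<M. \<psi> i * (y (Suc i) - y i)) = 0 \<Longrightarrow>
      (\<Sum>i<M. \<psi> i * integral {y i..y (Suc i)} (\<lambda>t. A t * e' t + d t)) = 0"
    and g: "pc 0 L g" "integral {0..L} (\<lambda>t. (A t * e' t + d t) * (e' t - g t)) = 0"
    and small: "\<beta> * K * h \<le> \<kappa>0 / 2"
  shows "nrm L e + h * nrm L e' \<le> (K + 1) * (2 * (\<kappa>1 + \<beta> * L) / \<kappa>0) * h * nrm L g"
proof -
  define F where "F = (\<lambda>t. A t * e' t + d t)"
  note de = dual_estimate[OF y L cs e Z A z Aosc d orth]
  have NF: "nrm L F \<le> (\<kappa>1 + \<beta> * L) * nrm L e'"
    unfolding F_def by (rule de(1))
  have Ne: "nrm L e \<le> K * h * nrm L e'"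
    unfolding K_def P_def by (rule de(2))
  have ep: "pc 0 L e" and e'p: "pc 0 L e'" using pwC1D[OF e(1)] by auto
  have Fp: "pc 0 L F" unfolding F_def by (intro pc_add pc_mult A e'p d)
  have "0 \<le> P" using L cs by (simp add: P_def)
  then have K0: "0 \<le> K" using L cs by (simp add: K_def)
  have Nd: "nrm L d \<le> \<beta> * nrm L e"
  proof -
    have "nrm L d \<le> nrm L (\<lambda>t. \<beta> * e t)"
      using d cs by (intro nrm_mono[OF _ _ Z] pc_mult d ep) (auto simp: abs_mult)
    then show ?thesis using cs by (simp add: nrm_scale ep)
  qed
  define x where "x = nrm L e'"
  have x0: "0 \<le> x" by (simp add: x_def)
  have "\<kappa>0 * x\<^sup>2 = integral {0..L} (\<lambda>t. \<kappa>0 * (e' t)\<^sup>2)"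
    by (simp add: x_def nrm_square[OF e'p])
  also have "\<dots> \<le> integral {0..L} (\<lambda>t. A t * (e' t)\<^sup>2)"
    using A(2) by (intro integral_mono_finite[OF _ _ Z] pc_integrable pc_mult pc_power2 A e'p)
      (auto intro: mult_right_mono)
  also have "\<dots> = integral {0..L} (\<lambda>t. F t * (e' t - g t) + F t * g t - d t * e' t)"
    by (intro integral_cong) (simp add: F_def algebra_simps power2_eq_square)
  also have "\<dots> = integral {0..L} (\<lambda>t. F t * (e' t - g t)) + integral {0..L} (\<lambda>t. F t * g t)
      - integral {0..L} (\<lambda>t. d t * e' t)"
    by (rule integral_unique)
      (intro has_integral_add has_integral_diff integrable_integral pc_integrable pc_mult pc_diff Fp e'p g d)
  also have "\<dots> \<le> nrm L F * nrm L g + nrm L d * x"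
    using nrm_Cauchy_Schwarz[OF Fp g(1)] nrm_Cauchy_Schwarz[OF d(1) e'p] g(2)
    by (simp add: x_def F_def)
  also have "\<dots> \<le> (\<kappa>1 + \<beta> * L) * x * nrm L g + \<beta> * (K * h * x) * x"
  proof (intro add_mono mult_right_mono)
    show "nrm L d \<le> \<beta> * (K * h * x)"
      using Nd mult_left_mono[OF Ne cs(3)] by (simp add: x_def)
  qed (use NF x0 in \<open>auto simp: x_def\<close>)
  also have "\<beta> * (K * h * x) * x = (\<beta> * K * h) * x\<^sup>2" by (simp add: power2_eq_square)
  finally have 1: "\<kappa>0 * x\<^sup>2 \<le> (\<kappa>1 + \<beta> * L) * x * nrm L g + (\<beta> * K * h) * x\<^sup>2" .
  have "(\<beta> * K * h) * x\<^sup>2 \<le> \<kappa>0 / 2 * x\<^sup>2" using small by (rule mult_right_mono) simp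
  with 1 have 2: "(\<kappa>0 / 2 * x) * x \<le> ((\<kappa>1 + \<beta> * L) * nrm L g) * x"
    by (simp add: power2_eq_square algebra_simps)
  have X: "x \<le> 2 * (\<kappa>1 + \<beta> * L) / \<kappa>0 * nrm L g"
  proof (cases "x = 0")
    case True
    then show ?thesis using L cs by simp
  next
    case False
    then have "\<kappa>0 / 2 * x \<le> (\<kappa>1 + \<beta> * L) * nrm L g"
      using 2 x0 by (simp only: mult_le_cancel_right)
    then show ?thesis using cs by (simp add: field_simps)
  qed
  have "nrm L e + h * x \<le> (K + 1) * h * x"
    using Ne by (simp add: x_def algebra_simps)
  also have "\<dots> \<le> (K + 1) * h * (2 * (\<kappa>1 + \<beta> * L) / \<kappa>0 * nrm L g)"
    using X K0 cs by (intro mult_left_mono) auto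
  finally show ?thesis by (simp add: x_def mult_ac)
qed

section \<open>Polynomial approximation with prescribed mean, and cellwise functions\<close>

lemma poly_antiderivative:
  fixes q :: "real poly"
  obtains Q where "pderiv Q = q" "degree Q \<le> Suc (degree q)"
proof
  let ?Q = "\<Sum>i\<le>degree q. monom (coeff q i / real (Suc i)) (Suc i)"
  have "pderiv ?Q = (\<Sum>i\<le>degree q. pderiv (monom (coeff q i / real (Suc i)) (Suc i)))"
    using higher_pderiv_sum[of 1] by simp
  also have "\<dots> = (\<Sum>i\<le>degree q. monom (coeff q i) i)"
    by (intro sum.cong) (simp_all add: pderiv_monom del: of_nat_Suc)
  finally have "pderiv ?Q = (\<Sum>i\<le>degree q. monom (coeff q i) i)" .
  then show "pderiv ?Q = q"
    by (simp add: poly_as_sum_of_monoms)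
  show "degree ?Q \<le> Suc (degree q)"
    by (intro degree_sum_le order_trans[OF degree_monom_le]) auto
qed

lemma pwC1_poly: "pwC1 a b (poly q) (poly (pderiv q))"
  unfolding pwC1_def
  by (auto intro!: pc_continuous continuous_intros exI[of _ "{}"] poly_DERIV)

text \<open>Induction on the number of derivatives: approximate the derivative \<open>W 1\<close>,
  take an antiderivative of the polynomial and add the constant that matches the mean;
  \<open>cell_mean_estimate\<close> then yields one more factor (b - a)^2. The derivative of the top
  member \<open>W n\<close> is merely square integrable, so it enters through an oscillation bound,
  with \<open>G\<close> in the place of the integral of its square. Matching the mean is what later
  makes the discrete approximation vanish at the right end point.\<close>

lemma local_polynomial_approximation:
  fixes W :: "nat \<Rightarrow> real \<Rightarrow> real"
  assumes "a < b" "\<And>k. k < n \<Longrightarrow> pwC1 a b (W k) (W (Suc k))" "pc a b (W n)"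
    and "\<And>s t. s \<in> {a<..<b} \<Longrightarrow> t \<in> {a<..<b} \<Longrightarrow> \<bar>W n t - W n s\<bar> \<le> I"
    and "I\<^sup>2 \<le> (b - a) * G"
  shows "\<exists>q :: real poly. degree q \<le> n \<and> integral {a..b} (poly q) = integral {a..b} (W 0) \<and>
    integral {a..b} (\<lambda>t. (W 0 t - poly q t)\<^sup>2) \<le> (b - a) ^ (2 * Suc n) * G"
  using assms(2-5)
proof (induction n arbitrary: W)
  case 0
  define c where "c = integral {a..b} (W 0) / (b - a)"
  show ?case
    using cell_mean_estimate[OF assms(1) 0(2) finite.emptyI _ 0(4)] 0(3) assms(1)
    by (intro exI[of _ "[:c:]"]) (auto simp: c_def)
next
  case (Suc n)
  have "\<exists>q. degree q \<le> n \<and> integral {a..b} (poly q) = integral {a..b} (W (Suc 0)) \<and>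
    integral {a..b} (\<lambda>t. (W (Suc 0) t - poly q t)\<^sup>2) \<le> (b - a) ^ (2 * Suc n) * G"
    using Suc.prems by (intro Suc.IH[of "\<lambda>k. W (Suc k)"]) auto
  then obtain q where q: "degree q \<le> n"
    "integral {a..b} (\<lambda>t. (W (Suc 0) t - poly q t)\<^sup>2) \<le> (b - a) ^ (2 * Suc n) * G" by blast
  obtain Q where Q: "pderiv Q = q" "degree Q \<le> Suc (degree q)"
    by (rule poly_antiderivative)
  define \<phi> where "\<phi> = (\<lambda>t. W 0 t - poly Q t)"
  define \<phi>' where "\<phi>' = (\<lambda>t. W (Suc 0) t - poly q t)"
  have p: "pwC1 a b \<phi> \<phi>'"
    unfolding \<phi>_def \<phi>'_def using Suc.prems(1)[of 0] Q(1) pwC1_poly[of a b Q]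
    by (intro pwC1_diff) auto
  define c where "c = integral {a..b} \<phi> / (b - a)"
  have est: "integral {a..b} (\<lambda>t. (\<phi> t - c)\<^sup>2) \<le> (b - a)\<^sup>2 * integral {a..b} (\<lambda>t. (\<phi>' t)\<^sup>2)"
    unfolding c_def
  proof (rule cell_mean_estimate[OF assms(1) pwC1_pc[OF p] finite.emptyI])
    show "\<bar>\<phi> t - \<phi> s\<bar> \<le> integral {a..b} (\<lambda>r. \<bar>\<phi>' r\<bar>)"
      if "s \<in> {a<..<b} - {}" "t \<in> {a<..<b} - {}" for s t
      using that by (intro pwC1_osc[OF p]) auto
    show "(integral {a..b} (\<lambda>r. \<bar>\<phi>' r\<bar>))\<^sup>2 \<le> (b - a) * integral {a..b} (\<lambda>t. (\<phi>' t)\<^sup>2)"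
      using assms(1) by (intro integral_abs_square_le pc_integrable pc_power2 pc_abs pwC1_pc'[OF p]) auto
  qed
  show ?case
  proof (intro exI[of _ "Q + [:c:]"] conjI)
    show "degree (Q + [:c:]) \<le> Suc n"
      using Q q by (intro degree_add_le) auto
    have W0: "pc a b (W 0)" using Suc.prems(1)[of 0] pwC1_pc by blast
    have Qi: "poly Q integrable_on {a..b}" by (intro pc_integrable pwC1_pc[OF pwC1_poly])
    have "integral {a..b} \<phi> = integral {a..b} (W 0) - integral {a..b} (poly Q)"
      unfolding \<phi>_def by (intro integral_diff pc_integrable W0 Qi)
    moreover have "integral {a..b} (\<lambda>t. poly Q t + c) = integral {a..b} (poly Q) + (b - a) * c"
      using assms(1) Qi by (subst integral_add) auto
    moreover have "(b - a) * c = integral {a..b} \<phi>"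
      using assms(1) by (simp add: c_def)
    moreover have "poly (Q + [:c:]) = (\<lambda>t. poly Q t + c)" by (simp add: fun_eq_iff)
    ultimately show "integral {a..b} (poly (Q + [:c:])) = integral {a..b} (W 0)"
      by (simp only:)
    have "integral {a..b} (\<lambda>t. (W 0 t - poly (Q + [:c:]) t)\<^sup>2) = integral {a..b} (\<lambda>t. (\<phi> t - c)\<^sup>2)"
      by (intro integral_cong) (simp add: \<phi>_def algebra_simps)
    also have "\<dots> \<le> (b - a)\<^sup>2 * ((b - a) ^ (2 * Suc n) * G)"
      using est q(2) by (fastforce simp: \<phi>'_def intro: order_trans mult_left_mono)
    finally show "integral {a..b} (\<lambda>t. (W 0 t - poly (Q + [:c:]) t)\<^sup>2) \<le> (b - a) ^ (2 * Suc (Suc n)) * G"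
      by (simp add: power2_eq_square mult_ac)
  qed
qed

text \<open>A sum, so that membership in \<open>pc\<close> reduces to one cell at a time. At the
  nodes the value is 0, so inequalities for cellwise functions are stated off a finite set.\<close>

definition cellwise :: "nat \<Rightarrow> (nat \<Rightarrow> real) \<Rightarrow> (nat \<Rightarrow> real \<Rightarrow> real) \<Rightarrow> real \<Rightarrow> real" where
  "cellwise M y f t = (\<Sum>i<M. if y i < t \<and> t < y (Suc i) then f i t else 0)"

lemma cellwise_eq:
  assumes y: "is_mesh L M y" and i: "i < M" "t \<in> {y i<..<y (Suc i)}"
  shows "cellwise M y f t = f i t"
proof -
  have "\<not> (y j < t \<and> t < y (Suc j))" if j: "j < M" "j \<noteq> i" for j
  proof (cases "j < i")
    case True
    then have "y (Suc j) \<le> y i" using mono_onD[OF is_meshD(1)[OF y], of "Suc j" i] i by auto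
    then show ?thesis using i by auto
  next
    case False
    then have "y (Suc i) \<le> y j" using mono_onD[OF is_meshD(1)[OF y], of "Suc i" j] i j by auto
    then show ?thesis using i by auto
  qed
  then have "cellwise M y f t = (\<Sum>j<M. if j = i then f i t else 0)"
    unfolding cellwise_def using i by (intro sum.cong) auto
  then show ?thesis using i by simp
qed

lemma pc_cellwise:
  assumes "\<And>i. i < M \<Longrightarrow> continuous_on {y i..y (Suc i)} (f i)"
  shows "pc a b (cellwise M y f)"
  unfolding cellwise_def
proof (rule pc_sum)
  fix i assume i: "i \<in> {..<M}"
  let ?f = "\<lambda>t. if y i < t \<and> t < y (Suc i) then f i t else 0"
  have c: "continuous_on {y i..y (Suc i)} (f i)" using assms i by simp
  obtain B where B: "0 < B" "\<forall>x\<in>f i ` {y i..y (Suc i)}. norm x \<le> B"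
    using compact_imp_bounded[OF compact_continuous_image[OF c compact_Icc]]
    unfolding bounded_pos by blast
  \<comment> \<open>The order of the two nodes is not known here; \<open>max\<close> takes care of a
    reversed pair, for which the middle interval is empty.\<close>
  have "continuous_on ({..<y i} \<union> {y i<..<y (Suc i)} \<union> {max (y i) (y (Suc i))<..}) ?f"
  proof (intro continuous_on_open_Un)
    show "continuous_on {y i<..<y (Suc i)} ?f"
      using c by (subst continuous_on_cong[OF refl, of _ _ "f i"]) (auto intro: continuous_on_subset)
    show "continuous_on {..<y i} ?f"
      by (subst continuous_on_cong[OF refl, of _ _ "\<lambda>_. 0"]) auto
    show "continuous_on {max (y i) (y (Suc i))<..} ?f"
      by (subst continuous_on_cong[OF refl, of _ _ "\<lambda>_. 0"]) auto
  qed auto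
  then have "continuous_on ({a..b} - {y i, y (Suc i)}) ?f"
    by (rule continuous_on_subset) auto
  then show "pc a b ?f"
    using B by (intro pcI[where Y = "{y i, y (Suc i)}" and B = B]) auto
qed

section \<open>The enriched finite element space\<close>

lemma continuous_eq_on_closed_interval:
  fixes f g :: "real \<Rightarrow> real"
  assumes "a < b" "continuous_on {a..b} f" "continuous_on {a..b} g"
    and "\<And>t. t \<in> {a<..<b} \<Longrightarrow> f t = g t" "t \<in> {a..b}"
  shows "f t = g t"
  using continuous_constant_on_closure[of "{a<..<b}" "\<lambda>t. f t - g t" 0 t] assms
  by (auto intro!: continuous_on_diff)

section \<open>Lagrange interpolation on an element\<close>

lemma lagrange_basis_poly:
  assumes "k \<le> p"
  obtains q where "degree q \<le> p" "\<And>t. lagrange_basis p a b k t = poly q t"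
proof
  let ?n = "lagrange_node p a b"
  let ?f = "\<lambda>l. [:- ?n l / (?n k - ?n l), 1 / (?n k - ?n l):]"
  show "lagrange_basis p a b k t = poly (prod ?f ({..p} - {k})) t" for t
    by (simp add: lagrange_basis_def poly_prod diff_divide_distrib)
  have "degree (prod ?f ({..p} - {k})) \<le> sum (degree \<circ> ?f) ({..p} - {k})"
    by (rule degree_prod_sum_le) simp
  also have "\<dots> \<le> (\<Sum>l\<in>{..p} - {k}. 1)"
    by (intro sum_mono) (simp add: degree_pCons_eq_if)
  also have "\<dots> = p" using assms by simp
  finally show "degree (prod ?f ({..p} - {k})) \<le> p" .
qed

lemma lagrange_node_inj:
  assumes "1 \<le> p" "a < b" "lagrange_node p a b k = lagrange_node p a b l"
  shows "k = l"
  using assms by (simp add: lagrange_node_def)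

lemma lagrange_basis_node:
  assumes "1 \<le> p" "a < b" "k \<le> p" "l \<le> p"
  shows "lagrange_basis p a b k (lagrange_node p a b l) = (if k = l then 1 else 0)"
proof (cases "k = l")
  case True
  have "lagrange_node p a b l - lagrange_node p a b r \<noteq> 0" if "r \<noteq> l" for r
    using lagrange_node_inj[OF assms(1,2), of l r] that by auto
  then show ?thesis
    unfolding lagrange_basis_def True by (intro trans[OF prod.neutral]) auto
next
  case False
  then show ?thesis
    using assms by (auto simp: lagrange_basis_def intro!: prod_zero bexI[of _ l])
qed

text \<open>Two polynomials of degree at most p that agree at p + 1 distinct nodes coincide. In
  consequence the span of the products contains an enrichment function times any polynomial of
  degree at most p, which is the form in which the enrichment is used.\<close>

lemma lagrange_interpolation:
  assumes "1 \<le> p" "a < b" "degree q \<le> p"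
  shows "poly q t = (\<Sum>k\<le>p. poly q (lagrange_node p a b k) * lagrange_basis p a b k t)"
proof -
  have "\<forall>k\<in>{..p}. \<exists>r. degree r \<le> p \<and> (\<forall>t. lagrange_basis p a b k t = poly r t)"
    using lagrange_basis_poly by (metis atMost_iff)
  then obtain r where r: "\<And>k. k \<le> p \<Longrightarrow> degree (r k) \<le> p"
    "\<And>k t. k \<le> p \<Longrightarrow> lagrange_basis p a b k t = poly (r k) t"
    by (metis atMost_iff)
  let ?n = "lagrange_node p a b"
  define s where "s = (\<Sum>k\<le>p. smult (poly q (?n k)) (r k))"
  have s: "poly s t = (\<Sum>k\<le>p. poly q (?n k) * lagrange_basis p a b k t)" for t
    by (simp add: s_def poly_sum r(2))
  have card: "card (?n ` {..p}) = Suc p"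
    using lagrange_node_inj[OF assms(1,2)] by (subst card_image) (auto intro: inj_onI)
  have "q = s"
  proof (rule poly_eqI_degree[of "?n ` {..p}"])
    fix x assume "x \<in> ?n ` {..p}"
    then obtain l where l: "l \<le> p" "x = ?n l" by auto
    have "poly s x = (\<Sum>k\<le>p. if k = l then poly q x else 0)"
      unfolding s using assms l by (intro sum.cong) (auto simp: lagrange_basis_node)
    then show "poly q x = poly s x" using l by simp
  next
    have "degree s \<le> p"
      unfolding s_def by (intro degree_sum_le) (auto intro: order_trans[OF degree_smult_le] r)
    then show "degree s < card (?n ` {..p})" using card by simp
  qed (use assms card in simp)
  then show ?thesis using s[of t] by simp
qed

section \<open>The enrichment function\<close>

lemma enrichment_left:
  assumes "a < g" "g < b" "t \<in> {a..g}"
  shows "enrichment a b g t = 2 * (b - g) / (b - a) * (t - a)"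
proof -
  have "(b - a) * enrichment a b g t = 2 * (b - g) * (t - a)"
    using assms by (simp add: enrichment_def right_diff_distrib) (simp add: algebra_simps)
  then show ?thesis using assms by (simp add: eq_divide_eq mult.commute)
qed

text \<open>Compared with the formula on the left, \<open>2 * (t - g)\<close> is subtracted: the
  slope drops by 2 at g, wherever g lies in the element.\<close>

lemma enrichment_right:
  assumes "a < g" "g < b" "t \<in> {g..b}"
  shows "enrichment a b g t = 2 * (b - g) / (b - a) * (t - a) - 2 * (t - g)"
proof -
  have "(b - a) * enrichment a b g t = 2 * (b - g) * (t - a) - (b - a) * (2 * (t - g))"
    using assms by (simp add: enrichment_def right_diff_distrib) (simp add: algebra_simps)
  then show ?thesis using assms by (simp add: field_simps)
qed

lemma enrichment_outside: "t \<notin> {a<..<b} \<Longrightarrow> a < b \<Longrightarrow> a \<le> g \<Longrightarrow> g \<le> b \<Longrightarrow> enrichment a b g t = 0"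
  by (auto simp: enrichment_def not_less)

lemma pwC1_enrichment:
  assumes "a < g" "g < b"
  shows "\<exists>e'. pwC1 c d (enrichment a b g) e'"
proof -
  define \<alpha> where "\<alpha> = 2 * (b - g) / (b - a)"
  \<comment> \<open>Slopes 0, \<alpha>, \<alpha> - 2 and 0; the values at the three kinks do not
    matter.\<close>
  define e' where "e' = (\<lambda>t. if t < a then 0 else if t < g then \<alpha> else if t < b then \<alpha> - 2 else 0)"
  have \<alpha>b: "\<alpha> * (b - a) = 2 * (b - g)" using assms by (simp add: \<alpha>_def)
  have der: "(enrichment a b g has_real_derivative e' t) (at t)" if t: "t \<notin> {a, g, b}" for t
  proof -
    consider "t < a" | "a < t" "t < g" | "g < t" "t < b" | "b < t" using t by force
    then show ?thesis
    proof cases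
      case 1
      have "((\<lambda>_. 0) has_real_derivative 0) (at t)" by simp
      then have "(enrichment a b g has_real_derivative 0) (at t)"
        using 1 assms by (rule_tac has_field_derivative_transform_within_open[of _ _ _ "{..<a}"])
          (auto simp: enrichment_outside)
      then show ?thesis using 1 by (simp add: e'_def)
    next
      case 2
      have "((\<lambda>t. \<alpha> * (t - a)) has_real_derivative \<alpha>) (at t)"
        by (auto intro!: derivative_eq_intros)
      then have "(enrichment a b g has_real_derivative \<alpha>) (at t)"
        using 2 assms by (rule_tac has_field_derivative_transform_within_open[of _ _ _ "{a<..<g}"])
          (auto simp: enrichment_left \<alpha>_def)
      then show ?thesis using 2 by (simp add: e'_def)
    next
      case 3
      have "((\<lambda>t. \<alpha> * (t - a) - 2 * (t - g)) has_real_derivative \<alpha> - 2) (at t)"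
        by (auto intro!: derivative_eq_intros)
      then have "(enrichment a b g has_real_derivative \<alpha> - 2) (at t)"
        using 3 assms by (rule_tac has_field_derivative_transform_within_open[of _ _ _ "{g<..<b}"])
          (auto simp: enrichment_right \<alpha>_def)
      then show ?thesis using 3 assms by (simp add: e'_def)
    next
      case 4
      have "((\<lambda>_. 0) has_real_derivative 0) (at t)" by simp
      then have "(enrichment a b g has_real_derivative 0) (at t)"
        using 4 assms by (rule_tac has_field_derivative_transform_within_open[of _ _ _ "{b<..}"])
          (auto simp: enrichment_outside)
      then show ?thesis using 4 assms by (simp add: e'_def)
    qed
  qed
  have cont: "continuous_on UNIV (enrichment a b g)"
  proof -
    have "continuous_on ({..a} \<union> {a..g} \<union> {g..b} \<union> {b..}) (enrichment a b g)"
    proof (intro continuous_on_closed_Un)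
      show "continuous_on {..a} (enrichment a b g)"
        using assms by (subst continuous_on_cong[OF refl, of _ _ "\<lambda>_. 0"]) (auto simp: enrichment_outside)
      show "continuous_on {b..} (enrichment a b g)"
        using assms by (subst continuous_on_cong[OF refl, of _ _ "\<lambda>_. 0"]) (auto simp: enrichment_outside)
      show "continuous_on {a..g} (enrichment a b g)"
        using assms by (subst continuous_on_cong[OF refl enrichment_left]) (auto intro!: continuous_intros)
      show "continuous_on {g..b} (enrichment a b g)"
        using assms by (subst continuous_on_cong[OF refl enrichment_right]) (auto intro!: continuous_intros)
    qed auto
    moreover have "{..a} \<union> {a..g} \<union> {g..b} \<union> {b..} = (UNIV :: real set)"
      using assms by auto
    ultimately show ?thesis by simp
  qed
  have "pc c d e'"
  proof (rule pcI[where Y = "{a, g, b}" and B = "\<bar>\<alpha>\<bar> + 2"])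
    have "isCont e' t" if t: "t \<notin> {a, g, b}" for t
    proof -
      consider "t < a" | "a < t" "t < g" | "g < t" "t < b" | "b < t" using t by force
      then obtain S k where "open S" "t \<in> S" "\<And>s. s \<in> S \<Longrightarrow> e' s = k"
        by cases (use assms that[of "{..<a}" 0] that[of "{a<..<g}" \<alpha>] that[of "{g<..<b}" "\<alpha> - 2"]
            that[of "{b<..}" 0] in \<open>auto simp: e'_def\<close>)
      then have "continuous_on S e'" "open S" "t \<in> S"
        by (auto simp: continuous_on_cong[of S S e' "\<lambda>_. k"])
      then show ?thesis by (simp add: continuous_on_eq_continuous_at)
    qed
    then show "continuous_on ({c..d} - {a, g, b}) e'"
      by (intro continuous_at_imp_continuous_on) auto
  qed (auto simp: e'_def)
  then show ?thesis
    unfolding pwC1_def using cont der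
    by (intro exI[of _ e'] conjI exI[of _ "{a, g, b}"]) (auto intro: continuous_on_subset)
qed

lemma pwC1_sum_ex:
  "(\<And>i. i \<in> I \<Longrightarrow> \<exists>f'. pwC1 a b (f i) f') \<Longrightarrow> \<exists>f'. pwC1 a b (\<lambda>t. \<Sum>i\<in>I. f i t) f'"
proof (induction I rule: infinite_finite_induct)
  case (insert i I)
  obtain f' where "pwC1 a b (f i) f'" using insert.prems by blast
  moreover obtain g' where "pwC1 a b (\<lambda>t. \<Sum>i\<in>I. f i t) g'" using insert by blast
  ultimately have "pwC1 a b (f i) f'" "pwC1 a b (\<lambda>t. \<Sum>i\<in>I. f i t) g'" .
  from pwC1_add[OF this] show ?case using insert.hyps by auto
qed (auto intro!: exI[of _ "\<lambda>_. 0"] pwC1_const)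

section \<open>Cells, elements and the regularity of discrete functions\<close>

lemma mesh_cell:
  assumes y: "is_mesh L M y" and t: "0 \<le> t" "t < L"
  obtains i where "i < M" "y i \<le> t" "t < y (Suc i)"
proof -
  define i where "i = Max {i. i \<le> M \<and> y i \<le> t}"
  have fin: "finite {i. i \<le> M \<and> y i \<le> t}" by simp
  have "0 \<in> {i. i \<le> M \<and> y i \<le> t}" using is_meshD(2)[OF y] t by simp
  then have i: "i \<le> M" "y i \<le> t"
    using Max_in[OF fin] unfolding i_def by blast+
  have "i < M" using i is_meshD(3)[OF y] t by (cases "i = M") auto
  moreover have "t < y (Suc i)"
  proof (rule ccontr)
    assume "\<not> t < y (Suc i)"
    then have "Suc i \<in> {i. i \<le> M \<and> y i \<le> t}" using \<open>i < M\<close> by simp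
    then have "Suc i \<le> i" unfolding i_def by (rule Max_ge[OF fin])
    then show False by simp
  qed
  ultimately show ?thesis using i that by blast
qed

lemma mesh_cell_disjoint:
  assumes y: "is_mesh L M y" and ij: "i < M" "j < M" "t \<in> {y i<..<y (Suc i)}" "t \<in> {y j<..<y (Suc j)}"
  shows "i = j"
proof (rule ccontr)
  assume "i \<noteq> j"
  then consider "Suc i \<le> j" | "Suc j \<le> i" by linarith
  then show False
    using mono_onD[OF is_meshD(1)[OF y], of "Suc i" j] mono_onD[OF is_meshD(1)[OF y], of "Suc j" i] ij
    by cases auto
qed

text \<open>Two numberings meet here: elements are numbered from 1 and \<open>element x i\<close>
  ends at \<open>x i\<close>, whereas cells are numbered from 0 and start at \<open>y i\<close>.
  Element \<open>Suc i\<close> is cell i.\<close>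

lemma admissible_is_mesh:
  assumes "admissible_mesh L \<Gamma> N x"
  shows "is_mesh L N x"
proof -
  have step: "x i < x (Suc i)" if "i < N" for i
    using assms that unfolding admissible_mesh_def by (auto dest!: bspec[of _ _ "Suc i"])
  have "x i < x j" if "i < j" "j \<le> N" for i j
    using that
  proof (induction j)
    case (Suc j)
    then show ?case using step[of j] by (cases "i = j") auto
  qed simp
  then show ?thesis
    using assms by (auto simp: is_mesh_def admissible_mesh_def intro!: strict_mono_onI)
qed

lemma interface_elementE:
  assumes "admissible_mesh L \<Gamma> N x" "i \<in> interface_elements \<Gamma> N x"
  obtains g where "i \<in> {1..N}" "\<Gamma> \<inter> element x i = {g}" "the_elem (\<Gamma> \<inter> element x i) = g"
    "x (i - 1) < g" "g < x i" "x (i - 1) < x i"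
proof -
  have i: "i \<in> {1..N}" "\<Gamma> \<inter> element x i \<noteq> {}"
    using assms(2) by (auto simp: interface_elements_def)
  then obtain g where g: "g \<in> \<Gamma> \<inter> element x i" by blast
  have "h = g" if "h \<in> \<Gamma> \<inter> element x i" for h
    using assms(1) i(1) g that unfolding admissible_mesh_def by blast
  with g have "\<Gamma> \<inter> element x i = {g}" by blast
  with g i(1) that[of g] show ?thesis by (auto simp: element_def)
qed

lemma element_unique:
  assumes "admissible_mesh L \<Gamma> N x" "i \<in> {1..N}" "j \<in> {1..N}" "t \<in> element x i" "t \<in> element x j"
  shows "i = j"
proof -
  obtain k l where kl: "i = Suc k" "j = Suc l" "k < N" "l < N"
    using assms(2,3) by (cases i; cases j) auto
  then have "k = l"
    using assms(4,5) by (intro mesh_cell_disjoint[OF admissible_is_mesh[OF assms(1)] kl(3,4), of t])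
      (simp_all add: element_def)
  then show ?thesis using kl by simp
qed

lemma fem_space_pwC1:
  assumes adm: "admissible_mesh L \<Gamma> N x" and v: "v \<in> fem_space p L N x"
  shows "\<exists>v'. pwC1 0 L v v'"
proof -
  note y = admissible_is_mesh[OF adm]
  have "\<forall>i\<in>{1..N}. \<exists>q :: real poly. \<forall>t\<in>element x i. v t = poly q t"
    using v unfolding fem_space_def by blast
  then obtain q where q: "\<And>i t. i \<in> {1..N} \<Longrightarrow> t \<in> element x i \<Longrightarrow> v t = poly (q i) t"
    by metis
  define v' where "v' = cellwise N x (\<lambda>i. poly (pderiv (q (Suc i))))"
  have "(v has_real_derivative v' t) (at t)" if t: "t \<in> {0<..<L} - x ` {..N}" for t
  proof -
    obtain i where i: "i < N" "x i \<le> t" "t < x (Suc i)"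
      using mesh_cell[OF y, of t] t by auto
    then have t': "t \<in> {x i<..<x (Suc i)}" using t by (cases "x i = t") auto
    have "(v has_real_derivative poly (pderiv (q (Suc i))) t) (at t)"
      using q[of "Suc i"] i t'
      by (intro has_field_derivative_transform_within_open[OF poly_DERIV, of "{x i<..<x (Suc i)}"])
        (auto simp: element_def)
    then show ?thesis
      using cellwise_eq[OF y i(1) t'] by (simp add: v'_def)
  qed
  moreover have "pc 0 L v'"
    unfolding v'_def by (intro pc_cellwise continuous_intros)
  moreover have "continuous_on {0..L} v"
    using v by (simp add: fem_space_def)
  ultimately show ?thesis
    unfolding pwC1_def by (intro exI[of _ v'] conjI exI[of _ "x ` {..N}"]) auto
qed

text \<open>The enrichment functions are continuous and vanish outside their open elements, so any
  choice of coefficients gives a continuous function with zero boundary values.\<close>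

lemma enrichment_space_pwC1:
  assumes adm: "admissible_mesh L \<Gamma> N x" and e: "e \<in> enrichment_space p \<Gamma> N x"
  shows "\<exists>e'. pwC1 0 L e e'" "e 0 = 0" "e L = 0"
proof -
  obtain c where c: "e = (\<lambda>t. \<Sum>i\<in>interface_elements \<Gamma> N x. \<Sum>k\<le>p. c i k *
      (enrichment (x (i - 1)) (x i) (the_elem (\<Gamma> \<inter> element x i)) t *
       lagrange_basis p (x (i - 1)) (x i) k t))"
    using e unfolding enrichment_space_def by blast
  show "\<exists>e'. pwC1 0 L e e'"
    unfolding c
  proof (intro pwC1_sum_ex)
    fix i k assume i: "i \<in> interface_elements \<Gamma> N x" and k: "k \<in> {..p}"
    obtain g where g: "the_elem (\<Gamma> \<inter> element x i) = g" "x (i - 1) < g" "g < x i"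
      using interface_elementE[OF adm i] by metis
    obtain w' where w: "pwC1 0 L (enrichment (x (i - 1)) (x i) g) w'"
      using pwC1_enrichment[OF g(2,3)] by blast
    obtain q where q: "\<And>t. lagrange_basis p (x (i - 1)) (x i) k t = poly q t"
      using lagrange_basis_poly k by (metis atMost_iff)
    show "\<exists>f'. pwC1 0 L (\<lambda>t. c i k * (enrichment (x (i - 1)) (x i) (the_elem (\<Gamma> \<inter> element x i)) t *
       lagrange_basis p (x (i - 1)) (x i) k t)) f'"
      unfolding g(1) q using pwC1_mult[OF pwC1_const[of 0 L "c i k"] pwC1_mult[OF w pwC1_poly]] by blast
  qed
  have *: "e t = 0" if t: "t \<notin> {0<..<L}" for t
    unfolding c
  proof (intro sum.neutral ballI)
    fix i k assume i: "i \<in> interface_elements \<Gamma> N x" and k: "k \<in> {..p}"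
    obtain g where g: "i \<in> {1..N}" "the_elem (\<Gamma> \<inter> element x i) = g" "x (i - 1) < g" "g < x i"
      using interface_elementE[OF adm i] by metis
    have "i - 1 \<le> N" "i \<le> N" using g(1) by auto
    then have "t \<notin> {x (i - 1)<..<x i}"
      using t is_meshD(5)[OF admissible_is_mesh[OF adm], of "i - 1"]
        is_meshD(6)[OF admissible_is_mesh[OF adm], of i] by auto
    then show "c i k * (enrichment (x (i - 1)) (x i) (the_elem (\<Gamma> \<inter> element x i)) t *
       lagrange_basis p (x (i - 1)) (x i) k t) = 0"
      using g by (simp add: enrichment_outside)
  qed
  show "e 0 = 0" "e L = 0" by (auto intro: *)
qed

lemma sgfem_space_pwC1:
  assumes adm: "admissible_mesh L \<Gamma> N x" and u: "u \<in> sgfem_space p L \<Gamma> N x"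
  shows "\<exists>u'. pwC1 0 L u u'" "u 0 = 0" "u L = 0"
proof -
  obtain v e where ve: "u = (\<lambda>t. v t + e t)" "v \<in> fem_space p L N x" "e \<in> enrichment_space p \<Gamma> N x"
    using u unfolding sgfem_space_def by blast
  obtain v' e' where "pwC1 0 L v v'" "pwC1 0 L e e'"
    using fem_space_pwC1[OF adm ve(2)] enrichment_space_pwC1(1)[OF adm ve(3)] by blast
  from pwC1_add[OF this] show "\<exists>u'. pwC1 0 L u u'" unfolding ve(1) by blast
  show "u 0 = 0" "u L = 0"
    using enrichment_space_pwC1(2,3)[OF adm ve(3)] ve(1,2) by (auto simp: fem_space_def)
qed

text \<open>Needed to test with v - uh, the difference of an approximation and the discrete
  solution.\<close>

lemma sgfem_space_diff:
  assumes "u \<in> sgfem_space p L \<Gamma> N x" "w \<in> sgfem_space p L \<Gamma> N x"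
  shows "(\<lambda>t. u t - w t) \<in> sgfem_space p L \<Gamma> N x"
proof -
  obtain v e where ve: "u = (\<lambda>t. v t + e t)" "v \<in> fem_space p L N x" "e \<in> enrichment_space p \<Gamma> N x"
    using assms(1) unfolding sgfem_space_def by blast
  obtain v2 e2 where ve2: "w = (\<lambda>t. v2 t + e2 t)" "v2 \<in> fem_space p L N x" "e2 \<in> enrichment_space p \<Gamma> N x"
    using assms(2) unfolding sgfem_space_def by blast
  have "(\<lambda>t. v t - v2 t) \<in> fem_space p L N x"
    unfolding fem_space_def mem_Collect_eq
  proof (intro conjI ballI)
    show "continuous_on {0..L} (\<lambda>t. v t - v2 t)"
      using ve(2) ve2(2) by (auto simp: fem_space_def intro!: continuous_intros)
    show "v 0 - v2 0 = 0" "v L - v2 L = 0" using ve(2) ve2(2) by (auto simp: fem_space_def)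
    fix i assume "i \<in> {1..N}"
    then obtain q r :: "real poly" where "degree q \<le> p" "\<forall>t\<in>element x i. v t = poly q t"
      "degree r \<le> p" "\<forall>t\<in>element x i. v2 t = poly r t"
      using ve(2) ve2(2) unfolding fem_space_def by blast
    then show "\<exists>q :: real poly. degree q \<le> p \<and> (\<forall>t\<in>element x i. v t - v2 t = poly q t)"
      by (intro exI[of _ "q - r"]) (auto intro: degree_diff_le)
  qed
  moreover have "(\<lambda>t. e t - e2 t) \<in> enrichment_space p \<Gamma> N x"
  proof -
    obtain c c2 where "e = (\<lambda>t. \<Sum>i\<in>interface_elements \<Gamma> N x. \<Sum>k\<le>p. c i k *
      (enrichment (x (i - 1)) (x i) (the_elem (\<Gamma> \<inter> element x i)) t *
       lagrange_basis p (x (i - 1)) (x i) k t))"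
      "e2 = (\<lambda>t. \<Sum>i\<in>interface_elements \<Gamma> N x. \<Sum>k\<le>p. c2 i k *
      (enrichment (x (i - 1)) (x i) (the_elem (\<Gamma> \<inter> element x i)) t *
       lagrange_basis p (x (i - 1)) (x i) k t))"
      using ve(3) ve2(3) unfolding enrichment_space_def by blast
    then show ?thesis
      unfolding enrichment_space_def
      by (intro range_eqI[of _ _ "\<lambda>i k. c i k - c2 i k"]) (simp add: left_diff_distrib sum_subtractf)
  qed
  moreover have "(\<lambda>t. u t - w t) = (\<lambda>t. (v t - v2 t) + (e t - e2 t))"
    unfolding ve(1) ve2(1) by auto
  ultimately show ?thesis
    unfolding sgfem_space_def mem_Collect_eq
    by (intro exI[of _ "\<lambda>t. v t - v2 t"] exI[of _ "\<lambda>t. e t - e2 t"] conjI)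
qed

lemma mesh_node_notin_cell:
  assumes "is_mesh L M y" "i < M" "j \<le> M"
  shows "y j \<notin> {y i<..<y (Suc i)}"
proof (cases "j \<le> i")
  case True
  then show ?thesis using mono_onD[OF is_meshD(1)[OF assms(1)], of j i] assms by auto
next
  case False
  then show ?thesis using mono_onD[OF is_meshD(1)[OF assms(1)], of "Suc i" j] assms by auto
qed

text \<open>The kink of \<open>w\<close> at \<open>g\<close> is removed by a polynomial multiple of the enrichment function, because the
  difference of the two polynomials is divisible by \<open>t - g\<close>.\<close>

lemma enrichment_removes_kink:
  fixes q1 q2 :: "real poly"
  assumes "a < g" "g < b" "1 \<le> p" "continuous_on {a..b} w" "degree q1 \<le> p" "degree q2 \<le> p"
    and q1: "\<And>t. t \<in> {a<..<g} \<Longrightarrow> w t = poly q1 t"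
    and q2: "\<And>t. t \<in> {g<..<b} \<Longrightarrow> w t = poly q2 t"
  shows "\<exists>r s :: real poly. degree r \<le> p \<and> degree s \<le> p \<and>
    (\<forall>t\<in>{a<..<b}. w t + enrichment a b g t * poly r t = poly s t)"
proof -
  have c1: "w t = poly q1 t" if "t \<in> {a..g}" for t
  proof (rule continuous_eq_on_closed_interval[OF assms(1) _ _ q1 that])
    show "continuous_on {a..g} w"
      using assms(2) by (intro continuous_on_subset[OF assms(4)]) auto
  qed (auto intro: continuous_intros)
  have c2: "w t = poly q2 t" if "t \<in> {g..b}" for t
  proof (rule continuous_eq_on_closed_interval[OF assms(2) _ _ q2 that])
    show "continuous_on {g..b} w"
      using assms(1) by (intro continuous_on_subset[OF assms(4)]) auto
  qed (auto intro: continuous_intros)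
  have "poly (q2 - q1) g = 0" using c1[of g] c2[of g] assms by simp
  then obtain d where d: "q2 - q1 = [:- g, 1:] * d"
    unfolding poly_eq_0_iff_dvd by (elim dvdE)
  have dd: "degree d \<le> p - 1"
  proof (cases "d = 0")
    case False
    then have "degree (q2 - q1) = Suc (degree d)"
      unfolding d by (subst degree_mult_eq) auto
    moreover have "degree (q2 - q1) \<le> p" using assms by (intro degree_diff_le)
    ultimately show ?thesis by simp
  qed simp
  \<comment> \<open>To the right of g the enrichment lacks 2 (t - g) against its left formula. The
    multiplier r must therefore satisfy 2 (t - g) r = q2 - q1, which gives half of
    \<open>d\<close>.\<close>
  define r where "r = smult (1 / 2) d"
  define \<alpha> where "\<alpha> = 2 * (b - g) / (b - a)"
  define l where "l = [:- \<alpha> * a, \<alpha>:]"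
  define s where "s = q1 + l * r"
  have dr: "degree r \<le> p - 1" using dd by (simp add: r_def)
  have "degree l \<le> 1" by (simp add: l_def)
  then have "degree (l * r) \<le> p" using dr assms(3) degree_mult_le[of l r] by linarith
  then have ds: "degree s \<le> p" unfolding s_def using assms by (intro degree_add_le)
  have l: "poly l t = \<alpha> * (t - a)" for t by (simp add: l_def algebra_simps)
  show ?thesis
  proof (rule exI[of _ r], rule exI[of _ s], intro conjI ballI)
    show "degree r \<le> p" "degree s \<le> p" using dr ds by simp_all
    fix t assume t: "t \<in> {a<..<b}"
    show "w t + enrichment a b g t * poly r t = poly s t"
    proof (cases "t \<le> g")
      case True
      then show ?thesis
        using t assms c1[of t] enrichment_left[of a g b t] by (simp add: s_def l \<alpha>_def)
    next
      case False
      have "poly q2 t - poly q1 t = (t - g) * poly d t"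
        using arg_cong[OF d, of "\<lambda>q. poly q t"] by (simp add: algebra_simps)
      moreover have "2 * (t - g) * poly r t = (t - g) * poly d t" by (simp add: r_def)
      ultimately have e: "poly q2 t - 2 * (t - g) * poly r t = poly q1 t" by linarith
      have "w t + enrichment a b g t * poly r t = poly q2 t + (\<alpha> * (t - a) - 2 * (t - g)) * poly r t"
        using False t assms c2[of t] enrichment_right[of a g b t] by (simp add: \<alpha>_def)
      also have "\<dots> = (poly q2 t - 2 * (t - g) * poly r t) + \<alpha> * (t - a) * poly r t"
        by (simp add: algebra_simps)
      also have "\<dots> = poly s t" unfolding e by (simp add: s_def l)
      finally show ?thesis .
    qed
  qed
qed

text \<open>A membership test that mentions only continuity, boundary values and polynomial pieces
  between nodes and interfaces. On each interface element a polynomial multiple of the enrichment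
  function cancels the kink of w. These multiples together form \<open>e\<close>, and what remains
  is a single polynomial on every element, hence lies in the finite element space.\<close>

lemma sgfem_space_memI:
  assumes adm: "admissible_mesh L \<Gamma> N x" and p: "1 \<le> p"
    and w: "continuous_on {0..L} w" "w 0 = 0" "w L = 0"
    and pw: "\<And>a b. a < b \<Longrightarrow> 0 \<le> a \<Longrightarrow> b \<le> L \<Longrightarrow> {a<..<b} \<inter> (x ` {..N} \<union> \<Gamma>) = {} \<Longrightarrow>
      \<exists>q :: real poly. degree q \<le> p \<and> (\<forall>t\<in>{a<..<b}. w t = poly q t)"
  shows "w \<in> sgfem_space p L \<Gamma> N x"
proof -
  note y = admissible_is_mesh[OF adm]
  let ?I = "interface_elements \<Gamma> N x"
  let ?w = "\<lambda>i. enrichment (x (i - 1)) (x i) (the_elem (\<Gamma> \<inter> element x i))"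
  have cell: "x (i - 1) < x i" "0 \<le> x (i - 1)" "x i \<le> L" "element x i \<inter> x ` {..N} = {}" if "i \<in> {1..N}" for i
  proof -
    obtain k where k: "i = Suc k" "k < N" using \<open>i \<in> {1..N}\<close> by (cases i) auto
    show "x (i - 1) < x i" "0 \<le> x (i - 1)" "x i \<le> L"
      using is_meshD(4,5)[OF y, of k] is_meshD(6)[OF y, of "Suc k"] k by auto
    show "element x i \<inter> x ` {..N} = {}"
      using mesh_node_notin_cell[OF y k(2)] k(1) by (auto simp: element_def)
  qed
  have "\<exists>r. degree r \<le> p \<and> (\<exists>s :: real poly. degree s \<le> p \<and> (\<forall>t\<in>element x i. w t + ?w i t * poly r t = poly s t))"
    if i: "i \<in> ?I" for i
  proof -
    obtain g where g: "i \<in> {1..N}" "\<Gamma> \<inter> element x i = {g}" "the_elem (\<Gamma> \<inter> element x i) = g"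
      "x (i - 1) < g" "g < x i"
      using interface_elementE[OF adm i] by metis
    note ci = cell[OF g(1)]
    have sub: "{x (i - 1)<..<g} \<subseteq> element x i - {g}" "{g<..<x i} \<subseteq> element x i - {g}"
      using g(4,5) by (auto simp: element_def)
    have dis: "(element x i - {g}) \<inter> (x ` {..N} \<union> \<Gamma>) = {}"
      using ci(4) g(2) by blast
    have "{x (i - 1)<..<g} \<inter> (x ` {..N} \<union> \<Gamma>) = {}" "{g<..<x i} \<inter> (x ` {..N} \<union> \<Gamma>) = {}"
      using sub dis by (meson disjoint_iff subsetD)+
    then obtain q1 q2 :: "real poly" where q: "degree q1 \<le> p" "degree q2 \<le> p"
      "\<And>t. t \<in> {x (i - 1)<..<g} \<Longrightarrow> w t = poly q1 t" "\<And>t. t \<in> {g<..<x i} \<Longrightarrow> w t = poly q2 t"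
      using pw[of "x (i - 1)" g] pw[of g "x i"] ci g by auto
    have cw: "continuous_on {x (i - 1)..x i} w" using w(1) ci by (auto intro: continuous_on_subset)
    obtain r s :: "real poly" where rs: "degree r \<le> p" "degree s \<le> p"
      "\<forall>t\<in>{x (i - 1)<..<x i}. w t + enrichment (x (i - 1)) (x i) g t * poly r t = poly s t"
      using enrichment_removes_kink[OF g(4,5) p cw q] by blast
    have "\<forall>t\<in>element x i. w t + ?w i t * poly r t = poly s t"
      unfolding g(3) using rs(3) by (simp add: element_def)
    with rs(1,2) show ?thesis by (intro exI[of _ r] conjI exI[of _ s])
  qed
  \<comment> \<open>The two polynomials are packed into a pair so that one application of choice
    selects both.\<close>
  then have "\<forall>i\<in>?I. \<exists>rs. degree (fst rs) \<le> p \<and> degree (snd rs) \<le> p \<and>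
      (\<forall>t\<in>element x i. w t + ?w i t * poly (fst rs) t = poly (snd rs) t)"
    by (metis fst_conv snd_conv)
  then obtain rs where rs': "\<forall>i\<in>?I. degree (fst (rs i)) \<le> p \<and> degree (snd (rs i)) \<le> p \<and>
      (\<forall>t\<in>element x i. w t + ?w i t * poly (fst (rs i)) t = poly (snd (rs i)) t)"
    unfolding bchoice_iff by blast
  define r where "r i = fst (rs i)" for i
  define s where "s i = snd (rs i)" for i
  have rs: "degree (r i) \<le> p" "degree (s i) \<le> p"
    "\<And>t. t \<in> element x i \<Longrightarrow> w t + ?w i t * poly (r i) t = poly (s i) t" if "i \<in> ?I" for i
    using bspec[OF rs' that] by (simp_all only: r_def s_def)
  \<comment> \<open>Minus the nodal values of the multiplier: \<open>e\<close> is to be minus the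
    sum of the products \<open>?w i * r i\<close>, so that w - e equals the polynomial
    \<open>s i\<close> on interface element i.\<close>
  define c where "c i k = - poly (r i) (lagrange_node p (x (i - 1)) (x i) k)" for i k
  define e where "e = (\<lambda>t. \<Sum>i\<in>?I. \<Sum>k\<le>p. c i k * (?w i t * lagrange_basis p (x (i - 1)) (x i) k t))"
  have e_eq: "e t = - (\<Sum>i\<in>?I. ?w i t * poly (r i) t)" for t
  proof -
    have "(\<Sum>k\<le>p. c i k * (?w i t * lagrange_basis p (x (i - 1)) (x i) k t)) = - (?w i t * poly (r i) t)"
      if i: "i \<in> ?I" for i
    proof -
      have "x (i - 1) < x i" using interface_elementE[OF adm i] by metis
      then have "poly (r i) t = - (\<Sum>k\<le>p. c i k * lagrange_basis p (x (i - 1)) (x i) k t)"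
        using lagrange_interpolation[OF p _ rs(1)[OF i], of "x (i - 1)" "x i" t]
        by (simp add: c_def sum_negf)
      then show ?thesis by (simp add: sum_distrib_left mult_ac)
    qed
    then show ?thesis by (simp add: e_def sum_negf)
  qed
  have eE: "e \<in> enrichment_space p \<Gamma> N x"
    unfolding enrichment_space_def e_def by (rule range_eqI[of _ _ c]) (rule refl)
  have off: "?w i t = 0" if "i \<in> ?I" "t \<notin> element x i" for i t
    using interface_elementE[OF adm that(1)] that(2)
    by (metis element_def enrichment_outside less_imp_le)
  have finI: "finite ?I" by (simp add: interface_elements_def)
  have "(\<lambda>t. w t - e t) \<in> fem_space p L N x"
    unfolding fem_space_def mem_Collect_eq
  proof (intro conjI ballI)
    obtain e' where "pwC1 0 L e e'" using enrichment_space_pwC1(1)[OF adm eE] by blast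
    then show "continuous_on {0..L} (\<lambda>t. w t - e t)"
      using w(1) pwC1_cont by (auto intro!: continuous_on_diff)
    show "w 0 - e 0 = 0" "w L - e L = 0"
      using w enrichment_space_pwC1(2,3)[OF adm eE] by auto
    fix j assume j: "j \<in> {1..N}"
    have eu: "e t = - (if j \<in> ?I then ?w j t * poly (r j) t else 0)" if t: "t \<in> element x j" for t
    proof -
      have z: "?w i t * poly (r i) t = 0" if "i \<in> ?I" "i \<noteq> j" for i
      proof -
        have "i \<in> {1..N}" using that(1) by (auto simp: interface_elements_def)
        then have "t \<notin> element x i" using element_unique[OF adm _ j _ t] that(2) by blast
        then show ?thesis using off[OF that(1)] by simp
      qed
      show ?thesis
      proof (cases "j \<in> ?I")
        case True
        have "(\<Sum>i\<in>?I. ?w i t * poly (r i) t) = ?w j t * poly (r j) t + (\<Sum>i\<in>?I - {j}. ?w i t * poly (r i) t)"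
          by (rule sum.remove[OF finI True])
        also have "(\<Sum>i\<in>?I - {j}. ?w i t * poly (r i) t) = 0"
          by (rule sum.neutral) (use z in blast)
        finally show ?thesis using True by (simp add: e_eq)
      next
        case False
        have "(\<Sum>i\<in>?I. ?w i t * poly (r i) t) = 0"
          by (rule sum.neutral) (use z False in blast)
        then show ?thesis using False by (simp add: e_eq)
      qed
    qed
    show "\<exists>q :: real poly. degree q \<le> p \<and> (\<forall>t\<in>element x j. w t - e t = poly q t)"
    proof (cases "j \<in> ?I")
      case True
      then show ?thesis using rs(2,3)[OF True] eu by (intro exI[of _ "s j"]) auto
    next
      case False
      then have "element x j \<inter> (x ` {..N} \<union> \<Gamma>) = {}"
        using j cell(4)[OF j] by (auto simp: interface_elements_def)
      then obtain q :: "real poly" where "degree q \<le> p" "\<forall>t\<in>element x j. w t = poly q t"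
        using pw[OF cell(1-3)[OF j]] unfolding element_def by blast
      then show ?thesis using eu False by (intro exI[of _ q]) auto
    qed
  qed
  then show ?thesis
    unfolding sgfem_space_def mem_Collect_eq using eE
    by (intro exI[of _ "\<lambda>t. w t - e t"] exI[of _ e] conjI) auto
qed

text \<open>The supply of discrete functions: derivatives are prescribed freely on the refined
  cells, subject only to total integral zero, which is the boundary condition at L. It serves both
  for cellwise constant test functions and for the approximation of u'.\<close>

lemma cellwise_polynomial_in_sgfem_space:
  assumes adm: "admissible_mesh L \<Gamma> N x" and p: "1 \<le> p"
    and y: "is_mesh L M y" "y ` {..M} = x ` {..N} \<union> \<Gamma>"
    and q: "\<And>i. i < M \<Longrightarrow> degree (q i) \<le> p - 1"
    and z: "integral {0..L} (cellwise M y (\<lambda>i. poly (q i))) = 0"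
  shows "(\<lambda>t. integral {0..t} (cellwise M y (\<lambda>i. poly (q i)))) \<in> sgfem_space p L \<Gamma> N x" (is "?w \<in> _")
    and "pwC1 0 L (\<lambda>t. integral {0..t} (cellwise M y (\<lambda>i. poly (q i)))) (cellwise M y (\<lambda>i. poly (q i)))"
proof -
  let ?f = "cellwise M y (\<lambda>i. poly (q i))"
  have fp: "pc 0 L ?f" by (intro pc_cellwise continuous_intros)
  show w: "pwC1 0 L ?w ?f" by (rule pwC1_indefinite[OF fp])
  show "?w \<in> sgfem_space p L \<Gamma> N x"
  proof (rule sgfem_space_memI[OF adm p pwC1_cont[OF w]])
    fix a b assume ab: "a < b" "0 \<le> a" "b \<le> L" "{a<..<b} \<inter> (x ` {..N} \<union> \<Gamma>) = {}"
    obtain i where i: "i < M" "y i \<le> a" "a < y (Suc i)"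
      using mesh_cell[OF y(1), of a] ab by auto
    have "y (Suc i) \<in> x ` {..N} \<union> \<Gamma>" using y(2) i(1) by (auto simp flip: y(2))
    \<comment> \<open>An interval free of nodes and interfaces lies in a single refined cell, where
      the primitive is one polynomial.\<close>
    then have bi: "b \<le> y (Suc i)" using ab(4) i(3) by (metis IntI emptyE greaterThanLessThan_iff not_le)
    obtain Q where Q: "pderiv Q = q i" "degree Q \<le> Suc (degree (q i))"
      by (rule poly_antiderivative)
    have "?w t = poly (Q + [:?w a - poly Q a:]) t" if t: "t \<in> {a<..<b}" for t
    proof -
      have "?w t - ?w a = integral {a..t} ?f"
        using pwC1_integral[OF w, of a t] t ab by simp
      also have "\<dots> = integral {a..t} (poly (q i))"
        by (rule integral_cong_finite[of "{a}"]) (use i bi t cellwise_eq[OF y(1) i(1)] in auto)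
      also have "\<dots> = poly Q t - poly Q a"
        using pwC1_integral[OF pwC1_poly[of a t Q], of a t] t Q by simp
      finally show ?thesis by simp
    qed
    moreover have "degree (Q + [:?w a - poly Q a:]) \<le> p"
      using Q(2) q[OF i(1)] p by (intro degree_add_le) auto
    ultimately show "\<exists>q :: real poly. degree q \<le> p \<and> (\<forall>t\<in>{a<..<b}. ?w t = poly q t)" by blast
  qed (use z in auto)
qed

section \<open>Refining the mesh by the interfaces\<close>

lemma mesh_enumeration:
  assumes "finite Y" "0 \<in> Y" "L \<in> Y" "Y \<subseteq> {0..L}"
  obtains M y where "is_mesh L M y" "y ` {..M} = Y"
proof
  define l where "l = sorted_list_of_set Y"
  have l: "set l = Y" "sorted l" "distinct l" using assms by (auto simp: l_def)
  have len: "0 < length l" using l(1) assms(2) by (cases l) auto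
  define M where "M = length l - 1"
  have Ml: "{..M} = {..<length l}"
    using len unfolding M_def by (metis Suc_diff_1 lessThan_Suc_atMost)
  have mono: "strict_mono_on {..M} ((!) l)"
    unfolding Ml using l(2,3) by (intro strict_mono_onI) (simp add: sorted_wrt_nth_less strict_sorted_iff)
  show im: "((!) l) ` {..M} = Y"
    unfolding Ml l(1)[symmetric] by (auto simp: set_conv_nth)
  have m: "mono_on {..M} ((!) l)" by (rule strict_mono_on_imp_mono_on[OF mono])
  obtain i where i: "i \<le> M" "l ! i = 0" using assms(2) im by (metis atMost_iff imageE)
  obtain j where j: "j \<le> M" "l ! j = L" using assms(3) im by (metis atMost_iff imageE)
  have "l ! 0 \<in> Y" "l ! M \<in> Y" using im by auto
  then show "is_mesh L M ((!) l)"
    using mono mono_onD[OF m, of 0 i] mono_onD[OF m, of j M] i j assms(4)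
    by (auto simp: is_mesh_def intro: antisym)
qed

text \<open>A refined cell has no node of the original mesh in its interior, so it stays within the
  element in which it starts.\<close>

lemma refined_mesh_size:
  assumes y: "is_mesh L M y" "x ` {..N} \<subseteq> y ` {..M}" and x: "is_mesh L N x" and i: "i < M"
  shows "y (Suc i) - y i \<le> mesh_size N x"
proof -
  have yi: "0 \<le> y i" "y i < L" "y i < y (Suc i)"
    using is_meshD(5)[OF y(1), of i] i is_meshD(4)[OF y(1) i] is_meshD(6)[OF y(1), of "Suc i"] by auto
  obtain j where j: "j < N" "x j \<le> y i" "y i < x (Suc j)"
    using mesh_cell[OF x yi(1,2)] .
  obtain k where k: "k \<le> M" "x (Suc j) = y k"
    using y(2) j(1) by (metis Suc_leI atMost_iff imageE image_subset_iff)
  have "y (Suc i) \<le> x (Suc j)"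
    using mesh_node_notin_cell[OF y(1) i k(1)] j(3) k(2) by auto
  then have "y (Suc i) - y i \<le> x (Suc j) - x (Suc j - 1)" using j by simp
  also have "\<dots> \<le> mesh_size N x"
    unfolding mesh_size_def using j(1) by (intro Max_ge rev_image_eqI[of "Suc j"]) auto
  finally show ?thesis .
qed

section \<open>Weak derivatives on an interval\<close>

text \<open>Lebesgue differentiation: outside a null set, f x is the limit of the averages over
  [x, x + h], and for small h these are all 0.\<close>

lemma negligible_of_zero_integrals:
  fixes f :: "real \<Rightarrow> real"
  assumes f: "f integrable_on {a..b}"
    and zero: "\<And>c d. a < c \<Longrightarrow> c < d \<Longrightarrow> d < b \<Longrightarrow> integral {c..d} f = 0"
  shows "negligible {t \<in> {a<..<b}. f t \<noteq> 0}"
proof -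
  \<comment> \<open>Extended by 0 because the differentiation theorem asks for integrability over
    all bounded boxes.\<close>
  define f0 where "f0 = (\<lambda>t. if t \<in> {a..b} then f t else 0)"
  have "f0 integrable_on UNIV"
    unfolding f0_def by (rule integrable_restrict_UNIV[THEN iffD2, OF f])
  then have "f0 integrable_on cbox c d" for c d :: real
    by (rule integrable_on_subcbox) auto
  then obtain N where N: "negligible N"
    "\<And>x e. x \<notin> N \<Longrightarrow> 0 < e \<Longrightarrow> \<exists>d>0. \<forall>h. 0 < h \<and> h < d \<longrightarrow>
      norm (integral (cbox x (x + h *\<^sub>R One)) f0 /\<^sub>R h ^ DIM(real) - f0 x) < e"
    using integrable_ccontinuous_explicit[of f0] by metis
  have "f x = 0" if x: "x \<in> {a<..<b}" "x \<notin> N" for x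
  proof (rule ccontr)
    assume "f x \<noteq> 0"
    then obtain d where d: "d > 0" "\<forall>h. 0 < h \<and> h < d \<longrightarrow>
      norm (integral (cbox x (x + h *\<^sub>R One)) f0 /\<^sub>R h ^ DIM(real) - f0 x) < \<bar>f x\<bar>"
      using N(2)[OF x(2), of "\<bar>f x\<bar>"] by auto
    define h where "h = min (d / 2) ((b - x) / 2)"
    have h: "0 < h" "h < d" "x + h < b" using d(1) x(1) by (auto simp: h_def min_def field_simps)
    have "integral {x..x + h} f0 = integral {x..x + h} f"
      using x h by (intro integral_cong) (auto simp: f0_def)
    also have "\<dots> = 0" using x h by (intro zero) auto
    finally have "norm (0 - f0 x) < \<bar>f x\<bar>"
      using d(2) h by force
    then show False using x by (simp add: f0_def)
  qed
  then show ?thesis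
    by (intro negligible_subset[OF N(1)]) auto
qed

text \<open>Fubini's theorem is applied on the product of two copies of \<open>lborel\<close>, where
  joint measurability requires Borel functions; absolute integrability provides only Lebesgue
  measurable ones.\<close>

lemma borel_representative:
  fixes f :: "real \<Rightarrow> real"
  assumes "f absolutely_integrable_on {a..b}"
  obtains f0 N where "integrable lborel f0" "negligible N" "\<And>t. t \<notin> {a..b} \<Longrightarrow> f0 t = 0"
    "\<And>t. t \<in> {a..b} - N \<Longrightarrow> f0 t = f t"
proof -
  let ?f = "\<lambda>t. indicat_real {a..b} t *\<^sub>R f t"
  have int: "integrable lebesgue ?f"
    using assms by (simp add: set_integrable_def)
  then obtain f1 where f1: "f1 \<in> borel_measurable lborel" "AE t in lborel. ?f t = f1 t"
    using completion_ex_borel_measurable_real[of ?f lborel] by (auto dest: borel_measurable_integrable)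
  have AE1: "AE t in lebesgue. ?f t = f1 t"
    using AE_completion[OF f1(2)] by simp
  have f1b: "f1 \<in> borel_measurable borel" using f1(1) by simp
  have "integrable lebesgue f1"
    using int measurable_completion[OF f1(1)] AE1 by (rule integrable_cong_AE_imp)
  then have i1: "integrable lborel f1"
    using integrable_completion[OF f1(1)] by simp
  define f0 where "f0 t = indicat_real {a..b} t *\<^sub>R f1 t" for t
  have "integrable lborel f0"
    unfolding f0_def using i1 by (intro integrable_mult_indicator) auto
  moreover obtain N where N: "negligible N" "{t. ?f t \<noteq> f1 t} \<subseteq> N"
    using AE1 unfolding eventually_ae_filter_negligible by blast
  have "f1 t = f t" if "t \<in> {a..b} - N" for t
    using subsetD[OF N(2), of t] that by (cases "f t = f1 t") auto
  ultimately show ?thesis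
    using N(1) by (intro that[of f0 N]) (auto simp: f0_def)
qed

lemma integral_lborel_interval:
  fixes f :: "real \<Rightarrow> real"
  assumes "integrable lborel f" "S \<in> sets borel"
  shows "(LINT t|lborel. indicat_real S t * f t) = integral S f"
  using set_borel_integral_eq_integral(2)[of S f] integrable_mult_indicator[of S lborel f] assms
  by (simp add: set_integrable_def set_lebesgue_integral_def)

text \<open>Fubini's theorem on the triangle a \<le> s \<le> t \<le> b; the integrand is dominated
  by the product |g s| |\<psi> t|.\<close>

lemma integral_indefinite_swap:
  fixes g \<psi> :: "real \<Rightarrow> real"
  assumes g: "g absolutely_integrable_on {a..b}" and \<psi>: "\<psi> absolutely_integrable_on {a..b}"
  shows "integral {a..b} (\<lambda>t. integral {a..t} g * \<psi> t) = integral {a..b} (\<lambda>s. g s * integral {s..b} \<psi>)"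
proof -
  obtain g0 N where g0: "integrable lborel g0" "negligible N" "\<And>t. t \<notin> {a..b} \<Longrightarrow> g0 t = 0"
    "\<And>t. t \<in> {a..b} - N \<Longrightarrow> g0 t = g t" using borel_representative[OF g] by metis
  obtain p0 K where p0: "integrable lborel p0" "negligible K" "\<And>t. t \<notin> {a..b} \<Longrightarrow> p0 t = 0"
    "\<And>t. t \<in> {a..b} - K \<Longrightarrow> p0 t = \<psi> t" using borel_representative[OF \<psi>] by metis
  have [measurable]: "g0 \<in> borel_measurable borel" "p0 \<in> borel_measurable borel"
    using borel_measurable_integrable[OF g0(1)] borel_measurable_integrable[OF p0(1)] by simp_all
  define h where "h s t = (if s \<le> t then g0 s * p0 t else 0)" for s t :: real
  have meas[measurable]: "case_prod h \<in> borel_measurable (lborel \<Otimes>\<^sub>M lborel)"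
    unfolding h_def by measurable
  have hi: "integrable (lborel \<Otimes>\<^sub>M lborel) (case_prod h)"
  proof (rule lborel_pair.Fubini_integrable)
    have i2: "integrable lborel (\<lambda>t. h s t)" for s
      by (rule Bochner_Integration.integrable_bound[of _ "\<lambda>t. g0 s * p0 t"])
        (use p0(1) in \<open>auto simp: h_def\<close>)
    then show "AE s in lborel. integrable lborel (\<lambda>t. case_prod h (s, t))" by simp
    show "integrable lborel (\<lambda>s. LINT t|lborel. norm (case_prod h (s, t)))"
    proof (rule Bochner_Integration.integrable_bound[of _ "\<lambda>s. g0 s * (LINT t|lborel. \<bar>p0 t\<bar>)"])
      show "integrable lborel (\<lambda>s. g0 s * (LINT t|lborel. \<bar>p0 t\<bar>))" using g0(1) by simp
      show "(\<lambda>s. LINT t|lborel. norm (case_prod h (s, t))) \<in> borel_measurable lborel" by measurable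
      show "AE s in lborel. norm (LINT t|lborel. norm (case_prod h (s, t))) \<le> norm (g0 s * (LINT t|lborel. \<bar>p0 t\<bar>))"
      proof (rule AE_I2)
        fix s
        have "(LINT t|lborel. \<bar>h s t\<bar>) \<le> (LINT t|lborel. \<bar>g0 s\<bar> * \<bar>p0 t\<bar>)"
          using i2[of s] p0(1) by (intro integral_mono) (auto simp: h_def abs_mult)
        then show "norm (LINT t|lborel. norm (case_prod h (s, t))) \<le> norm (g0 s * (LINT t|lborel. \<bar>p0 t\<bar>))"
          by (simp add: abs_mult)
      qed
    qed
  qed simp
  have G: "(LINT s|lborel. h s t) = integral {a..t} g * p0 t" for t
  proof (cases "t \<in> {a..b}")
    case True
    have "h s t = indicat_real {a..t} s * g0 s * p0 t" for s
      using g0(3)[of s] by (auto simp: h_def indicator_def)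
    then have "(LINT s|lborel. h s t) = (LINT s|lborel. indicat_real {a..t} s * g0 s) * p0 t"
      by simp
    also have "(LINT s|lborel. indicat_real {a..t} s * g0 s) = integral {a..t} g0"
      using g0(1) by (rule integral_lborel_interval) simp
    also have "\<dots> = integral {a..t} g"
      using g0(2,4) True by (intro integral_spike[of N]) auto
    finally show ?thesis .
  next
    case False
    then have "h s t = 0" for s using p0(3) by (simp add: h_def)
    then show ?thesis using p0(3)[OF False] by simp
  qed
  have P: "(LINT t|lborel. h s t) = g0 s * integral {s..b} \<psi>" for s
  proof (cases "s \<in> {a..b}")
    case True
    have "h s t = g0 s * (indicat_real {s..b} t * p0 t)" for t
      using p0(3)[of t] by (auto simp: h_def indicator_def)
    then have "(LINT t|lborel. h s t) = g0 s * (LINT t|lborel. indicat_real {s..b} t * p0 t)"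
      by simp
    also have "(LINT t|lborel. indicat_real {s..b} t * p0 t) = integral {s..b} p0"
      using p0(1) by (rule integral_lborel_interval) simp
    also have "\<dots> = integral {s..b} \<psi>"
      using p0(2,4) True by (intro integral_spike[of K]) auto
    finally show ?thesis .
  next
    case False
    then have "h s t = 0" for t using g0(3) by (simp add: h_def)
    then show ?thesis using g0(3)[OF False] by simp
  qed
  have ig: "integrable lborel (\<lambda>t. integral {a..t} g * p0 t)"
    using lborel_pair.integrable_snd[OF hi] by (simp add: G)
  have ip: "integrable lborel (\<lambda>s. g0 s * integral {s..b} \<psi>)"
    using lborel_pair.integrable_fst[OF hi] by (simp add: P)
  have "integral {a..b} (\<lambda>t. integral {a..t} g * \<psi> t) = integral {a..b} (\<lambda>t. integral {a..t} g * p0 t)"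
    using p0(2,4) by (intro integral_spike[of K]) auto
  also have "\<dots> = (LINT t|lborel. indicat_real {a..b} t * (integral {a..t} g * p0 t))"
    using integral_lborel_interval[OF ig, of "{a..b}"] by simp
  also have "\<dots> = (LINT t|lborel. integral {a..t} g * p0 t)"
    using p0(3) by (intro Bochner_Integration.integral_cong) (auto simp: indicator_def)
  also have "\<dots> = (LINT s|lborel. g0 s * integral {s..b} \<psi>)"
    using lborel_pair.Fubini_integral[OF hi] by (simp add: G P)
  also have "\<dots> = (LINT s|lborel. indicat_real {a..b} s * (g0 s * integral {s..b} \<psi>))"
    using g0(3) by (intro Bochner_Integration.integral_cong) (auto simp: indicator_def)
  also have "\<dots> = integral {a..b} (\<lambda>s. g0 s * integral {s..b} \<psi>)"
    using integral_lborel_interval[OF ip, of "{a..b}"] by simp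
  also have "\<dots> = integral {a..b} (\<lambda>s. g s * integral {s..b} \<psi>)"
    using g0(2,4) by (intro integral_spike[of N]) auto
  finally show ?thesis .
qed

lemma integral_by_parts_vanishing:
  fixes g \<phi> :: "real \<Rightarrow> real"
  assumes "a \<le> b" "g absolutely_integrable_on {a..b}" "pwC1 a b \<phi> \<phi>'" "\<phi> b = 0"
  shows "integral {a..b} (\<lambda>t. integral {a..t} g * \<phi>' t) = - integral {a..b} (\<lambda>t. g t * \<phi> t)"
proof -
  have "integral {a..b} (\<lambda>t. integral {a..t} g * \<phi>' t) = integral {a..b} (\<lambda>s. g s * integral {s..b} \<phi>')"
    by (intro integral_indefinite_swap assms pc_absolutely_integrable pwC1_pc'[OF assms(3)])
  also have "\<dots> = integral {a..b} (\<lambda>s. - (g s * \<phi> s))"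
    using pwC1_integral[OF assms(3)] assms(4) by (intro integral_cong) auto
  finally show ?thesis by simp
qed

lemma pc_times_absolutely_integrable:
  assumes "pc a b \<phi>" "g absolutely_integrable_on {a..b}"
  shows "(\<lambda>t. \<phi> t * g t) absolutely_integrable_on {a..b}"
proof -
  obtain Y B where Y: "finite Y" "continuous_on ({a..b} - Y) \<phi>" "\<forall>t\<in>{a..b} - Y. \<bar>\<phi> t\<bar> \<le> B"
    using assms(1) unfolding pc_def by blast
  have "{a..b} - Y \<in> sets borel"
    using Y(1) by (auto intro: borel_closed finite_imp_closed)
  then have bor: "{a..b} - Y \<in> sets lebesgue" by auto
  have neg: "negligible Y" by (rule negligible_finite[OF Y(1)])
  have "(\<lambda>t. \<phi> t * g t) absolutely_integrable_on ({a..b} - Y)"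
  proof (rule absolutely_integrable_bounded_measurable_product_real[OF _ bor])
    show "\<phi> \<in> borel_measurable (lebesgue_on ({a..b} - Y))"
      using Y(2) bor by (intro continuous_imp_measurable_on_sets_lebesgue) auto
    show "bounded (\<phi> ` ({a..b} - Y))" using Y(3) by (auto simp: bounded_iff)
    show "g absolutely_integrable_on {a..b} - Y"
      using assms(2) bor by (rule set_integrable_subset) auto
  qed
  then show ?thesis
    by (rule absolutely_integrable_spike_set) (auto intro: negligible_subset[OF neg])
qed

section \<open>Square integrable functions on an interval\<close>

lemma absolutely_integrable_Icc_iff_Ioo:
  fixes f :: "real \<Rightarrow> real"
  shows "f absolutely_integrable_on {a<..<b} \<longleftrightarrow> f absolutely_integrable_on {a..b}"
proof -
  have "negligible {x \<in> {a..b} - {a<..<b}. f x \<noteq> 0}"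
    by (rule negligible_subset[of "{a, b}"]) auto
  moreover have "negligible {x \<in> {a<..<b} - {a..b}. f x \<noteq> 0}"
    by (rule negligible_subset[of "{}"]) auto
  ultimately show ?thesis
    using absolutely_integrable_spike_set by blast
qed

lemma LINT_interval:
  fixes f :: "real \<Rightarrow> real"
  assumes "f absolutely_integrable_on {a..b}"
  shows "(LINT t:{a<..<b}|lebesgue. f t) = integral {a..b} f"
  using set_lebesgue_integral_eq_integral(2)[of "{a<..<b}" f] assms
  by (simp add: absolutely_integrable_Icc_iff_Ioo integral_open_interval_real)

text \<open>On a bounded interval |v| \<le> 1 + v^2 makes v itself integrable. Conversely, absolute
  integrability of v carries its measurability.\<close>

lemma L2_iff:
  "v \<in> L2 {a<..<b} \<longleftrightarrow>
    v absolutely_integrable_on {a..b} \<and> (\<lambda>t. (v t)\<^sup>2) absolutely_integrable_on {a..b}"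
proof
  assume v: "v \<in> L2 {a<..<b}"
  then have m: "set_borel_measurable lebesgue {a<..<b} v"
    and i: "(\<lambda>t. (v t)\<^sup>2) absolutely_integrable_on {a<..<b}" by (auto simp: L2_def)
  have "(\<lambda>t. 1 + (v t)\<^sup>2) absolutely_integrable_on {a<..<b}"
    using i by (intro set_integral_add(1)) (auto intro: absolutely_integrable_on_const)
  then have "v absolutely_integrable_on {a<..<b}"
  proof (rule set_integrable_bound[OF _ m], intro AE_I2 impI)
    fix t
    have "\<bar>v t\<bar> \<le> 1 + (v t)\<^sup>2"
    proof (cases "\<bar>v t\<bar> \<le> 1")
      case False
      then have "\<bar>v t\<bar> * 1 \<le> \<bar>v t\<bar> * \<bar>v t\<bar>" by (intro mult_left_mono) auto
      then show ?thesis by (simp add: power2_eq_square)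
    qed (auto intro: add_increasing2)
    then show "norm (v t) \<le> norm (1 + (v t)\<^sup>2)" by simp
  qed
  with i show "v absolutely_integrable_on {a..b} \<and> (\<lambda>t. (v t)\<^sup>2) absolutely_integrable_on {a..b}"
    by (simp add: absolutely_integrable_Icc_iff_Ioo)
next
  assume "v absolutely_integrable_on {a..b} \<and> (\<lambda>t. (v t)\<^sup>2) absolutely_integrable_on {a..b}"
  then have "v absolutely_integrable_on {a<..<b}" "(\<lambda>t. (v t)\<^sup>2) absolutely_integrable_on {a<..<b}"
    by (simp_all add: absolutely_integrable_Icc_iff_Ioo)
  then show "v \<in> L2 {a<..<b}"
    unfolding L2_def set_borel_measurable_def
    by (auto simp: set_integrable_def dest: borel_measurable_integrable)
qed

lemma pc_L2: "pc a b f \<Longrightarrow> f \<in> L2 {a<..<b}"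
  unfolding L2_iff by (auto intro: pc_absolutely_integrable)

lemma L2_mult:
  assumes "u \<in> L2 {a<..<b}" "v \<in> L2 {a<..<b}"
  shows "(\<lambda>t. u t * v t) absolutely_integrable_on {a..b}"
proof -
  have m: "set_borel_measurable lebesgue {a<..<b} u" "set_borel_measurable lebesgue {a<..<b} v"
    and i: "(\<lambda>t. (u t)\<^sup>2) absolutely_integrable_on {a<..<b}" "(\<lambda>t. (v t)\<^sup>2) absolutely_integrable_on {a<..<b}"
    using assms by (auto simp: L2_def)
  have "(\<lambda>t. indicat_real {a<..<b} t *\<^sub>R (u t * v t)) =
      (\<lambda>t. (indicat_real {a<..<b} t *\<^sub>R u t) * (indicat_real {a<..<b} t *\<^sub>R v t))"
    by (auto simp: indicator_def)
  then have meas: "set_borel_measurable lebesgue {a<..<b} (\<lambda>t. u t * v t)"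
    using m by (simp add: set_borel_measurable_def borel_measurable_times)
  have "(\<lambda>t. (u t)\<^sup>2 + (v t)\<^sup>2) absolutely_integrable_on {a<..<b}"
    using i by (intro set_integral_add(1))
  then have "(\<lambda>t. u t * v t) absolutely_integrable_on {a<..<b}"
    using meas
  proof (rule set_integrable_bound, intro AE_I2 impI)
    fix t
    have "2 * \<bar>u t * v t\<bar> \<le> (u t)\<^sup>2 + (v t)\<^sup>2"
      using sum_squares_bound[of "\<bar>u t\<bar>" "\<bar>v t\<bar>"] by (simp add: abs_mult)
    moreover have "0 \<le> \<bar>u t * v t\<bar>" by simp
    ultimately have "\<bar>u t * v t\<bar> \<le> (u t)\<^sup>2 + (v t)\<^sup>2" by linarith
    then show "norm (u t * v t) \<le> norm ((u t)\<^sup>2 + (v t)\<^sup>2)" by simp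
  qed
  then show ?thesis by (simp add: absolutely_integrable_Icc_iff_Ioo)
qed

lemma L2_diff:
  assumes "u \<in> L2 {a<..<b}" "v \<in> L2 {a<..<b}"
  shows "(\<lambda>t. u t - v t) \<in> L2 {a<..<b}"
proof -
  have "(\<lambda>t. (u t)\<^sup>2 + (v t)\<^sup>2 - 2 * (u t * v t)) absolutely_integrable_on {a..b}"
    using assms L2_mult[OF assms] by (intro set_integral_add(1) set_integral_diff(1)) (auto simp: L2_iff)
  moreover have "(\<lambda>t. (u t)\<^sup>2 + (v t)\<^sup>2 - 2 * (u t * v t)) = (\<lambda>t. (u t - v t)\<^sup>2)"
    by (auto simp: power2_diff)
  ultimately show ?thesis
    using assms by (auto simp: L2_iff intro: set_integral_diff(1))
qed

definition eq_ae :: "real \<Rightarrow> real \<Rightarrow> (real \<Rightarrow> real) \<Rightarrow> (real \<Rightarrow> real) \<Rightarrow> bool" where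
  "eq_ae a b f g \<longleftrightarrow> negligible {t \<in> {a<..<b}. f t \<noteq> g t}"

lemma eq_ae_refl [simp]: "eq_ae a b f f"
  by (simp add: eq_ae_def)

lemma eq_ae_sym: "eq_ae a b f g \<Longrightarrow> eq_ae a b g f"
  by (simp add: eq_ae_def eq_commute)

lemma eq_ae_trans: "eq_ae a b f g \<Longrightarrow> eq_ae a b g h \<Longrightarrow> eq_ae a b f h"
  unfolding eq_ae_def by (erule negligible_subset[OF negligible_Un], assumption) auto

lemma eq_ae_mono: "eq_ae a b f g \<Longrightarrow> a \<le> c \<Longrightarrow> d \<le> b \<Longrightarrow> eq_ae c d f g"
  unfolding eq_ae_def by (erule negligible_subset) auto

text \<open>The outer function may depend on t, so that superpositions such as
  \<open>\<kappa> j (t, v t)\<close> are covered; a unary operation is obtained by repeating an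
  argument.\<close>

lemma eq_ae_comp2:
  assumes "eq_ae a b f f'" "eq_ae a b g g'"
  shows "eq_ae a b (\<lambda>t. h t (f t) (g t)) (\<lambda>t. h t (f' t) (g' t))"
  using assms unfolding eq_ae_def
  by (auto intro!: negligible_subset[OF negligible_Un[OF assms[unfolded eq_ae_def]]])

lemma eq_ae_spike_set: "eq_ae a b f g \<Longrightarrow> \<exists>N. negligible N \<and> (\<forall>t\<in>{a..b} - N. g t = f t)"
  unfolding eq_ae_def
  by (rule exI[of _ "{t \<in> {a<..<b}. f t \<noteq> g t} \<union> {a, b}"]) auto

lemma eq_ae_integral: "eq_ae a b f g \<Longrightarrow> integral {a..b} f = integral {a..b} g"
  using eq_ae_spike_set[of a b f g] integral_spike[of _ "{a..b}" g f] by auto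

lemma eq_ae_absolutely_integrable:
  "f absolutely_integrable_on {a..b} \<Longrightarrow> eq_ae a b f g \<Longrightarrow> g absolutely_integrable_on {a..b}"
  using eq_ae_spike_set[of a b f g] absolutely_integrable_spike by metis

lemma eq_ae_L2: "u \<in> L2 {a<..<b} \<Longrightarrow> eq_ae a b u v \<Longrightarrow> v \<in> L2 {a<..<b}"
  unfolding L2_iff
  using eq_ae_absolutely_integrable eq_ae_comp2[of a b u v u v "\<lambda>_ x _. x\<^sup>2"] by blast

text \<open>The set where two continuous functions differ is open in the open interval, and an open
  null set is empty.\<close>

lemma eq_ae_continuous:
  assumes "a < b" "continuous_on {a..b} f" "continuous_on {a..b} g" "eq_ae a b f g" "t \<in> {a..b}"
  shows "f t = g t"
proof -
  have "continuous_on {a<..<b} (\<lambda>t. f t - g t)"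
    using assms by (intro continuous_intros) (auto intro: continuous_on_subset)
  then have "open ({a<..<b} \<inter> (\<lambda>t. f t - g t) -` (- {0}))"
    by (rule continuous_open_preimage) auto
  moreover have "{a<..<b} \<inter> (\<lambda>t. f t - g t) -` (- {0}) = {t \<in> {a<..<b}. f t \<noteq> g t}" by auto
  ultimately have "{t \<in> {a<..<b}. f t \<noteq> g t} = {}"
    using assms(4) open_not_negligible[of "{t \<in> {a<..<b}. f t \<noteq> g t}"]
    by (auto simp: eq_ae_def)
  then show ?thesis
    using assms by (intro continuous_eq_on_closed_interval[of a b f g t]) auto
qed

section \<open>Test functions and weak derivatives\<close>

lemma test_functions_pwC1:
  assumes "\<phi> \<in> test_functions {a<..<b}" "a < b"
  shows "pwC1 a b \<phi> (deriv \<phi>)" "\<phi> a = 0" "\<phi> b = 0" "continuous_on UNIV (deriv \<phi>)"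
proof -
  obtain D where D: "\<And>x. (\<phi> has_vector_derivative D x) (at x)" "continuous_on UNIV D"
    using assms unfolding test_functions_def C1_differentiable_on_def by auto
  have d: "(\<phi> has_real_derivative D x) (at x)" for x
    using D(1) by (simp add: has_real_derivative_iff_has_vector_derivative)
  then have "deriv \<phi> = D" by (auto intro: DERIV_imp_deriv)
  moreover have "continuous_on {a..b} \<phi>"
    using d by (intro continuous_at_imp_continuous_on) (auto intro: DERIV_isCont)
  ultimately show "pwC1 a b \<phi> (deriv \<phi>)" "continuous_on UNIV (deriv \<phi>)"
    unfolding pwC1_def using d D(2)
    by (auto intro!: exI[of _ "{}"] pc_continuous intro: continuous_on_subset)
  show "\<phi> a = 0" "\<phi> b = 0"
    using assms unfolding test_functions_def by force+
qed

lemma is_weak_deriv_iff: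
  assumes "a < b"
  shows "is_weak_deriv {a<..<b} v g \<longleftrightarrow> v \<in> L2 {a<..<b} \<and> g \<in> L2 {a<..<b} \<and>
    (\<forall>\<phi>\<in>test_functions {a<..<b}.
      integral {a..b} (\<lambda>t. v t * deriv \<phi> t) = - integral {a..b} (\<lambda>t. g t * \<phi> t))"
proof -
  have "(LINT t:{a<..<b}|lebesgue. v t * \<phi> t) = integral {a..b} (\<lambda>t. v t * \<phi> t)"
    if "v \<in> L2 {a<..<b}" "pc a b \<phi>" for v \<phi>
    by (intro LINT_interval L2_mult that pc_L2)
  then have "((LINT t:{a<..<b}|lebesgue. v t * deriv \<phi> t) = - (LINT t:{a<..<b}|lebesgue. g t * \<phi> t)) \<longleftrightarrow>
      integral {a..b} (\<lambda>t. v t * deriv \<phi> t) = - integral {a..b} (\<lambda>t. g t * \<phi> t)"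
    if "v \<in> L2 {a<..<b}" "g \<in> L2 {a<..<b}" "\<phi> \<in> test_functions {a<..<b}" for \<phi>
    using that pwC1D[OF test_functions_pwC1(1)[OF that(3) assms]] by simp
  then show ?thesis
    unfolding is_weak_deriv_def by blast
qed

lemma is_weak_deriv_cong:
  assumes "a < b" "eq_ae a b v v'" "eq_ae a b g g'"
  shows "is_weak_deriv {a<..<b} v g \<longleftrightarrow> is_weak_deriv {a<..<b} v' g'"
proof -
  have "is_weak_deriv {a<..<b} v' g'"
    if "eq_ae a b v v'" "eq_ae a b g g'" "is_weak_deriv {a<..<b} v g" for v v' g g'
    using that eq_ae_integral[OF eq_ae_comp2[OF that(1) that(1), of "\<lambda>t x _. x * \<phi> t" for \<phi>]]
      eq_ae_integral[OF eq_ae_comp2[OF that(2) that(2), of "\<lambda>t x _. x * \<phi> t" for \<phi>]]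
    unfolding is_weak_deriv_iff[OF assms(1)] by (auto intro: eq_ae_L2)
  then show ?thesis using assms eq_ae_sym by blast
qed

lemma pwC1_is_weak_deriv:
  assumes "a < b" "pwC1 a b v g"
  shows "is_weak_deriv {a<..<b} v g"
  unfolding is_weak_deriv_iff[OF assms(1)]
proof (intro conjI ballI)
  show "v \<in> L2 {a<..<b}" "g \<in> L2 {a<..<b}"
    using pwC1D[OF assms(2)] by (auto intro: pc_L2)
  fix \<phi> assume "\<phi> \<in> test_functions {a<..<b}"
  note \<phi> = test_functions_pwC1[OF this assms(1)]
  have p: "pc a b (\<lambda>t. g t * \<phi> t)" "pc a b (\<lambda>t. v t * deriv \<phi> t)"
    using pwC1D[OF assms(2)] pwC1D[OF \<phi>(1)] by (auto intro: pc_mult)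
  have "integral {a..b} (\<lambda>t. g t * \<phi> t + v t * deriv \<phi> t) = 0"
    using pwC1_integral[OF pwC1_mult[OF assms(2) \<phi>(1)], of a b] \<phi> assms(1) by simp
  then show "integral {a..b} (\<lambda>t. v t * deriv \<phi> t) = - integral {a..b} (\<lambda>t. g t * \<phi> t)"
    using integral_add[OF pc_integrable[OF p(1)] pc_integrable[OF p(2)]] by simp
qed

text \<open>Mean zero is what makes the primitive vanish again to the right of the support.\<close>

lemma test_function_antiderivative:
  assumes "continuous_on UNIV \<xi>" "a < c" "c \<le> d" "d < b" "\<And>t. t \<notin> {c..d} \<Longrightarrow> \<xi> t = 0"
    and "integral {a..b} \<xi> = 0"
  obtains \<phi> where "\<phi> \<in> test_functions {a<..<b}" "deriv \<phi> = \<xi>"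
proof -
  define \<phi> where "\<phi> t = integral {a..t} \<xi>" for t
  have int: "\<xi> integrable_on {s..t}" for s t
    using assms(1) by (intro integrable_continuous_real) (auto intro: continuous_on_subset)
  have left: "\<phi> t = 0" if "t < c" for t
    using integral_cong[of "{a..t}" \<xi> "\<lambda>_. 0"] assms(5) that by (simp add: \<phi>_def)
  have right: "\<phi> t = 0" if "d < t" for t
  proof -
    have "integral {a..t} \<xi> = integral {a..d} \<xi> + integral {d..t} \<xi>"
      using that assms by (intro Henstock_Kurzweil_Integration.integral_combine[symmetric] int) auto
    also have "integral {d..t} \<xi> = 0"
      using assms(5) integral_cong_finite[of "{d}" "{d..t}" \<xi> "\<lambda>_. 0"] by auto
    finally have 1: "\<phi> t = integral {a..d} \<xi>" by (simp add: \<phi>_def)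
    have "integral {a..b} \<xi> = integral {a..d} \<xi> + integral {d..b} \<xi>"
      using that assms by (intro Henstock_Kurzweil_Integration.integral_combine[symmetric] int) auto
    also have "integral {d..b} \<xi> = 0"
      using assms(5) integral_cong_finite[of "{d}" "{d..b}" \<xi> "\<lambda>_. 0"] by auto
    finally show ?thesis using 1 assms(6) by simp
  qed
  have der: "(\<phi> has_real_derivative \<xi> t) (at t)" for t
  proof (cases "t < c")
    case True
    have "((\<lambda>_. 0) has_real_derivative 0) (at t)" by simp
    then have "(\<phi> has_real_derivative 0) (at t)"
      by (rule has_field_derivative_transform_within_open[of _ _ _ "{..<c}"]) (use True left in auto)
    then show ?thesis using True assms(5) by simp
  next
    case False
    \<comment> \<open>The upper limit \<open>t + 1\<close> makes t an interior point, also for t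
      beyond b.\<close>
    have "((\<lambda>x. integral {a..x} \<xi>) has_real_derivative \<xi> t) (at t within {a..t + 1})"
      using False assms by (intro integral_has_real_derivative) (auto intro: continuous_on_subset)
    then show ?thesis
      using False assms(2) at_within_Icc_at[of a t "t + 1"] by (simp add: \<phi>_def[abs_def])
  qed
  show ?thesis
  proof (rule that)
    show "deriv \<phi> = \<xi>" using der by (auto intro: DERIV_imp_deriv)
    show "\<phi> \<in> test_functions {a<..<b}"
      unfolding test_functions_def C1_differentiable_on_def mem_Collect_eq
    proof (intro conjI exI[of _ \<xi>] exI[of _ "{c..d}"] ballI allI impI)
      show "(\<phi> has_vector_derivative \<xi> x) (at x)" for x
        using der by (simp add: has_real_derivative_iff_has_vector_derivative)
      show "\<phi> t = 0" if "t \<notin> {c..d}" for t using left right that by force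
    qed (use assms in auto)
  qed
qed

text \<open>Du Bois-Reymond. The functions \<open>n \<tau> / (1 + n \<tau>)\<close> are continuous and increase to the indicator function
  of the interval on which \<open>\<tau>\<close> is positive.\<close>

lemma du_Bois_Reymond:
  fixes w :: "real \<Rightarrow> real"
  assumes "a < b" and w: "w absolutely_integrable_on {a..b}"
    and zero: "\<And>\<phi>. \<phi> \<in> test_functions {a<..<b} \<Longrightarrow> integral {a..b} (\<lambda>t. w t * deriv \<phi> t) = 0"
  shows "\<exists>k. eq_ae a b w (\<lambda>_. k)"
proof -
  define hat where "hat c d t = max 0 ((t - c) * (d - t))" for c d t :: real
  have hat_cont: "continuous_on S (hat c d)" for S c d
    unfolding hat_def by (intro continuous_intros)
  have hat_pos: "0 \<le> hat c d t" for c d t by (simp add: hat_def)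
  have hat_out: "hat c d t = 0" if "t \<notin> {c<..<d}" "c \<le> d" for c d t
    using that by (auto simp: hat_def max_def not_less mult_le_0_iff zero_le_mult_iff)
  have hat_in: "0 < hat c d t" if "t \<in> {c<..<d}" for c d t
    using that by (simp add: hat_def)
  define c0 where "c0 = (2 * a + b) / 3"
  define d0 where "d0 = (a + 2 * b) / 3"
  have cd0: "a < c0" "c0 < d0" "d0 < b" using assms(1) by (auto simp: c0_def d0_def)
  define \<theta> where "\<theta> = hat c0 d0"
  define I where "I = integral {a..b} \<theta>"
  have I: "I > 0"
  proof -
    have "I \<noteq> 0"
    proof
      assume "I = 0"
      then have "\<theta> t = 0" if "t \<in> {a..b}" for t
        using integral_eq_0_iff[of a b \<theta>] hat_cont hat_pos assms(1) that
        by (auto simp: I_def \<theta>_def)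
      then show False using hat_in[of "(c0 + d0) / 2" c0 d0] cd0 by (force simp: \<theta>_def)
    qed
    moreover have "0 \<le> I"
      unfolding I_def \<theta>_def using hat_pos by (intro integral_nonneg integrable_continuous_real hat_cont)
    ultimately show ?thesis by simp
  qed
  \<comment> \<open>The candidate for the constant: the mean of w with the fixed bump
    \<open>\<theta>\<close> as weight.\<close>
  define k where "k = integral {a..b} (\<lambda>t. \<theta> t * w t) / I"
  \<comment> \<open>Subtracting from \<psi> the multiple of \<open>\<theta>\<close> with the same
    integral leaves a function of mean zero, the derivative of a test function, which w
    annihilates.\<close>
  have key: "integral {a..b} (\<lambda>t. \<psi> t * (w t - k)) = 0"
    if \<psi>: "continuous_on UNIV \<psi>" "a < c" "c < d" "d < b" "\<And>t. t \<notin> {c..d} \<Longrightarrow> \<psi> t = 0" for \<psi> c d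
  proof -
    define J where "J = integral {a..b} \<psi>"
    define \<xi> where "\<xi> t = \<psi> t - J / I * \<theta> t" for t
    have pc: "pc a b \<psi>" "pc a b \<theta>"
      unfolding \<theta>_def by (auto intro!: pc_continuous hat_cont intro: continuous_on_subset[OF \<psi>(1)])
    have "(\<xi> has_integral (J - J / I * I)) {a..b}"
      unfolding \<xi>_def I_def J_def
      by (intro has_integral_diff has_integral_mult_right integrable_integral pc_integrable pc)
    then have \<xi>0: "integral {a..b} \<xi> = 0" using I by (auto dest: integral_unique)
    obtain \<phi> where \<phi>: "\<phi> \<in> test_functions {a<..<b}" "deriv \<phi> = \<xi>"
    proof (rule test_function_antiderivative[of \<xi> a "min c c0" "max d d0" b])
      show "continuous_on UNIV \<xi>"
        unfolding \<xi>_def \<theta>_def by (intro continuous_intros \<psi> hat_cont)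
      show "\<xi> t = 0" if "t \<notin> {min c c0..max d d0}" for t
      proof -
        have "t \<notin> {c..d}" "t \<notin> {c0<..<d0}" using that by auto
        then show ?thesis using \<psi>(5)[of t] hat_out[of t c0 d0] cd0 by (simp add: \<xi>_def \<theta>_def)
      qed
    qed (use cd0 \<psi> \<xi>0 in auto)
    have iw: "(\<lambda>t. \<psi> t * w t) integrable_on {a..b}" "(\<lambda>t. \<theta> t * w t) integrable_on {a..b}"
      using pc_times_absolutely_integrable[OF _ w] pc by (auto simp: absolutely_integrable_on_def)
    have "((\<lambda>t. \<psi> t * w t - J / I * (\<theta> t * w t)) has_integral
      (integral {a..b} (\<lambda>t. \<psi> t * w t) - J / I * integral {a..b} (\<lambda>t. \<theta> t * w t))) {a..b}"
      by (intro has_integral_diff has_integral_mult_right integrable_integral iw)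
    moreover have "(\<lambda>t. \<psi> t * w t - J / I * (\<theta> t * w t)) = (\<lambda>t. w t * \<xi> t)"
      by (auto simp: \<xi>_def algebra_simps)
    ultimately have "integral {a..b} (\<lambda>t. w t * \<xi> t) = integral {a..b} (\<lambda>t. \<psi> t * w t) - J * k"
      by (simp add: k_def integral_unique)
    then have Jk: "integral {a..b} (\<lambda>t. \<psi> t * w t) - J * k = 0"
      using zero[OF \<phi>(1)] \<phi>(2) by simp
    have "((\<lambda>t. \<psi> t * w t - k * \<psi> t) has_integral
      (integral {a..b} (\<lambda>t. \<psi> t * w t) - k * J)) {a..b}"
      unfolding J_def by (intro has_integral_diff has_integral_mult_right integrable_integral iw pc_integrable pc)
    moreover have "(\<lambda>t. \<psi> t * w t - k * \<psi> t) = (\<lambda>t. \<psi> t * (w t - k))"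
      by (auto simp: algebra_simps)
    ultimately have "integral {a..b} (\<lambda>t. \<psi> t * (w t - k)) = integral {a..b} (\<lambda>t. \<psi> t * w t) - k * J"
      by (simp add: integral_unique)
    then show ?thesis using Jk by (simp add: mult.commute)
  qed
  have wk: "(\<lambda>t. w t - k) absolutely_integrable_on {a..b}"
    using w by (intro set_integral_diff(1)) (auto intro: absolutely_integrable_on_const)
  have "integral {c..d} (\<lambda>t. w t - k) = 0" if cd: "a < c" "c < d" "d < b" for c d
  proof -
    define \<psi> where "\<psi> n t = real n * hat c d t / (1 + real n * hat c d t)" for n t
    have den: "0 < 1 + real n * hat c d t" for n t
      using hat_pos[of c d t] by (intro add_pos_nonneg) auto
    have \<psi>c: "continuous_on S (\<psi> n)" for n S
      unfolding \<psi>_def using den by (intro continuous_intros hat_cont) (auto simp: less_imp_neq[symmetric])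
    have \<psi>b: "\<bar>\<psi> n t\<bar> \<le> 1" for n t
      using den[of n t] hat_pos[of c d t] by (simp add: \<psi>_def abs_divide)
    have lim: "(\<lambda>n. integral {a..b} (\<lambda>t. \<psi> n t * (w t - k))) \<longlonglongrightarrow>
        integral {a..b} (\<lambda>t. if t \<in> {c<..<d} then w t - k else 0)"
    proof (rule dominated_convergence(2))
      show "(\<lambda>t. \<psi> n t * (w t - k)) integrable_on {a..b}" for n
        using pc_times_absolutely_integrable[OF pc_continuous[OF \<psi>c] wk]
        by (auto simp: absolutely_integrable_on_def)
      show "(\<lambda>t. \<bar>w t - k\<bar>) integrable_on {a..b}"
        using wk by (auto simp: absolutely_integrable_on_def)
      show "norm (\<psi> n t * (w t - k)) \<le> \<bar>w t - k\<bar>" for n t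
        using \<psi>b[of n t] by (simp add: abs_mult mult_left_le_one_le)
      show "(\<lambda>n. \<psi> n t * (w t - k)) \<longlonglongrightarrow> (if t \<in> {c<..<d} then w t - k else 0)" for t
      proof (cases "t \<in> {c<..<d}")
        case True
        have h: "0 < hat c d t" by (rule hat_in[OF True])
        have "(\<lambda>n. real n * hat c d t / (1 + real n * hat c d t)) \<longlonglongrightarrow> 1"
          using h by real_asymp
        then have "(\<lambda>n. \<psi> n t * (w t - k)) \<longlonglongrightarrow> 1 * (w t - k)"
          unfolding \<psi>_def by (intro tendsto_mult tendsto_const)
        then show ?thesis using True by simp
      next
        case False
        then have "hat c d t = 0" using hat_out[of t c d] cd by simp
        then have "\<psi> n t * (w t - k) = (if t \<in> {c<..<d} then w t - k else 0)" for n
          using False by (auto simp: \<psi>_def)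
        then show ?thesis by simp
      qed
    qed
    have "integral {a..b} (\<lambda>t. \<psi> n t * (w t - k)) = 0" for n
      by (rule key[OF \<psi>c cd]) (use hat_out cd in \<open>auto simp: \<psi>_def\<close>)
    then have "integral {a..b} (\<lambda>t. if t \<in> {c<..<d} then w t - k else 0) = 0"
      using lim by (simp add: LIMSEQ_const_iff)
    moreover have "integral {a..b} (\<lambda>t. if t \<in> {c<..<d} then w t - k else 0) = integral {c<..<d} (\<lambda>t. w t - k)"
      using cd by (subst integral_restrict_Int) (auto intro!: arg_cong2[where f = integral])
    ultimately show ?thesis by (simp add: integral_open_interval_real)
  qed
  then have "negligible {t \<in> {a<..<b}. w t - k \<noteq> 0}"
    using wk by (intro negligible_of_zero_integrals) (auto simp: absolutely_integrable_on_def)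
  then show ?thesis by (auto simp: eq_ae_def)
qed

lemma pwC1_cong:
  assumes "pwC1 a b f f'" "\<And>t. t \<in> {a..b} \<Longrightarrow> g t = f t"
  shows "pwC1 a b g f'"
proof -
  obtain Y where Y: "finite Y" "\<forall>t\<in>{a<..<b} - Y. (f has_real_derivative f' t) (at t)"
    using assms(1) unfolding pwC1_def by blast
  have "(g has_real_derivative f' t) (at t)" if t: "t \<in> {a<..<b} - Y" for t
  proof (rule has_field_derivative_transform_within_open)
    show "(f has_real_derivative f' t) (at t)" using Y(2) t by blast
    show "f s = g s" if "s \<in> {a<..<b}" for s using assms(2)[of s] that by simp
  qed (use t in auto)
  moreover have "continuous_on {a..b} g"
    by (rule continuous_on_eq[OF pwC1_cont[OF assms(1)]]) (rule assms(2)[symmetric])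
  ultimately show ?thesis
    using Y(1) pwC1_pc'[OF assms(1)] unfolding pwC1_def by blast
qed

text \<open>Integration by parts shows that v minus the primitive of g annihilates the derivatives
  of all test functions, so by \<open>du_Bois_Reymond\<close> it is constant almost
  everywhere.\<close>

lemma weak_deriv_representation:
  assumes ab: "a < b" and v: "is_weak_deriv {a<..<b} v g"
  shows "\<exists>c. eq_ae a b v (\<lambda>t. c + integral {a..t} g)"
proof -
  define G where "G t = integral {a..t} g" for t
  have L2: "v \<in> L2 {a<..<b}" "g \<in> L2 {a<..<b}" using v by (auto simp: is_weak_deriv_def)
  have gi: "g absolutely_integrable_on {a..b}" and vi: "v absolutely_integrable_on {a..b}"
    using L2 by (auto simp: L2_iff)
  have Gc: "continuous_on {a..b} G"
    unfolding G_def using gi by (intro indefinite_integral_continuous_1) (simp add: absolutely_integrable_on_def)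
  have Gi: "G absolutely_integrable_on {a..b}"
    by (intro pc_absolutely_integrable pc_continuous Gc)
  have "\<exists>k. eq_ae a b (\<lambda>t. v t - G t) (\<lambda>_. k)"
  proof (rule du_Bois_Reymond[OF ab set_integral_diff(1)[OF vi Gi]])
    fix \<phi> assume \<phi>: "\<phi> \<in> test_functions {a<..<b}"
    note p = test_functions_pwC1[OF \<phi> ab]
    have "(\<lambda>t. v t * deriv \<phi> t) integrable_on {a..b}"
      using L2_mult[OF L2(1) pc_L2[OF pwC1_pc'[OF p(1)]]] by (simp add: absolutely_integrable_on_def)
    moreover have "(\<lambda>t. G t * deriv \<phi> t) integrable_on {a..b}"
      by (intro pc_integrable pc_mult pc_continuous Gc pwC1_pc'[OF p(1)])
    ultimately have "integral {a..b} (\<lambda>t. v t * deriv \<phi> t - G t * deriv \<phi> t) =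
        integral {a..b} (\<lambda>t. v t * deriv \<phi> t) - integral {a..b} (\<lambda>t. G t * deriv \<phi> t)"
      by (rule integral_diff)
    also have "\<dots> = - integral {a..b} (\<lambda>t. g t * \<phi> t) - - integral {a..b} (\<lambda>t. g t * \<phi> t)"
      using v \<phi> integral_by_parts_vanishing[OF less_imp_le[OF ab] gi p(1,3)]
      unfolding is_weak_deriv_iff[OF ab] G_def by simp
    finally show "integral {a..b} (\<lambda>t. (v t - G t) * deriv \<phi> t) = 0"
      by (simp add: left_diff_distrib)
  qed
  then obtain k where "eq_ae a b (\<lambda>t. v t - G t) (\<lambda>_. k)" by blast
  then have "eq_ae a b v (\<lambda>t. k + integral {a..t} g)"
    by (simp add: eq_ae_def G_def algebra_simps)
  then show ?thesis by blast
qed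

lemma eq_ae_of_equal_primitives:
  fixes g h :: "real \<Rightarrow> real"
  assumes "a < b" "g integrable_on {a..b}" "h integrable_on {a..b}"
    and "\<And>t. t \<in> {a..b} \<Longrightarrow> integral {a..t} g = integral {a..t} h"
  shows "eq_ae a b g h"
proof -
  have i: "(\<lambda>t. g t - h t) integrable_on {c..d}" if "a \<le> c" "d \<le> b" for c d
    using integrable_subinterval_real[OF integrable_diff[OF assms(2,3)]] that by auto
  have z: "integral {a..t} (\<lambda>t. g t - h t) = 0" if "t \<in> {a..b}" for t
    using assms(4)[OF that] that integrable_subinterval_real[OF assms(2), of a t]
      integrable_subinterval_real[OF assms(3), of a t] by (subst integral_diff) auto
  have "negligible {t \<in> {a<..<b}. g t - h t \<noteq> 0}"
  proof (rule negligible_of_zero_integrals)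
    fix c d assume "a < c" "c < d" "d < b"
    then show "integral {c..d} (\<lambda>t. g t - h t) = 0"
      using z[of c] z[of d] i[of a d] Henstock_Kurzweil_Integration.integral_combine[of a c d "\<lambda>t. g t - h t"] by auto
  qed (use i in auto)
  then show ?thesis by (simp add: eq_ae_def)
qed

text \<open>The two continuous representatives of v coincide at every point. At a this gives equal
  constants, and then equal primitives of g and h.\<close>

lemma weak_deriv_unique:
  assumes ab: "a < b" and g: "is_weak_deriv {a<..<b} v g" and h: "is_weak_deriv {a<..<b} v h"
  shows "eq_ae a b g h"
proof -
  obtain c where c: "eq_ae a b v (\<lambda>t. c + integral {a..t} g)"
    using weak_deriv_representation[OF ab g] by blast
  obtain d where d: "eq_ae a b v (\<lambda>t. d + integral {a..t} h)"
    using weak_deriv_representation[OF ab h] by blast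
  have gh: "g integrable_on {a..b}" "h integrable_on {a..b}"
    using g h by (auto simp: is_weak_deriv_def L2_iff absolutely_integrable_on_def)
  have eq: "c + integral {a..t} g = d + integral {a..t} h" if "t \<in> {a..b}" for t
    by (rule eq_ae_continuous[OF ab _ _ eq_ae_trans[OF eq_ae_sym[OF c] d] that])
      (intro continuous_intros indefinite_integral_continuous_1 gh)+
  show ?thesis
    by (rule eq_ae_of_equal_primitives[OF ab gh]) (use eq eq[of a] ab in auto)
qed

lemma weak_deriv_eq_ae:
  assumes "a < b" "is_weak_deriv {a<..<b} v g"
  shows "is_weak_deriv {a<..<b} v (weak_deriv {a<..<b} v)" "eq_ae a b (weak_deriv {a<..<b} v) g"
proof -
  show *: "is_weak_deriv {a<..<b} v (weak_deriv {a<..<b} v)"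
    unfolding weak_deriv_def using someI[of "is_weak_deriv {a<..<b} v", OF assms(2)] .
  show "eq_ae a b (weak_deriv {a<..<b} v) g"
    by (rule weak_deriv_unique[OF assms(1) * assms(2)])
qed

text \<open>Links classical derivatives to \<open>weak_deriv\<close>, which is a Hilbert choice: by
  uniqueness every choice agrees almost everywhere with the derivative of a piecewise C1
  representative.\<close>

lemma weak_deriv_pwC1:
  assumes "a < b" "pwC1 a b w g" "eq_ae a b v w"
  shows "is_weak_deriv {a<..<b} v g" "eq_ae a b (weak_deriv {a<..<b} v) g"
proof -
  show *: "is_weak_deriv {a<..<b} v g"
    using is_weak_deriv_cong[OF assms(1,3) eq_ae_refl] pwC1_is_weak_deriv[OF assms(1,2)] by simp
  show "eq_ae a b (weak_deriv {a<..<b} v) g"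
    by (rule weak_deriv_eq_ae(2)[OF assms(1) *])
qed

text \<open>The recursion refers to v only in its outermost step, so a case distinction replaces
  induction.\<close>

lemma sobolev_eq_ae:
  assumes "a < b" "eq_ae a b v w" "v \<in> sobolev k {a<..<b}"
  shows "w \<in> sobolev k {a<..<b}"
proof (cases k)
  case 0
  then show ?thesis using assms eq_ae_L2 by auto
next
  case (Suc l)
  then show ?thesis
    using assms eq_ae_L2[OF _ assms(2)] is_weak_deriv_cong[OF assms(1,2) eq_ae_refl] by auto
qed

section \<open>Continuous representatives of Sobolev functions\<close>

lemma sobolev_weak_deriv:
  assumes "a < b" "v \<in> sobolev (Suc k) {a<..<b}"
  shows "is_weak_deriv {a<..<b} v (weak_deriv {a<..<b} v)" "weak_deriv {a<..<b} v \<in> sobolev k {a<..<b}"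
proof -
  obtain g where g: "g \<in> sobolev k {a<..<b}" "is_weak_deriv {a<..<b} v g"
    using assms(2) by auto
  show "is_weak_deriv {a<..<b} v (weak_deriv {a<..<b} v)"
    by (rule weak_deriv_eq_ae[OF assms(1) g(2)])
  show "weak_deriv {a<..<b} v \<in> sobolev k {a<..<b}"
    using sobolev_eq_ae[OF assms(1) eq_ae_sym[OF weak_deriv_eq_ae(2)[OF assms(1) g(2)]] g(1)] .
qed

lemma sobolev_iterated_weak_deriv:
  assumes "a < b" "v \<in> sobolev n {a<..<b}" "k < n"
  shows "is_weak_deriv {a<..<b} ((weak_deriv {a<..<b} ^^ k) v) ((weak_deriv {a<..<b} ^^ Suc k) v)"
proof -
  have "(weak_deriv {a<..<b} ^^ j) v \<in> sobolev (n - j) {a<..<b}" if "j \<le> n" for j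
    using that
  proof (induction j)
    case (Suc j)
    then have "(weak_deriv {a<..<b} ^^ j) v \<in> sobolev (Suc (n - Suc j)) {a<..<b}"
      by (simp add: Suc_diff_Suc)
    then show ?case using sobolev_weak_deriv(2)[OF assms(1)] by simp
  qed (use assms in simp)
  from this[of k] assms(3) have "(weak_deriv {a<..<b} ^^ k) v \<in> sobolev (Suc (n - Suc k)) {a<..<b}"
    by (simp add: Suc_diff_Suc)
  then show ?thesis using sobolev_weak_deriv(1)[OF assms(1)] by simp
qed

text \<open>Each weak derivative of order at most n is almost everywhere a constant plus a primitive
  of the next one; these primitives are the functions \<open>W k\<close>. The derivative of order n
  + 1 is only square integrable and need not lie in \<open>pc\<close>, so for \<open>W n\<close> the
  increments are recorded as integrals instead of a \<open>pwC1\<close> statement.\<close>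

lemma sobolev_representative:
  fixes v :: "real \<Rightarrow> real" and a b :: real
  defines "U \<equiv> \<lambda>k. (weak_deriv {a<..<b} ^^ k) v"
  assumes ab: "a < b" and v: "v \<in> sobolev (Suc n) {a<..<b}"
  obtains W where "\<And>k. k < n \<Longrightarrow> pwC1 a b (W k) (W (Suc k))" "\<And>k. k \<le> n \<Longrightarrow> continuous_on {a..b} (W k)"
    "\<And>k. k \<le> n \<Longrightarrow> eq_ae a b (U k) (W k)"
    "\<And>s t. a \<le> s \<Longrightarrow> s \<le> t \<Longrightarrow> t \<le> b \<Longrightarrow> W n t - W n s = integral {s..t} (U (Suc n))"
    "U (Suc n) \<in> L2 {a<..<b}"
proof -
  have wd: "is_weak_deriv {a<..<b} (U k) (U (Suc k))" if "k \<le> n" for k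
    unfolding U_def using sobolev_iterated_weak_deriv[OF ab v, of k] that by simp
  have "\<forall>k. \<exists>c. k \<le> n \<longrightarrow> eq_ae a b (U k) (\<lambda>t. c + integral {a..t} (U (Suc k)))"
    using weak_deriv_representation[OF ab wd] by blast
  then obtain c where c: "\<And>k. k \<le> n \<Longrightarrow> eq_ae a b (U k) (\<lambda>t. c k + integral {a..t} (U (Suc k)))"
    by metis
  define W where "W k t = c k + integral {a..t} (U (Suc k))" for k t
  have int: "U (Suc k) integrable_on {a..b}" if "k \<le> n" for k
    using wd[OF that] by (auto simp: is_weak_deriv_def L2_iff absolutely_integrable_on_def)
  have ae: "eq_ae a b (U k) (W k)" if "k \<le> n" for k
    unfolding W_def using c[OF that] .
  have cont: "continuous_on {a..b} (W k)" if "k \<le> n" for k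
    unfolding W_def by (intro continuous_intros indefinite_integral_continuous_1 int that)
  have step: "pwC1 a b (W k) (W (Suc k))" if "k < n" for k
  proof -
    have "pwC1 a b (\<lambda>t. c k + integral {a..t} (W (Suc k))) (\<lambda>t. 0 + W (Suc k) t)"
      using that by (intro pwC1_add pwC1_const pwC1_indefinite pc_continuous cont) simp
    moreover have "W k t = c k + integral {a..t} (W (Suc k))" if "t \<in> {a..b}" for t
    proof -
      have "eq_ae a t (U (Suc k)) (W (Suc k))"
        using that \<open>k < n\<close> by (intro eq_ae_mono[OF ae[of "Suc k"]]) auto
      then show ?thesis using eq_ae_integral by (simp add: W_def[of k])
    qed
    ultimately show ?thesis by (intro pwC1_cong[of a b _ "W (Suc k)" "W k"]) auto
  qed
  show ?thesis
  proof (rule that[of W, OF step cont ae])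
    show "U (Suc n) \<in> L2 {a<..<b}" using wd[of n] by (simp add: is_weak_deriv_def)
    fix s t assume st: "a \<le> s" "s \<le> t" "t \<le> b"
    have "integral {a..s} (U (Suc n)) + integral {s..t} (U (Suc n)) = integral {a..t} (U (Suc n))"
      using st by (intro Henstock_Kurzweil_Integration.integral_combine integrable_subinterval_real[OF int[of n]]) auto
    then show "W n t - W n s = integral {s..t} (U (Suc n))" by (simp add: W_def)
  qed
qed

lemma L2_norm_eq_nrm: "f \<in> L2 {0<..<L} \<Longrightarrow> L2_norm {0<..<L} f = nrm L f"
  unfolding L2_norm_def nrm_def by (simp add: LINT_interval L2_iff)

lemma eq_ae_nrm: "eq_ae 0 L f g \<Longrightarrow> nrm L f = nrm L g"
  unfolding nrm_def using eq_ae_integral[OF eq_ae_comp2[of 0 L f g f g "\<lambda>_ x _. x\<^sup>2"]] by simp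

lemma L2_integral_abs:
  assumes "f \<in> L2 {0<..<L}" "0 \<le> L"
  shows "integral {0..L} (\<lambda>t. \<bar>f t\<bar>) \<le> sqrt L * nrm L f"
proof -
  have i: "(\<lambda>t. (f t)\<^sup>2) integrable_on {0..L}" "(\<lambda>t. \<bar>f t\<bar>) integrable_on {0..L}"
    using assms(1) by (auto simp: L2_iff absolutely_integrable_on_def)
  have "\<bar>integral {0..L} (\<lambda>t. \<bar>f t\<bar>)\<bar> \<le> \<bar>sqrt L * nrm L f\<bar>"
    unfolding abs_le_square_iff power_mult_distrib
    using integral_abs_square_le[OF assms(2) i] assms(2) i
    by (simp add: nrm_def integral_nonneg)
  then show ?thesis using assms(2) by (simp add: abs_mult)
qed

lemma sobolev_seminorm_pwC1:
  assumes "0 < L" "pwC1 0 L w g" "eq_ae 0 L v w"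
  shows "sobolev_seminorm 1 {0<..<L} v = nrm L g"
proof -
  note w = weak_deriv_pwC1[OF assms]
  have "weak_deriv {0<..<L} v \<in> L2 {0<..<L}"
    using eq_ae_L2[OF pc_L2[OF pwC1_pc'[OF assms(2)]] eq_ae_sym[OF w(2)]] .
  then show ?thesis
    using eq_ae_nrm[OF w(2)] by (simp add: sobolev_seminorm_def L2_norm_eq_nrm)
qed

section \<open>Test functions in the first-order space and boundary values\<close>

lemma test_functions_subset_H10:
  assumes "0 < L" "\<phi> \<in> test_functions {0<..<L}"
  shows "\<phi> \<in> H10 {0<..<L}"
proof -
  note p = test_functions_pwC1[OF assms(2,1)]
  have "is_weak_deriv {0<..<L} \<phi> (deriv \<phi>)" by (rule pwC1_is_weak_deriv[OF assms(1) p(1)])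
  then have "\<phi> \<in> sobolev 1 {0<..<L}" by (auto simp: is_weak_deriv_def)
  moreover have "H1_norm {0<..<L} (\<lambda>t. \<phi> t - \<phi> t) = 0"
    using sobolev_seminorm_pwC1[OF assms(1) pwC1_const[of 0 L 0], of "\<lambda>t. 0"]
    by (simp add: H1_norm_def L2_norm_def nrm_def)
  ultimately show ?thesis
    unfolding H10_def using assms(2) by force
qed

text \<open>A trace inequality. For a test function \<phi> close to u, the continuous function w -
  \<phi> has at an end point at most its mean absolute value plus the L1 norm of its derivative.
  Both are controlled by the H1 distance, and \<phi> vanishes at the end point.\<close>

lemma H10_boundary_values:
  assumes L: "0 < L" and u: "u \<in> H10 {0<..<L}"
    and w: "continuous_on {0..L} w" "eq_ae 0 L u w"
  shows "w 0 = 0" "w L = 0"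
proof -
  define g where "g = weak_deriv {0<..<L} u"
  have "u \<in> sobolev (Suc 0) {0<..<L}" using u by (simp add: H10_def)
  then have g: "is_weak_deriv {0<..<L} u g"
    unfolding g_def by (rule sobolev_weak_deriv(1)[OF L])
  then have uL2: "u \<in> L2 {0<..<L}" and gL2: "g \<in> L2 {0<..<L}" by (auto simp: is_weak_deriv_def)
  obtain c where c: "eq_ae 0 L u (\<lambda>t. c + integral {0..t} g)"
    using weak_deriv_representation[OF L g] by blast
  have gi: "g integrable_on {0..L}" using gL2 by (auto simp: L2_iff absolutely_integrable_on_def)
  have wc: "w t = c + integral {0..t} g" if "t \<in> {0..L}" for t
    by (rule eq_ae_continuous[OF L w(1) _ eq_ae_trans[OF eq_ae_sym[OF w(2)] c] that])
      (intro continuous_intros indefinite_integral_continuous_1 gi)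
  have bound: "\<bar>w s\<bar> \<le> (sqrt L / L + sqrt L) * \<epsilon>" if \<epsilon>: "0 < \<epsilon>" and s: "s = 0 \<or> s = L" for \<epsilon> s
  proof -
    obtain \<phi> where \<phi>: "\<phi> \<in> test_functions {0<..<L}" "H1_norm {0<..<L} (\<lambda>t. u t - \<phi> t) < \<epsilon>"
      using u \<epsilon> unfolding H10_def by blast
    note p = test_functions_pwC1[OF \<phi>(1) L]
    define d where "d t = g t - deriv \<phi> t" for t
    define D where "D t = w t - \<phi> t" for t
    have \<phi>wd: "is_weak_deriv {0<..<L} \<phi> (deriv \<phi>)" by (rule pwC1_is_weak_deriv[OF L p(1)])
    have dL2: "d \<in> L2 {0<..<L}"
      unfolding d_def using gL2 \<phi>wd by (intro L2_diff) (auto simp: is_weak_deriv_def)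
    have dwd: "is_weak_deriv {0<..<L} (\<lambda>t. u t - \<phi> t) d"
      unfolding is_weak_deriv_iff[OF L]
    proof (intro conjI ballI)
      show "(\<lambda>t. u t - \<phi> t) \<in> L2 {0<..<L}"
        using uL2 \<phi>wd by (intro L2_diff) (auto simp: is_weak_deriv_def)
      fix \<psi> assume \<psi>: "\<psi> \<in> test_functions {0<..<L}"
      note q = test_functions_pwC1[OF \<psi> L]
      have i: "(\<lambda>t. v t * \<psi>' t) integrable_on {0..L}" if "v \<in> L2 {0<..<L}" "pc 0 L \<psi>'" for v \<psi>'
        using L2_mult[OF that(1) pc_L2[OF that(2)]] by (simp add: absolutely_integrable_on_def)
      have \<phi>L2: "\<phi> \<in> L2 {0<..<L}" "deriv \<phi> \<in> L2 {0<..<L}" using \<phi>wd by (auto simp: is_weak_deriv_def)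
      have "integral {0..L} (\<lambda>t. u t * deriv \<psi> t - \<phi> t * deriv \<psi> t) =
        integral {0..L} (\<lambda>t. u t * deriv \<psi> t) - integral {0..L} (\<lambda>t. \<phi> t * deriv \<psi> t)"
        by (intro integral_diff i uL2 \<phi>L2 pwC1_pc'[OF q(1)])
      moreover have "integral {0..L} (\<lambda>t. g t * \<psi> t - deriv \<phi> t * \<psi> t) =
        integral {0..L} (\<lambda>t. g t * \<psi> t) - integral {0..L} (\<lambda>t. deriv \<phi> t * \<psi> t)"
        by (intro integral_diff i gL2 \<phi>L2 pwC1_pc[OF q(1)])
      ultimately show "integral {0..L} (\<lambda>t. (u t - \<phi> t) * deriv \<psi> t) = - integral {0..L} (\<lambda>t. d t * \<psi> t)"
        using g \<phi>wd \<psi> unfolding is_weak_deriv_iff[OF L] d_def by (simp add: left_diff_distrib)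
    qed (rule dL2)
    have aeD: "eq_ae 0 L (\<lambda>t. u t - \<phi> t) D"
      unfolding D_def using eq_ae_comp2[OF w(2) eq_ae_refl[of 0 L \<phi>], of "\<lambda>_ x y. x - y"] .
    have uL: "(\<lambda>t. u t - \<phi> t) \<in> L2 {0<..<L}" using dwd by (simp add: is_weak_deriv_def)
    have wdd: "eq_ae 0 L (weak_deriv {0<..<L} (\<lambda>t. u t - \<phi> t)) d"
      by (rule weak_deriv_eq_ae(2)[OF L dwd])
    have N1: "nrm L D \<le> \<epsilon>" and N2: "nrm L d \<le> \<epsilon>"
    proof -
      have "L2_norm {0<..<L} (\<lambda>t. u t - \<phi> t) = nrm L D"
        using L2_norm_eq_nrm[OF uL] eq_ae_nrm[OF aeD] by simp
      moreover have "sobolev_seminorm 1 {0<..<L} (\<lambda>t. u t - \<phi> t) = nrm L d"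
        using L2_norm_eq_nrm[OF eq_ae_L2[OF dL2 eq_ae_sym[OF wdd]]] eq_ae_nrm[OF wdd]
        by (simp add: sobolev_seminorm_def)
      ultimately have "sqrt ((nrm L D)\<^sup>2 + (nrm L d)\<^sup>2) < \<epsilon>"
        using \<phi>(2) by (simp add: H1_norm_def)
      then show "nrm L D \<le> \<epsilon>" "nrm L d \<le> \<epsilon>"
        by (meson order_trans[OF real_sqrt_sum_squares_ge1 less_imp_le]
            order_trans[OF real_sqrt_sum_squares_ge2 less_imp_le])+
    qed
    have DL2: "D \<in> L2 {0<..<L}" by (rule eq_ae_L2[OF uL aeD])
    have Ddiff: "\<bar>D t - D s\<bar> \<le> sqrt L * \<epsilon>" if t: "t \<in> {0..L}" for t
    proof -
      have di: "d integrable_on {0..L}" "(\<lambda>t. \<bar>d t\<bar>) integrable_on {0..L}"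
        using dL2 by (auto simp: L2_iff absolutely_integrable_on_def)
      have D: "D r = c - \<phi> 0 + integral {0..r} d" if r: "r \<in> {0..L}" for r
      proof -
        have "integral {0..r} d = integral {0..r} g - integral {0..r} (deriv \<phi>)"
          unfolding d_def using r by (intro integral_diff integrable_subinterval_real[OF gi]
              pc_integrable_sub[OF pwC1_pc'[OF p(1)]]) auto
        also have "integral {0..r} (deriv \<phi>) = \<phi> r - \<phi> 0"
          using r by (intro pwC1_integral[OF p(1)]) auto
        finally show ?thesis using wc[OF r] by (simp add: D_def)
      qed
      \<comment> \<open>Either end point bounds, together with t, a subinterval over which the
        increment is an integral of d up to sign; this treats both ends at once.\<close>
      have "\<exists>r r'. {r..r'} \<subseteq> {0..L} \<and> \<bar>D t - D s\<bar> = \<bar>integral {r..r'} d\<bar>"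
      proof (cases "s = 0")
        case True
        then show ?thesis using D[of t] D[of 0] t by (intro exI[of _ 0] exI[of _ t]) auto
      next
        case False
        then have "s = L" using s by simp
        have "integral {0..t} d + integral {t..L} d = integral {0..L} d"
          using t by (intro Henstock_Kurzweil_Integration.integral_combine di) auto
        then show ?thesis using D[of t] D[of L] t \<open>s = L\<close> L by (intro exI[of _ t] exI[of _ L]) auto
      qed
      then obtain r r' where r: "{r..r'} \<subseteq> {0..L}" "\<bar>D t - D s\<bar> = \<bar>integral {r..r'} d\<bar>" by blast
      have i: "d integrable_on {r..r'}" "(\<lambda>t. \<bar>d t\<bar>) integrable_on {r..r'}"
        using integrable_subinterval_real[OF di(1) r(1)] integrable_subinterval_real[OF di(2) r(1)] by auto
      have "\<bar>integral {r..r'} d\<bar> \<le> integral {r..r'} (\<lambda>t. \<bar>d t\<bar>)"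
        using integral_norm_bound_integral[OF i] by simp
      also have "\<dots> \<le> integral {0..L} (\<lambda>t. \<bar>d t\<bar>)"
        by (intro integral_subset_le r i di) simp
      also have "\<dots> \<le> sqrt L * nrm L d" using L by (intro L2_integral_abs dL2) simp
      also have "\<dots> \<le> sqrt L * \<epsilon>" using N2 L by (intro mult_left_mono) auto
      finally show ?thesis using r(2) by simp
    qed
    have Di: "(\<lambda>t. \<bar>D t\<bar>) integrable_on {0..L}"
      using DL2 by (auto simp: L2_iff absolutely_integrable_on_def)
    \<comment> \<open>The pointwise comparison of D s with D t is averaged over t.\<close>
    have "L * \<bar>D s\<bar> = integral {0..L} (\<lambda>t. \<bar>D s\<bar>)" using L by simp
    also have "\<dots> \<le> integral {0..L} (\<lambda>t. \<bar>D t\<bar> + sqrt L * \<epsilon>)"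
    proof (rule integral_le)
      show "\<bar>D s\<bar> \<le> \<bar>D t\<bar> + sqrt L * \<epsilon>" if "t \<in> {0..L}" for t
        using Ddiff[OF that] by linarith
    qed (use Di in \<open>auto intro: integrable_add\<close>)
    also have "\<dots> = integral {0..L} (\<lambda>t. \<bar>D t\<bar>) + L * (sqrt L * \<epsilon>)"
      using L Di by (subst integral_add) auto
    also have "\<dots> \<le> sqrt L * \<epsilon> + L * (sqrt L * \<epsilon>)"
    proof (rule add_right_mono)
      have "integral {0..L} (\<lambda>t. \<bar>D t\<bar>) \<le> sqrt L * nrm L D"
        using L by (intro L2_integral_abs[OF DL2]) simp
      also have "\<dots> \<le> sqrt L * \<epsilon>" using N1 L by (intro mult_left_mono) auto
      finally show "integral {0..L} (\<lambda>t. \<bar>D t\<bar>) \<le> sqrt L * \<epsilon>" .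
    qed
    also have "\<dots> = L * ((sqrt L / L + sqrt L) * \<epsilon>)" using L by (simp add: ring_distribs)
    finally have "\<bar>D s\<bar> \<le> (sqrt L / L + sqrt L) * \<epsilon>" using L by simp
    then show ?thesis using s p(2,3) by (auto simp: D_def)
  qed
  have "w s = 0" if s: "s = 0 \<or> s = L" for s
  proof -
    define T where "T = sqrt L / L + sqrt L"
    have T: "0 < T" using L by (simp add: T_def add_pos_pos)
    have "\<bar>w s\<bar> \<le> 0"
    proof (rule field_le_epsilon)
      fix \<epsilon> :: real assume "0 < \<epsilon>"
      then show "\<bar>w s\<bar> \<le> 0 + \<epsilon>" using bound[OF _ s, of "\<epsilon> / T"] T by (simp flip: T_def)
    qed
    then show ?thesis by simp
  qed
  then show "w 0 = 0" "w L = 0" by auto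
qed

section \<open>The quasilinear problem\<close>

text \<open>The derivative extends continuously to the closed strip, hence is bounded on the compact
  part with values up to R, and the mean value inequality applies on this convex set. The constant
  depends on R.\<close>

lemma C1_on_closure_Lipschitz:
  fixes f :: "real \<times> real \<Rightarrow> real"
  assumes "C1_on_closure ({c<..<d} \<times> UNIV) f" "c < d"
  obtains \<Lambda> where "0 \<le> \<Lambda>" "\<And>s t \<zeta>. s \<in> {c<..<d} \<Longrightarrow> t \<in> {c<..<d} \<Longrightarrow> \<bar>\<zeta>\<bar> \<le> R \<Longrightarrow>
    \<bar>f (t, \<zeta>) - f (s, \<zeta>)\<bar> \<le> \<Lambda> * \<bar>t - s\<bar>"
proof -
  obtain D :: "real \<times> real \<Rightarrow> (real \<times> real) \<Rightarrow>\<^sub>L real" where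
    D: "continuous_on (closure ({c<..<d} \<times> UNIV)) D"
      "\<And>z. z \<in> {c<..<d} \<times> UNIV \<Longrightarrow> (f has_derivative blinfun_apply (D z)) (at z)"
    using assms(1) unfolding C1_on_closure_def by blast
  let ?K = "{c..d} \<times> {-R..R}"
  have "closure ({c<..<d} \<times> (UNIV :: real set)) = {c..d} \<times> UNIV"
    using assms(2) by (simp add: closure_Times)
  then have "continuous_on ?K D" using D(1) by (auto intro: continuous_on_subset)
  then have "bounded (D ` ?K)"
    by (intro compact_imp_bounded compact_continuous_image compact_Times compact_Icc)
  then obtain \<Lambda> where \<Lambda>: "0 < \<Lambda>" "\<And>z. z \<in> ?K \<Longrightarrow> norm (D z) \<le> \<Lambda>"
    unfolding bounded_pos by blast
  let ?S = "{c<..<d} \<times> {-R..R}"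
  have "\<bar>f (t, \<zeta>) - f (s, \<zeta>)\<bar> \<le> \<Lambda> * \<bar>t - s\<bar>"
    if "s \<in> {c<..<d}" "t \<in> {c<..<d}" "\<bar>\<zeta>\<bar> \<le> R" for s t \<zeta>
  proof -
    have "norm (f (t, \<zeta>) - f (s, \<zeta>)) \<le> \<Lambda> * norm ((t, \<zeta>) - (s, \<zeta>))"
    proof (rule differentiable_bound[of ?S f "\<lambda>z. blinfun_apply (D z)"])
      show "convex ?S" by (intro convex_Times) auto
      show "(f has_derivative blinfun_apply (D z)) (at z within ?S)" if "z \<in> ?S" for z
        using D(2)[of z] that by (auto intro: has_derivative_at_withinI)
      show "onorm (blinfun_apply (D z)) \<le> \<Lambda>" if "z \<in> ?S" for z
        using \<Lambda>(2)[of z] that by (auto simp: norm_blinfun.rep_eq)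
    qed (use that in auto)
    then show ?thesis by (simp add: norm_Pair)
  qed
  then show ?thesis using that \<Lambda>(1) by (meson less_imp_le)
qed

locale quasilinear_problem =
  fixes L :: real and m :: nat and \<gamma> :: "nat \<Rightarrow> real"
    and \<kappa> :: "nat \<Rightarrow> real \<times> real \<Rightarrow> real"
    and \<kappa>min \<kappa>max CL :: "nat \<Rightarrow> real"
    and f u :: "real \<Rightarrow> real" and p :: nat
  assumes L: "0 < L"
    and \<gamma>_mono: "strict_mono_on {1..m} \<gamma>"
    and \<gamma>_in: "\<gamma> ` {1..m} \<subseteq> {0<..<L}"
    and \<kappa>minmax: "\<forall>j\<le>m. 0 < \<kappa>min j \<and> \<kappa>min j \<le> \<kappa>max j"
    and \<kappa>_cont: "\<forall>j\<le>m. continuous_on (closure (subdomain L m \<gamma> j) \<times> UNIV) (\<kappa> j)"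
    and \<kappa>_bounds: "\<forall>j\<le>m. \<forall>t\<in>closure (subdomain L m \<gamma> j). \<forall>\<zeta>. \<kappa> j (t, \<zeta>) \<in> {\<kappa>min j..\<kappa>max j}"
    and \<kappa>_Lip: "\<forall>j\<le>m. \<forall>t\<in>subdomain L m \<gamma> j. \<forall>\<zeta>1 \<zeta>2.
           \<bar>\<kappa> j (t, \<zeta>1) - \<kappa> j (t, \<zeta>2)\<bar> \<le> CL j * \<bar>\<zeta>1 - \<zeta>2\<bar>"
    and \<kappa>_C1: "\<forall>j\<le>m. C1_on_closure (subdomain L m \<gamma> j \<times> UNIV) (\<kappa> j)"
    and f: "f \<in> L2 {0<..<L}"
    and p: "1 \<le> p"
    and u: "u \<in> H10 {0<..<L}"
    and u_weak: "\<forall>w\<in>H10 {0<..<L}. diffusion_form L m \<gamma> \<kappa> u u w = load_form L f w"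
    and u_reg: "u \<in> H_Gamma (p + 1) L m \<gamma>"
begin

abbreviation bp :: "nat \<Rightarrow> real" where "bp \<equiv> breakpoint L m \<gamma>"

text \<open>One coefficient on the whole interval, so that the form becomes a single integral. It is
  0 at every breakpoint; its bounds therefore hold off the breakpoints.\<close>

definition k :: "real \<Rightarrow> real \<Rightarrow> real" where
  "k t \<zeta> = cellwise (Suc m) bp (\<lambda>j t. \<kappa> j (t, \<zeta>)) t"

section \<open>Breakpoints and the glued coefficient\<close>

lemma bp_mesh: "is_mesh L (Suc m) bp"
  unfolding is_mesh_def
proof (intro conjI strict_mono_onI)
  fix i j assume ij: "i \<in> {..Suc m}" "j \<in> {..Suc m}" "i < j"
  have g: "0 < \<gamma> i" "\<gamma> i < L" if "i \<in> {1..m}" for i using subsetD[OF \<gamma>_in imageI[OF that]] by simp_all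
  show "bp i < bp j"
  proof (cases "i = 0")
    case True
    then show ?thesis using ij g[of j] L by (auto simp: breakpoint_def)
  next
    case False
    show ?thesis
    proof (cases "j \<le> m")
      case True
      then have "\<gamma> i < \<gamma> j" using ij False by (intro strict_mono_onD[OF \<gamma>_mono]) auto
      then show ?thesis using True False ij by (simp add: breakpoint_def)
    next
      case False
      then show ?thesis using \<open>i \<noteq> 0\<close> ij g[of i] by (simp add: breakpoint_def)
    qed
  qed
qed (auto simp: breakpoint_def)

lemma bp_less: "j \<le> m \<Longrightarrow> bp j < bp (Suc j)"
  using is_meshD(4)[OF bp_mesh, of j] by simp

lemma bp_bounds: "j \<le> m \<Longrightarrow> 0 \<le> bp j" "j \<le> m \<Longrightarrow> bp (Suc j) \<le> L"
  using is_meshD(5)[OF bp_mesh, of j] is_meshD(6)[OF bp_mesh, of "Suc j"] by auto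

lemma closure_subdomain: "j \<le> m \<Longrightarrow> closure (subdomain L m \<gamma> j) = {bp j..bp (Suc j)}"
  using bp_less unfolding subdomain_def by (simp add: closure_greaterThanLessThan)

lemma k_eq: "j \<le> m \<Longrightarrow> t \<in> {bp j<..<bp (Suc j)} \<Longrightarrow> k t \<zeta> = \<kappa> j (t, \<zeta>)"
  unfolding k_def using cellwise_eq[OF bp_mesh, of j t] by simp

lemma bp_cell:
  assumes "t \<in> {0..L} - bp ` {..Suc m}"
  obtains j where "j \<le> m" "t \<in> {bp j<..<bp (Suc j)}"
proof -
  have "t \<noteq> bp (Suc m)" using assms by blast
  then have "t < L" using is_meshD(3)[OF bp_mesh] assms by auto
  then obtain j where j: "j < Suc m" "bp j \<le> t" "t < bp (Suc j)"
    using mesh_cell[OF bp_mesh, of t] assms by auto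
  moreover have "t \<noteq> bp j" using assms j(1) by auto
  ultimately show ?thesis using that[of j] by auto
qed

lemma \<kappa>_comp_cont:
  assumes "j \<le> m" "continuous_on {0..L} v"
  shows "continuous_on {bp j..bp (Suc j)} (\<lambda>t. \<kappa> j (t, v t))"
proof -
  have v: "continuous_on {bp j..bp (Suc j)} v"
    using assms(2) bp_bounds[OF assms(1)] by (auto intro: continuous_on_subset)
  have "continuous_on ({bp j..bp (Suc j)} \<times> UNIV) (\<kappa> j)"
    using \<kappa>_cont assms(1) closure_subdomain[OF assms(1)] by auto
  from continuous_on_compose2[OF this continuous_on_Pair[OF continuous_on_id v]]
  show ?thesis by auto
qed

lemma k_pc:
  assumes "continuous_on {0..L} v"
  shows "pc 0 L (\<lambda>t. k t (v t))"
proof -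
  have "pc 0 L (cellwise (Suc m) bp (\<lambda>j t. \<kappa> j (t, v t)))"
    by (rule pc_cellwise) (use \<kappa>_comp_cont[OF _ assms] in simp)
  then show ?thesis by (simp add: k_def[abs_def] cellwise_def[abs_def])
qed

definition \<kappa>0 where "\<kappa>0 = Min (\<kappa>min ` {..m})"
definition \<kappa>1 where "\<kappa>1 = Max (\<kappa>max ` {..m})"
text \<open>The constants \<open>CL j\<close> carry no sign condition; inserting 0 makes the maximum
  nonnegative.\<close>

definition CLip where "CLip = Max (insert 0 (CL ` {..m}))"

lemma \<kappa>0_pos: "0 < \<kappa>0"
  unfolding \<kappa>0_def using \<kappa>minmax by (subst Min_gr_iff) auto

lemma \<kappa>1_nonneg: "0 \<le> \<kappa>1"
proof -
  have "0 \<le> \<kappa>max 0" using \<kappa>minmax by (metis le0 less_imp_le order_trans)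
  also have "\<dots> \<le> \<kappa>1" unfolding \<kappa>1_def by (intro Max_ge) auto
  finally show ?thesis .
qed

lemma CLip_nonneg: "0 \<le> CLip"
  unfolding CLip_def by (intro Max_ge) auto

lemma k_bounds:
  assumes "t \<in> {0..L} - bp ` {..Suc m}"
  shows "\<kappa>0 \<le> k t \<zeta>" "k t \<zeta> \<le> \<kappa>1"
proof -
  obtain j where j: "j \<le> m" "t \<in> {bp j<..<bp (Suc j)}" using bp_cell[OF assms] .
  have "\<kappa> j (t, \<zeta>) \<in> {\<kappa>min j..\<kappa>max j}"
    using \<kappa>_bounds j closure_subdomain[OF j(1)] by auto
  moreover have "\<kappa>0 \<le> \<kappa>min j" "\<kappa>max j \<le> \<kappa>1"
    unfolding \<kappa>0_def \<kappa>1_def using j(1) by (auto intro: Min_le Max_ge)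
  ultimately show "\<kappa>0 \<le> k t \<zeta>" "k t \<zeta> \<le> \<kappa>1" using k_eq[OF j] by auto
qed

lemma k_Lipschitz:
  assumes "t \<in> {0..L} - bp ` {..Suc m}"
  shows "\<bar>k t \<zeta>1 - k t \<zeta>2\<bar> \<le> CLip * \<bar>\<zeta>1 - \<zeta>2\<bar>"
proof -
  obtain j where j: "j \<le> m" "t \<in> {bp j<..<bp (Suc j)}" using bp_cell[OF assms] .
  have "\<bar>k t \<zeta>1 - k t \<zeta>2\<bar> \<le> CL j * \<bar>\<zeta>1 - \<zeta>2\<bar>"
    using \<kappa>_Lip j k_eq[OF j] by (simp add: subdomain_def)
  also have "\<dots> \<le> CLip * \<bar>\<zeta>1 - \<zeta>2\<bar>"
    unfolding CLip_def using j(1) by (intro mult_right_mono Max_ge) auto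
  finally show ?thesis .
qed

text \<open>Regularity in the position holds only within one subdomain and for values in a bounded
  range. The range used later is the mesh-independent bound for the discrete solutions.\<close>

lemma k_local_Lipschitz:
  obtains \<Lambda> where "0 \<le> \<Lambda>" "\<And>j s t \<zeta>. j \<le> m \<Longrightarrow> s \<in> {bp j<..<bp (Suc j)} \<Longrightarrow> t \<in> {bp j<..<bp (Suc j)} \<Longrightarrow>
    \<bar>\<zeta>\<bar> \<le> R \<Longrightarrow> \<bar>k t \<zeta> - k s \<zeta>\<bar> \<le> \<Lambda> * \<bar>t - s\<bar>"
proof -
  have "\<forall>j. \<exists>\<Lambda>. j \<le> m \<longrightarrow> 0 \<le> \<Lambda> \<and> (\<forall>s\<in>{bp j<..<bp (Suc j)}. \<forall>t\<in>{bp j<..<bp (Suc j)}. \<forall>\<zeta>. \<bar>\<zeta>\<bar> \<le> R \<longrightarrow>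
    \<bar>\<kappa> j (t, \<zeta>) - \<kappa> j (s, \<zeta>)\<bar> \<le> \<Lambda> * \<bar>t - s\<bar>)"
  proof
    fix j
    show "\<exists>\<Lambda>. j \<le> m \<longrightarrow> 0 \<le> \<Lambda> \<and> (\<forall>s\<in>{bp j<..<bp (Suc j)}. \<forall>t\<in>{bp j<..<bp (Suc j)}. \<forall>\<zeta>. \<bar>\<zeta>\<bar> \<le> R \<longrightarrow>
      \<bar>\<kappa> j (t, \<zeta>) - \<kappa> j (s, \<zeta>)\<bar> \<le> \<Lambda> * \<bar>t - s\<bar>)"
    proof (cases "j \<le> m")
      case True
      then have "C1_on_closure ({bp j<..<bp (Suc j)} \<times> UNIV) (\<kappa> j)"
        using \<kappa>_C1 by (simp add: subdomain_def)
      from C1_on_closure_Lipschitz[OF this bp_less[OF True], of R] show ?thesis by metis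
    qed simp
  qed
  then obtain \<Lambda> where \<Lambda>: "\<And>j. j \<le> m \<Longrightarrow> 0 \<le> \<Lambda> j"
    "\<And>j s t \<zeta>. j \<le> m \<Longrightarrow> s \<in> {bp j<..<bp (Suc j)} \<Longrightarrow> t \<in> {bp j<..<bp (Suc j)} \<Longrightarrow> \<bar>\<zeta>\<bar> \<le> R \<Longrightarrow>
      \<bar>\<kappa> j (t, \<zeta>) - \<kappa> j (s, \<zeta>)\<bar> \<le> \<Lambda> j * \<bar>t - s\<bar>"
    by metis
  show ?thesis
  proof (rule that[of "Max (\<Lambda> ` {..m})"])
    show "0 \<le> Max (\<Lambda> ` {..m})" using \<Lambda>(1)[of 0] by (intro order_trans[OF _ Max_ge[of _ "\<Lambda> 0"]]) auto
    fix j s t \<zeta> assume h: "j \<le> m" "s \<in> {bp j<..<bp (Suc j)}" "t \<in> {bp j<..<bp (Suc j)}" "\<bar>\<zeta>\<bar> \<le> R"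
    have "\<Lambda> j * \<bar>t - s\<bar> \<le> Max (\<Lambda> ` {..m}) * \<bar>t - s\<bar>"
      using h(1) by (intro mult_right_mono Max_ge) auto
    then show "\<bar>k t \<zeta> - k s \<zeta>\<bar> \<le> Max (\<Lambda> ` {..m}) * \<bar>t - s\<bar>"
      using \<Lambda>(2)[OF h] k_eq[OF h(1,2)] k_eq[OF h(1,3)] by simp
  qed
qed

text \<open>Replaces the function in the coefficient by a continuous representative and the chosen
  weak derivatives by piecewise continuous ones. The integrands agree almost everywhere on each
  subdomain, and the new one is visibly integrable.\<close>

lemma diffusion_form_eq:
  assumes v: "continuous_on {0..L} v'" "eq_ae 0 L v v'"
    and a: "pc 0 L a'" "eq_ae 0 L (weak_deriv {0<..<L} a) a'"
    and b: "pc 0 L b'" "eq_ae 0 L (weak_deriv {0<..<L} b) b'"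
  shows "diffusion_form L m \<gamma> \<kappa> v a b = integral {0..L} (\<lambda>t. k t (v' t) * a' t * b' t)"
proof -
  have "(LINT t:subdomain L m \<gamma> j|lebesgue.
      \<kappa> j (t, v t) * weak_deriv {0<..<L} a t * weak_deriv {0<..<L} b t) =
    integral {bp j..bp (Suc j)} (\<lambda>t. k t (v' t) * a' t * b' t)" if j: "j \<le> m" for j
  proof -
    let ?a = "bp j" and ?b = "bp (Suc j)"
    let ?A = "weak_deriv {0<..<L} a" and ?B = "weak_deriv {0<..<L} b"
    have ae: "eq_ae ?a ?b v v'" "eq_ae ?a ?b ?A a'" "eq_ae ?a ?b ?B b'"
      using eq_ae_mono[OF _ bp_bounds[OF j]] v(2) a(2) b(2) by auto
    have "eq_ae ?a ?b (\<lambda>t. ?A t * ?B t) (\<lambda>t. a' t * b' t)"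
      using eq_ae_comp2[OF ae(2,3), of "\<lambda>_ x y. x * y"] .
    from eq_ae_sym[OF eq_ae_comp2[OF ae(1) this, of "\<lambda>t x y. \<kappa> j (t, x) * y"]]
    have *: "eq_ae ?a ?b (\<lambda>t. \<kappa> j (t, v' t) * a' t * b' t) (\<lambda>t. \<kappa> j (t, v t) * ?A t * ?B t)"
      by (simp only: mult.assoc)
    have "pc ?a ?b (\<lambda>t. \<kappa> j (t, v' t) * a' t * b' t)"
      by (intro pc_mult pc_continuous \<kappa>_comp_cont[OF j v(1)]
          pc_mono[OF a(1) bp_bounds[OF j]] pc_mono[OF b(1) bp_bounds[OF j]])
    then have "(\<lambda>t. \<kappa> j (t, v t) * ?A t * ?B t) absolutely_integrable_on {?a..?b}"
      using eq_ae_absolutely_integrable[OF pc_absolutely_integrable *] by blast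
    then have "(LINT t:subdomain L m \<gamma> j|lebesgue. \<kappa> j (t, v t) * ?A t * ?B t) =
      integral {?a..?b} (\<lambda>t. \<kappa> j (t, v t) * ?A t * ?B t)"
      unfolding subdomain_def by (rule LINT_interval)
    also have "\<dots> = integral {?a..?b} (\<lambda>t. \<kappa> j (t, v' t) * a' t * b' t)"
      by (rule eq_ae_integral[OF *, symmetric])
    also have "\<dots> = integral {?a..?b} (\<lambda>t. k t (v' t) * a' t * b' t)"
      by (rule integral_cong_finite[of "{?a, ?b}"]) (use k_eq[OF j] in auto)
    finally show ?thesis .
  qed
  then have "diffusion_form L m \<gamma> \<kappa> v a b =
      (\<Sum>j<Suc m. integral {bp j..bp (Suc j)} (\<lambda>t. k t (v' t) * a' t * b' t))"
    unfolding diffusion_form_def by (intro sum.cong) auto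
  also have "\<dots> = integral {0..L} (\<lambda>t. k t (v' t) * a' t * b' t)"
    by (intro integral_is_mesh[OF bp_mesh, symmetric] pc_integrable pc_mult k_pc v(1) a(1) b(1))
  finally show ?thesis .
qed

lemma load_form_eq: "pc 0 L w \<Longrightarrow> load_form L f w = integral {0..L} (\<lambda>t. f t * w t)"
  unfolding load_form_def by (intro LINT_interval L2_mult f pc_L2)

text \<open>Two kinds of representative are reconciled: a global continuous one from the first-order
  space, which carries the boundary values, and one on each subdomain with p continuous derivatives,
  up to finitely many points. The function \<open>g j\<close> is the derivative of order p + 1 on
  subdomain j.\<close>

lemma regular_representative:
  obtains W g w where
    "\<And>j i. j \<le> m \<Longrightarrow> i < p \<Longrightarrow> pwC1 (bp j) (bp (Suc j)) (W j i) (W j (Suc i))"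
    "\<And>j i. j \<le> m \<Longrightarrow> i \<le> p \<Longrightarrow> continuous_on {bp j..bp (Suc j)} (W j i)"
    "\<And>j s t. j \<le> m \<Longrightarrow> bp j \<le> s \<Longrightarrow> s \<le> t \<Longrightarrow> t \<le> bp (Suc j) \<Longrightarrow> W j p t - W j p s = integral {s..t} (g j)"
    "\<And>j. j \<le> m \<Longrightarrow> g j \<in> L2 {bp j<..<bp (Suc j)}"
    "\<And>j. j \<le> m \<Longrightarrow> (sobolev_seminorm (p + 1) (subdomain L m \<gamma> j) u)\<^sup>2 = integral {bp j..bp (Suc j)} (\<lambda>t. (g j t)\<^sup>2)"
    "pwC1 0 L w (cellwise (Suc m) bp (\<lambda>j. W j 1))" "eq_ae 0 L u w" "w 0 = 0" "w L = 0"
proof -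
  let ?U = "\<lambda>j i. (weak_deriv {bp j<..<bp (Suc j)} ^^ i) u"
  \<comment> \<open>Bundled, because the choice over j has to deliver all properties for the same
    family \<open>W\<close>.\<close>
  define P where "P j W \<longleftrightarrow> (\<forall>i<p. pwC1 (bp j) (bp (Suc j)) (W i) (W (Suc i))) \<and>
     (\<forall>i\<le>p. continuous_on {bp j..bp (Suc j)} (W i)) \<and>
     (\<forall>i\<le>p. eq_ae (bp j) (bp (Suc j)) (?U j i) (W i)) \<and>
     (\<forall>s t. bp j \<le> s \<longrightarrow> s \<le> t \<longrightarrow> t \<le> bp (Suc j) \<longrightarrow> W p t - W p s = integral {s..t} (?U j (Suc p))) \<and>
     ?U j (Suc p) \<in> L2 {bp j<..<bp (Suc j)}" for j and W :: "nat \<Rightarrow> real \<Rightarrow> real"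
  have "\<forall>j. \<exists>W. j \<le> m \<longrightarrow> P j W"
  proof
    fix j
    show "\<exists>W. j \<le> m \<longrightarrow> P j W"
    proof (cases "j \<le> m")
      case True
      then have "u \<in> sobolev (Suc p) {bp j<..<bp (Suc j)}"
        using u_reg unfolding H_Gamma_def subdomain_def by simp
      then show ?thesis
      proof (rule sobolev_representative[OF bp_less[OF True]], goal_cases)
        case (1 W)
        then have "P j W" by (simp add: P_def)
        then show ?case by blast
      qed
    qed simp
  qed
  then obtain W where PW: "\<And>j. j \<le> m \<Longrightarrow> P j (W j)"
    unfolding choice_iff by blast
  have W: "\<And>j i. j \<le> m \<Longrightarrow> i < p \<Longrightarrow> pwC1 (bp j) (bp (Suc j)) (W j i) (W j (Suc i))"
    "\<And>j i. j \<le> m \<Longrightarrow> i \<le> p \<Longrightarrow> continuous_on {bp j..bp (Suc j)} (W j i)"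
    "\<And>j i. j \<le> m \<Longrightarrow> i \<le> p \<Longrightarrow> eq_ae (bp j) (bp (Suc j)) (?U j i) (W j i)"
    "\<And>j s t. j \<le> m \<Longrightarrow> bp j \<le> s \<Longrightarrow> s \<le> t \<Longrightarrow> t \<le> bp (Suc j) \<Longrightarrow> W j p t - W j p s = integral {s..t} (?U j (Suc p))"
    "\<And>j. j \<le> m \<Longrightarrow> ?U j (Suc p) \<in> L2 {bp j<..<bp (Suc j)}"
    using PW unfolding P_def by blast+
  have "u \<in> sobolev (Suc 0) {0<..<L}" using u by (simp add: H10_def)
  then have "\<exists>V :: nat \<Rightarrow> real \<Rightarrow> real. continuous_on {0..L} (V 0) \<and> eq_ae 0 L u (V 0)"
  proof (rule sobolev_representative[OF L], goal_cases)
    case (1 V)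
    show ?case using 1(2,3)[of 0] by (intro exI[of _ V]) simp
  qed
  then obtain V :: "nat \<Rightarrow> real \<Rightarrow> real" where V: "continuous_on {0..L} (V 0)" "eq_ae 0 L u (V 0)"
    by blast
  define w where "w = V 0"
  \<comment> \<open>Both sides are continuous and agree almost everywhere with u, hence agree on the
    closed subdomain; so w inherits the derivative \<open>W j 1\<close> there.\<close>
  have wV: "w t = W j 0 t" if "j \<le> m" "t \<in> {bp j..bp (Suc j)}" for j t
  proof (rule eq_ae_continuous[OF bp_less[OF that(1)] _ W(2)[OF that(1), of 0] _ that(2)])
    show "continuous_on {bp j..bp (Suc j)} w"
      using V(1) bp_bounds[OF that(1)] by (auto simp: w_def intro: continuous_on_subset)
    show "eq_ae (bp j) (bp (Suc j)) w (W j 0)"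
      using eq_ae_trans[OF eq_ae_sym[OF eq_ae_mono[OF V(2) bp_bounds[OF that(1)]]]] W(3)[OF that(1), of 0]
      by (simp add: w_def)
  qed simp
  have "\<forall>j. \<exists>Y. finite Y \<and> (j \<le> m \<longrightarrow> (\<forall>t\<in>{bp j<..<bp (Suc j)} - Y. (W j 0 has_real_derivative W j 1 t) (at t)))"
  proof
    fix j
    show "\<exists>Y. finite Y \<and> (j \<le> m \<longrightarrow> (\<forall>t\<in>{bp j<..<bp (Suc j)} - Y. (W j 0 has_real_derivative W j 1 t) (at t)))"
      using W(1)[of j 0] p by (cases "j \<le> m") (auto simp: pwC1_def)
  qed
  then obtain Y where Y': "\<And>j. finite (Y j) \<and> (j \<le> m \<longrightarrow> (\<forall>t\<in>{bp j<..<bp (Suc j)} - Y j. (W j 0 has_real_derivative W j 1 t) (at t)))"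
    unfolding choice_iff by blast
  have Y: "\<And>j. finite (Y j)"
    "\<And>j t. j \<le> m \<Longrightarrow> t \<in> {bp j<..<bp (Suc j)} - Y j \<Longrightarrow> (W j 0 has_real_derivative W j 1 t) (at t)"
    using Y' by blast+
  let ?w' = "cellwise (Suc m) bp (\<lambda>j. W j 1)"
  have "(w has_real_derivative ?w' t) (at t)" if t: "t \<in> {0<..<L} - (bp ` {..Suc m} \<union> \<Union> (Y ` {..m}))" for t
  proof -
    have "t \<in> {0..L} - bp ` {..Suc m}" using t by auto
    then obtain j where j: "j \<le> m" "t \<in> {bp j<..<bp (Suc j)}" by (rule bp_cell)
    have "(w has_real_derivative W j 1 t) (at t)"
    proof (rule has_field_derivative_transform_within_open)
      show "(W j 0 has_real_derivative W j 1 t) (at t)" using t j by (intro Y(2)) auto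
      show "W j 0 s = w s" if "s \<in> {bp j<..<bp (Suc j)}" for s using wV[OF j(1), of s] that by simp
    qed (use j in auto)
    then show ?thesis using cellwise_eq[OF bp_mesh, of j t] j by simp
  qed
  moreover have "pc 0 L ?w'"
    by (rule pc_cellwise) (use W(2)[of _ 1] p in simp)
  moreover have "finite (bp ` {..Suc m} \<union> \<Union> (Y ` {..m}))" using Y(1) by auto
  ultimately have w': "pwC1 0 L w ?w'"
    unfolding pwC1_def using V(1)[folded w_def] by blast
  show ?thesis
  proof (rule that[of W "\<lambda>j. ?U j (Suc p)", OF W(1,2,4,5) _ w'])
    show "eq_ae 0 L u w" using V(2) by (simp add: w_def)
    show "w 0 = 0" "w L = 0"
      using H10_boundary_values[OF L u V] by (simp_all add: w_def)
    fix j assume j: "j \<le> m"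
    let ?g = "?U j (Suc p)"
    have i: "(\<lambda>t. (?g t)\<^sup>2) absolutely_integrable_on {bp j..bp (Suc j)}"
      using W(5)[OF j] by (simp add: L2_iff)
    have "0 \<le> integral {bp j..bp (Suc j)} (\<lambda>t. (?g t)\<^sup>2)"
      using i by (intro integral_nonneg) (auto simp: absolutely_integrable_on_def)
    then show "(sobolev_seminorm (p + 1) (subdomain L m \<gamma> j) u)\<^sup>2 = integral {bp j..bp (Suc j)} (\<lambda>t. (?g t)\<^sup>2)"
      using LINT_interval[OF i] by (simp add: sobolev_seminorm_def L2_norm_def subdomain_def)
  qed
qed

end

context quasilinear_problem
begin

abbreviation \<Gamma> :: "real set" where "\<Gamma> \<equiv> \<gamma> ` {1..m}"

section \<open>The weak equation, the energy bound and the approximation of u'\<close>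

lemma bp_image: "bp ` {..Suc m} = insert 0 (insert L \<Gamma>)"
proof -
  have "{..Suc m} = insert 0 (insert (Suc m) {1..m})" by auto
  then have "bp ` {..Suc m} = insert (bp 0) (insert (bp (Suc m)) (bp ` {1..m}))" by auto
  also have "bp ` {1..m} = \<Gamma>" by (intro image_cong) (auto simp: breakpoint_def)
  finally show ?thesis by (simp add: breakpoint_def)
qed

text \<open>The weak equation makes the flux of \<open>u\<close> equal to a primitive of \<open>- f\<close> almost everywhere, so the equation
  extends to piecewise \<open>C\<^sup>1\<close> functions without a density argument.\<close>

lemma flux_equation:
  assumes w: "pwC1 0 L w w'" "eq_ae 0 L u w"
    and v: "pwC1 0 L v v'" "v 0 = 0" "v L = 0"
  shows "integral {0..L} (\<lambda>t. k t (w t) * w' t * v' t) = integral {0..L} (\<lambda>t. f t * v t)"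
proof -
  define F where "F = (\<lambda>t. k t (w t) * w' t)"
  define G where "G t = integral {0..t} f" for t
  have Fp: "pc 0 L F" unfolding F_def by (intro pc_mult k_pc pwC1_cont[OF w(1)] pwC1_pc'[OF w(1)])
  have fi: "f absolutely_integrable_on {0..L}" using f by (simp add: L2_iff)
  have Gc: "continuous_on {0..L} G"
    unfolding G_def using fi by (intro indefinite_integral_continuous_1) (simp add: absolutely_integrable_on_def)
  have FG: "pc 0 L (\<lambda>t. F t + G t)" by (intro pc_add Fp pc_continuous Gc)
  have "\<exists>c. eq_ae 0 L (\<lambda>t. F t + G t) (\<lambda>_. c)"
  proof (rule du_Bois_Reymond[OF L pc_absolutely_integrable[OF FG]])
    fix \<phi> assume \<phi>: "\<phi> \<in> test_functions {0<..<L}"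
    note q = test_functions_pwC1[OF \<phi> L]
    have "diffusion_form L m \<gamma> \<kappa> u u \<phi> = load_form L f \<phi>"
      using u_weak test_functions_subset_H10[OF L \<phi>] by blast
    then have 1: "integral {0..L} (\<lambda>t. F t * deriv \<phi> t) = integral {0..L} (\<lambda>t. f t * \<phi> t)"
      using diffusion_form_eq[OF pwC1_cont[OF w(1)] w(2) pwC1_pc'[OF w(1)] weak_deriv_pwC1(2)[OF L w]
          pwC1_pc'[OF q(1)] weak_deriv_pwC1(2)[OF L q(1) eq_ae_refl]]
        load_form_eq[OF pwC1_pc[OF q(1)]] by (simp add: F_def)
    have 2: "integral {0..L} (\<lambda>t. G t * deriv \<phi> t) = - integral {0..L} (\<lambda>t. f t * \<phi> t)"
      unfolding G_def by (rule integral_by_parts_vanishing[OF less_imp_le[OF L] fi q(1,3)])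
    have "integral {0..L} (\<lambda>t. F t * deriv \<phi> t + G t * deriv \<phi> t) =
        integral {0..L} (\<lambda>t. F t * deriv \<phi> t) + integral {0..L} (\<lambda>t. G t * deriv \<phi> t)"
      by (intro integral_add pc_integrable pc_mult Fp pc_continuous[OF Gc] pwC1_pc'[OF q(1)])
    then show "integral {0..L} (\<lambda>t. (F t + G t) * deriv \<phi> t) = 0"
      using 1 2 by (simp add: distrib_right)
  qed
  then obtain c where c: "eq_ae 0 L (\<lambda>t. F t + G t) (\<lambda>_. c)" by blast
  have v'p: "pc 0 L v'" by (rule pwC1_pc'[OF v(1)])
  have "integral {0..L} (\<lambda>t. (F t + G t) * v' t) = integral {0..L} (\<lambda>t. c * v' t)"
    using eq_ae_integral[OF eq_ae_comp2[OF c c, of "\<lambda>t x _. x * v' t"]] .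
  also have "\<dots> = 0" using pwC1_integral[OF v(1), of 0 L] v L by simp
  finally have "integral {0..L} (\<lambda>t. F t * v' t + G t * v' t) = 0" by (simp add: distrib_right)
  moreover have "integral {0..L} (\<lambda>t. F t * v' t + G t * v' t) =
      integral {0..L} (\<lambda>t. F t * v' t) + integral {0..L} (\<lambda>t. G t * v' t)"
    by (intro integral_add pc_integrable pc_mult Fp pc_continuous[OF Gc] v'p)
  moreover have "integral {0..L} (\<lambda>t. G t * v' t) = - integral {0..L} (\<lambda>t. f t * v t)"
    unfolding G_def by (rule integral_by_parts_vanishing[OF less_imp_le[OF L] fi v(1,3)])
  ultimately show ?thesis by (simp add: F_def)
qed

text \<open>The discrete equation tested with its own solution: coercivity bounds the left side from
  below, and the Poincare inequality |v| \<le> sqrt L \<open>nrm L v'\<close> bounds the right side.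
  The result does not depend on the mesh.\<close>

lemma discrete_energy_bound:
  assumes v: "pwC1 0 L v v'" "v 0 = 0"
    and eq: "integral {0..L} (\<lambda>t. k t (v t) * v' t * v' t) = integral {0..L} (\<lambda>t. f t * v t)"
  shows "nrm L v' \<le> L * nrm L f / \<kappa>0"
proof -
  define x where "x = nrm L v'"
  have v'p: "pc 0 L v'" and vp: "pc 0 L v" using pwC1D[OF v(1)] by auto
  have fi: "(\<lambda>t. \<bar>f t\<bar>) integrable_on {0..L}" "(\<lambda>t. f t * v t) integrable_on {0..L}"
    using f L2_mult[OF f pc_L2[OF vp]] by (auto simp: L2_iff absolutely_integrable_on_def)
  have kp: "pc 0 L (\<lambda>t. k t (v t))" by (rule k_pc[OF pwC1_cont[OF v(1)]])
  have "\<kappa>0 * x\<^sup>2 = integral {0..L} (\<lambda>t. \<kappa>0 * (v' t)\<^sup>2)"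
    by (simp add: x_def nrm_square[OF v'p])
  also have "\<dots> \<le> integral {0..L} (\<lambda>t. k t (v t) * v' t * v' t)"
  proof (rule integral_mono_finite[of _ _ _ "bp ` {..Suc m}"])
    show "\<kappa>0 * (v' t)\<^sup>2 \<le> k t (v t) * v' t * v' t" if "t \<in> {0..L} - bp ` {..Suc m}" for t
      using mult_right_mono[OF k_bounds(1)[OF that, of "v t"], of "(v' t)\<^sup>2"]
      by (simp add: power2_eq_square mult.assoc)
  qed (auto intro!: pc_integrable pc_mult pc_power2 kp v'p)
  also have "\<dots> \<le> integral {0..L} (\<lambda>t. (sqrt L * x) * \<bar>f t\<bar>)"
    unfolding eq
  proof (rule integral_le)
    show "(\<lambda>t. (sqrt L * x) * \<bar>f t\<bar>) integrable_on {0..L}"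
      using integrable_on_mult_right[OF fi(1)] by simp
    show "f t * v t \<le> (sqrt L * x) * \<bar>f t\<bar>" if "t \<in> {0..L}" for t
    proof -
      have "f t * v t \<le> \<bar>f t\<bar> * \<bar>v t\<bar>" by (simp flip: abs_mult)
      also have "\<dots> \<le> \<bar>f t\<bar> * (sqrt L * x)"
        using pwC1_Poincare(1)[OF less_imp_le[OF L] v that] by (intro mult_left_mono) (auto simp: x_def)
      finally show ?thesis by (simp add: mult.commute)
    qed
  qed (rule fi)
  also have "\<dots> = (sqrt L * x) * integral {0..L} (\<lambda>t. \<bar>f t\<bar>)" by simp
  also have "\<dots> \<le> (sqrt L * x) * (sqrt L * nrm L f)"
    using L by (intro mult_left_mono L2_integral_abs f) (auto simp: x_def)
  also have "\<dots> = L * nrm L f * x" using L by simp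
  finally have *: "\<kappa>0 * x * x \<le> L * nrm L f * x" by (simp add: power2_eq_square mult.assoc)
  show ?thesis
  proof (cases "x = 0")
    case True
    then show ?thesis using L \<kappa>0_pos by (simp add: x_def)
  next
    case False
    then have "0 < x" using nrm_nonneg[of L v'] by (simp add: x_def less_le)
    then have "\<kappa>0 * x \<le> L * nrm L f" using * by (simp only: mult_le_cancel_right_pos)
    then show ?thesis using \<kappa>0_pos by (simp add: x_def le_divide_eq mult.commute)
  qed
qed

lemma mesh_cell_in_subdomain:
  assumes y: "is_mesh L M y" "bp ` {..Suc m} \<subseteq> y ` {..M}" and i: "i < M"
  obtains j where "j \<le> m" "bp j \<le> y i" "y (Suc i) \<le> bp (Suc j)"
proof -
  have yi: "0 \<le> y i" "y i < L"
    using is_meshD(5)[OF y(1), of i] i is_meshD(4)[OF y(1) i] is_meshD(6)[OF y(1), of "Suc i"] by auto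
  obtain j where j: "j < Suc m" "bp j \<le> y i" "y i < bp (Suc j)"
    using mesh_cell[OF bp_mesh yi] .
  have "bp (Suc j) \<in> bp ` {..Suc m}" using j(1) by auto
  then obtain l where l: "l \<le> M" "bp (Suc j) = y l"
    using y(2) by (metis atMost_iff imageE subsetD)
  have "y (Suc i) \<le> bp (Suc j)"
    using mesh_node_notin_cell[OF y(1) i l(1)] j(3) l(2) by auto
  then show ?thesis using j by (intro that[of j]) simp_all
qed

text \<open>A refined cell lies in one subdomain, where u is regular, so the local approximation
  applies to u' with degree p - 1. The squared errors add up over the cells and give h^(2p). Equal
  cell means make the integral of the approximation equal to that of w', which is zero, so its
  primitive vanishes at L.\<close>

lemma piecewise_polynomial_approximation:
  assumes W: "\<And>j i. j \<le> m \<Longrightarrow> i < p \<Longrightarrow> pwC1 (bp j) (bp (Suc j)) (W j i) (W j (Suc i))"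
    "\<And>j i. j \<le> m \<Longrightarrow> i \<le> p \<Longrightarrow> continuous_on {bp j..bp (Suc j)} (W j i)"
    "\<And>j s t. j \<le> m \<Longrightarrow> bp j \<le> s \<Longrightarrow> s \<le> t \<Longrightarrow> t \<le> bp (Suc j) \<Longrightarrow> W j p t - W j p s = integral {s..t} (g j)"
    "\<And>j. j \<le> m \<Longrightarrow> g j \<in> L2 {bp j<..<bp (Suc j)}"
    and w': "w' = cellwise (Suc m) bp (\<lambda>j. W j 1)" "pc 0 L w'" "integral {0..L} w' = 0"
    and y: "is_mesh L M y" "bp ` {..Suc m} \<subseteq> y ` {..M}" "\<And>i. i < M \<Longrightarrow> y (Suc i) - y i \<le> h"
    and h: "0 \<le> h"
  shows "\<exists>q :: nat \<Rightarrow> real poly. (\<forall>i<M. degree (q i) \<le> p - 1) \<and>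
    integral {0..L} (cellwise M y (\<lambda>i. poly (q i))) = 0 \<and>
    nrm L (\<lambda>t. w' t - cellwise M y (\<lambda>i. poly (q i)) t) \<le>
      h ^ p * sqrt (\<Sum>j\<le>m. integral {bp j..bp (Suc j)} (\<lambda>t. (g j t)\<^sup>2))"
proof -
  define g' where "g' = cellwise (Suc m) bp g"
  have g'_eq: "g' t = g j t" if "j \<le> m" "t \<in> {bp j<..<bp (Suc j)}" for j t
    unfolding g'_def using cellwise_eq[OF bp_mesh, of j t] that by simp
  have g'_int: "(\<lambda>t. (g' t)\<^sup>2) integrable_on {bp j..bp (Suc j)}" if j: "j \<le> m" for j
  proof -
    have "(\<lambda>t. (g j t)\<^sup>2) integrable_on {bp j..bp (Suc j)}"
      using W(4)[OF j] by (auto simp: L2_iff absolutely_integrable_on_def)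
    then show ?thesis
      by (rule integrable_spike_finite[of "{bp j, bp (Suc j)}", rotated 2]) (use g'_eq[OF j] in auto)
  qed
  have g'_all: "(\<lambda>t. (g' t)\<^sup>2) integrable_on {0..L}"
  proof -
    have "(\<lambda>t. (g' t)\<^sup>2) integrable_on {0..bp j}" if "j \<le> Suc m" for j
      using that
    proof (induction j)
      case 0
      then show ?case using is_meshD(2)[OF bp_mesh] integrable_on_refl[of _ 0] by simp
    next
      case (Suc j)
      then have j: "j \<le> m" by simp
      show ?case
        using Suc j by (intro Henstock_Kurzweil_Integration.integrable_combine[OF bp_bounds(1)[OF j]
              less_imp_le[OF bp_less[OF j]] _ g'_int[OF j]]) simp
    qed
    from this[of "Suc m"] show ?thesis using is_meshD(3)[OF bp_mesh] by simp
  qed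
  have "\<exists>q :: real poly. degree q \<le> p - 1 \<and> integral {y i..y (Suc i)} (poly q) = integral {y i..y (Suc i)} w' \<and>
    integral {y i..y (Suc i)} (\<lambda>t. (w' t - poly q t)\<^sup>2) \<le> h ^ (2 * p) * integral {y i..y (Suc i)} (\<lambda>t. (g' t)\<^sup>2)"
    if i: "i < M" for i
  proof -
    let ?a = "y i" and ?b = "y (Suc i)"
    obtain j where j: "j \<le> m" "bp j \<le> ?a" "?b \<le> bp (Suc j)"
      using mesh_cell_in_subdomain[OF y(1,2) i] .
    have ab: "?a < ?b" by (rule is_meshD(4)[OF y(1) i])
    have gi: "(\<lambda>t. (g j t)\<^sup>2) integrable_on {?a..?b}" "(\<lambda>t. \<bar>g j t\<bar>) integrable_on {?a..?b}" "g j integrable_on {?a..?b}"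
      using W(4)[OF j(1)] j(2,3) unfolding L2_iff absolutely_integrable_on_def
      by (auto intro: integrable_subinterval_real)
    have gg: "integral {?a..?b} (\<lambda>t. (g j t)\<^sup>2) = integral {?a..?b} (\<lambda>t. (g' t)\<^sup>2)"
      by (rule integral_cong_finite[of "{?a, ?b}"]) (use g'_eq[OF j(1)] j(2,3) in auto)
    have ww: "w' t = W j 1 t" if "t \<in> {?a<..<?b}" for t
      unfolding w'(1) using cellwise_eq[OF bp_mesh, of j t] that j by simp
    have osc: "\<bar>W j (Suc (p - 1)) t - W j (Suc (p - 1)) s\<bar> \<le> integral {?a..?b} (\<lambda>t. \<bar>g j t\<bar>)"
      if "s \<in> {?a<..<?b}" "t \<in> {?a<..<?b}" for s t
    proof -
      have *: "\<bar>W j p t - W j p s\<bar> \<le> integral {?a..?b} (\<lambda>t. \<bar>g j t\<bar>)" if "?a \<le> s" "s \<le> t" "t \<le> ?b" for s t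
      proof -
        have i: "g j integrable_on {s..t}" "(\<lambda>t. \<bar>g j t\<bar>) integrable_on {s..t}"
          using integrable_subinterval_real[OF gi(3)] integrable_subinterval_real[OF gi(2)] that by auto
        have "\<bar>W j p t - W j p s\<bar> = \<bar>integral {s..t} (g j)\<bar>" using W(3)[OF j(1), of s t] j that by simp
        also have "\<dots> \<le> integral {s..t} (\<lambda>t. \<bar>g j t\<bar>)" using integral_norm_bound_integral[OF i] by simp
        also have "\<dots> \<le> integral {?a..?b} (\<lambda>t. \<bar>g j t\<bar>)"
          using that by (intro integral_subset_le i gi) auto
        finally show ?thesis .
      qed
      show ?thesis using *[of s t] *[of t s] that p by (cases "s \<le> t") (auto simp: abs_minus_commute)
    qed
    have "\<exists>q :: real poly. degree q \<le> p - 1 \<and> integral {?a..?b} (poly q) = integral {?a..?b} (W j (Suc 0)) \<and>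
      integral {?a..?b} (\<lambda>t. (W j (Suc 0) t - poly q t)\<^sup>2) \<le> (?b - ?a) ^ (2 * Suc (p - 1)) * integral {?a..?b} (\<lambda>t. (g j t)\<^sup>2)"
    \<comment> \<open>Not w but w' is approximated: the family is shifted by one and has p - 1
      steps, so its top member is \<open>W j p\<close>.\<close>
    proof (rule local_polynomial_approximation[OF ab, of "p - 1" "\<lambda>i. W j (Suc i)"])
      show "pwC1 ?a ?b (W j (Suc l)) (W j (Suc (Suc l)))" if "l < p - 1" for l
        using that j by (intro pwC1_mono[OF W(1)]) auto
      show "pc ?a ?b (W j (Suc (p - 1)))"
        using j p by (intro pc_mono[OF pc_continuous[OF W(2)]]) auto
      show "(integral {?a..?b} (\<lambda>t. \<bar>g j t\<bar>))\<^sup>2 \<le> (?b - ?a) * integral {?a..?b} (\<lambda>t. (g j t)\<^sup>2)"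
        using ab by (intro integral_abs_square_le gi) auto
    qed (rule osc)
    then obtain q :: "real poly" where q: "degree q \<le> p - 1" "integral {?a..?b} (poly q) = integral {?a..?b} (W j 1)"
      "integral {?a..?b} (\<lambda>t. (W j 1 t - poly q t)\<^sup>2) \<le> (?b - ?a) ^ (2 * p) * integral {?a..?b} (\<lambda>t. (g j t)\<^sup>2)"
      using p by auto
    have "integral {?a..?b} w' = integral {?a..?b} (W j 1)"
      by (rule integral_cong_finite[of "{?a, ?b}"]) (use ww in auto)
    moreover have "integral {?a..?b} (\<lambda>t. (w' t - poly q t)\<^sup>2) = integral {?a..?b} (\<lambda>t. (W j 1 t - poly q t)\<^sup>2)"
      by (rule integral_cong_finite[of "{?a, ?b}"]) (use ww in auto)
    moreover have "(?b - ?a) ^ (2 * p) * integral {?a..?b} (\<lambda>t. (g j t)\<^sup>2) \<le> h ^ (2 * p) * integral {?a..?b} (\<lambda>t. (g j t)\<^sup>2)"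
      using y(3)[OF i] ab gi by (intro mult_right_mono power_mono integral_nonneg) auto
    ultimately show ?thesis using q gg by (intro exI[of _ q]) auto
  qed
  then have "\<forall>i. \<exists>q :: real poly. i < M \<longrightarrow> degree q \<le> p - 1 \<and> integral {y i..y (Suc i)} (poly q) = integral {y i..y (Suc i)} w' \<and>
    integral {y i..y (Suc i)} (\<lambda>t. (w' t - poly q t)\<^sup>2) \<le> h ^ (2 * p) * integral {y i..y (Suc i)} (\<lambda>t. (g' t)\<^sup>2)"
    by blast
  then obtain q :: "nat \<Rightarrow> real poly" where q': "\<forall>i. i < M \<longrightarrow> degree (q i) \<le> p - 1 \<and>
    integral {y i..y (Suc i)} (poly (q i)) = integral {y i..y (Suc i)} w' \<and>
    integral {y i..y (Suc i)} (\<lambda>t. (w' t - poly (q i) t)\<^sup>2) \<le> h ^ (2 * p) * integral {y i..y (Suc i)} (\<lambda>t. (g' t)\<^sup>2)"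
    unfolding choice_iff by blast
  let ?v' = "cellwise M y (\<lambda>i. poly (q i))"
  have v'p: "pc 0 L ?v'" by (intro pc_cellwise continuous_intros)
  have v'c: "?v' t = poly (q i) t" if "i < M" "t \<in> {y i<..<y (Suc i)}" for i t
    by (rule cellwise_eq[OF y(1) that])
  show ?thesis
  proof (intro exI[of _ q] conjI)
    show "\<forall>i<M. degree (q i) \<le> p - 1" using q' by blast
    have "integral {0..L} ?v' = (\<Sum>i<M. integral {y i..y (Suc i)} ?v')"
      by (rule integral_is_mesh[OF y(1) pc_integrable[OF v'p]])
    also have "\<dots> = (\<Sum>i<M. integral {y i..y (Suc i)} w')"
    proof (rule sum.cong)
      fix i assume "i \<in> {..<M}"
      then have i: "i < M" by simp
      have "integral {y i..y (Suc i)} ?v' = integral {y i..y (Suc i)} (poly (q i))"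
        by (rule integral_cong_finite[of "{y i, y (Suc i)}"]) (use v'c[OF i] in auto)
      then show "integral {y i..y (Suc i)} ?v' = integral {y i..y (Suc i)} w'" using q' i by simp
    qed simp
    also have "\<dots> = integral {0..L} w'" by (rule integral_is_mesh[OF y(1) pc_integrable[OF w'(2)], symmetric])
    finally show "integral {0..L} ?v' = 0" using w'(3) by simp
    have "integral {0..L} (\<lambda>t. (w' t - ?v' t)\<^sup>2) = (\<Sum>i<M. integral {y i..y (Suc i)} (\<lambda>t. (w' t - ?v' t)\<^sup>2))"
      by (intro integral_is_mesh[OF y(1)] pc_integrable pc_power2 pc_diff w' v'p)
    also have "\<dots> \<le> (\<Sum>i<M. h ^ (2 * p) * integral {y i..y (Suc i)} (\<lambda>t. (g' t)\<^sup>2))"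
    proof (rule sum_mono)
      fix i assume "i \<in> {..<M}"
      then have i: "i < M" by simp
      have "integral {y i..y (Suc i)} (\<lambda>t. (w' t - ?v' t)\<^sup>2) = integral {y i..y (Suc i)} (\<lambda>t. (w' t - poly (q i) t)\<^sup>2)"
        by (rule integral_cong_finite[of "{y i, y (Suc i)}"]) (use v'c[OF i] in auto)
      then show "integral {y i..y (Suc i)} (\<lambda>t. (w' t - ?v' t)\<^sup>2) \<le> h ^ (2 * p) * integral {y i..y (Suc i)} (\<lambda>t. (g' t)\<^sup>2)"
        using q' i by simp
    qed
    also have "\<dots> = h ^ (2 * p) * integral {0..L} (\<lambda>t. (g' t)\<^sup>2)"
      by (simp add: sum_distrib_left integral_is_mesh[OF y(1) g'_all])
    also have "integral {0..L} (\<lambda>t. (g' t)\<^sup>2) = (\<Sum>j\<le>m. integral {bp j..bp (Suc j)} (\<lambda>t. (g j t)\<^sup>2))"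
      unfolding integral_is_mesh[OF bp_mesh g'_all] lessThan_Suc_atMost
    proof (rule sum.cong)
      fix j assume "j \<in> {..m}"
      then show "integral {bp j..bp (Suc j)} (\<lambda>t. (g' t)\<^sup>2) = integral {bp j..bp (Suc j)} (\<lambda>t. (g j t)\<^sup>2)"
        by (intro integral_cong_finite[of "{bp j, bp (Suc j)}"]) (use g'_eq[of j] in auto)
    qed simp
    finally have "nrm L (\<lambda>t. w' t - ?v' t) \<le> sqrt (h ^ (2 * p) * (\<Sum>j\<le>m. integral {bp j..bp (Suc j)} (\<lambda>t. (g j t)\<^sup>2)))"
      unfolding nrm_def by (rule real_sqrt_le_mono)
    also have "\<dots> = h ^ p * sqrt (\<Sum>j\<le>m. integral {bp j..bp (Suc j)} (\<lambda>t. (g j t)\<^sup>2))"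
    proof -
      have "h ^ (2 * p) = (h ^ p)\<^sup>2" by (simp add: power_mult[symmetric] mult.commute)
      then show ?thesis using h by (simp add: real_sqrt_mult)
    qed
    finally show "nrm L (\<lambda>t. w' t - ?v' t) \<le>
      h ^ p * sqrt (\<Sum>j\<le>m. integral {bp j..bp (Suc j)} (\<lambda>t. (g j t)\<^sup>2))" .
  qed
qed

end

context quasilinear_problem
begin

section \<open>Choice of the constants and verification of the abstract hypotheses\<close>

theorem sgfem_error_estimate:
  "\<exists>h0>0. \<exists>C>0. \<forall>N x. admissible_mesh L \<Gamma> N x \<and> mesh_size N x < h0 \<longrightarrow>
    (\<forall>uh\<in>sgfem_space p L \<Gamma> N x.
      (\<forall>wh\<in>sgfem_space p L \<Gamma> N x. diffusion_form L m \<gamma> \<kappa> uh uh wh = load_form L f wh) \<longrightarrow>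
      L2_norm {0<..<L} (\<lambda>t. u t - uh t)
        + mesh_size N x * sobolev_seminorm 1 {0<..<L} (\<lambda>t. u t - uh t)
      \<le> C * mesh_size N x ^ (p + 1) *
          sqrt (\<Sum>j\<le>m. (sobolev_seminorm (p + 1) (subdomain L m \<gamma> j) u)\<^sup>2))"
proof -
  obtain W g w where W: "\<And>j i. j \<le> m \<Longrightarrow> i < p \<Longrightarrow> pwC1 (bp j) (bp (Suc j)) (W j i) (W j (Suc i))"
    "\<And>j i. j \<le> m \<Longrightarrow> i \<le> p \<Longrightarrow> continuous_on {bp j..bp (Suc j)} (W j i)"
    "\<And>j s t. j \<le> m \<Longrightarrow> bp j \<le> s \<Longrightarrow> s \<le> t \<Longrightarrow> t \<le> bp (Suc j) \<Longrightarrow> W j p t - W j p s = integral {s..t} (g j)"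
    "\<And>j. j \<le> m \<Longrightarrow> g j \<in> L2 {bp j<..<bp (Suc j)}"
    and gS: "\<And>j. j \<le> m \<Longrightarrow> (sobolev_seminorm (p + 1) (subdomain L m \<gamma> j) u)\<^sup>2 = integral {bp j..bp (Suc j)} (\<lambda>t. (g j t)\<^sup>2)"
    and w0: "pwC1 0 L w (cellwise (Suc m) bp (\<lambda>j. W j 1))" "eq_ae 0 L u w" "w 0 = 0" "w L = 0"
    by (rule regular_representative) (rule that)
  define w' where "w' = cellwise (Suc m) bp (\<lambda>j. W j 1)"
  have w: "pwC1 0 L w w'" using w0(1) by (simp add: w'_def)
  have w'p: "pc 0 L w'" by (rule pwC1_pc'[OF w])
  have w'0: "integral {0..L} w' = 0" using pwC1_integral[OF w, of 0 L] w0 L by simp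
  \<comment> \<open>The bound for u', available because u has at least p + 1 \<ge> 2 weak
    derivatives on every subdomain.\<close>
  obtain Y B where Y: "finite Y" "\<And>t. t \<in> {0..L} - Y \<Longrightarrow> \<bar>w' t\<bar> \<le> B"
    using w'p unfolding pc_def by blast
  define Z where "Z = bp ` {..Suc m} \<union> Y"
  have Z: "finite Z" using Y(1) by (simp add: Z_def)
  define S where "S = sqrt (\<Sum>j\<le>m. (sobolev_seminorm (p + 1) (subdomain L m \<gamma> j) u)\<^sup>2)"
  have S: "S = sqrt (\<Sum>j\<le>m. integral {bp j..bp (Suc j)} (\<lambda>t. (g j t)\<^sup>2))"
    unfolding S_def using gS by simp
  have S0: "0 \<le> S" unfolding S_def by (simp add: sum_nonneg)
  \<comment> \<open>The energy bound for uh', common to all meshes. By the Poincare inequality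
    \<open>sqrt L * R\<close> then bounds |uh|, and \<open>\<Lambda>0\<close> is taken for this
    range of values.\<close>
  define R where "R = L * nrm L f / \<kappa>0"
  have R0: "0 \<le> R" using L \<kappa>0_pos by (simp add: R_def)
  obtain \<Lambda>0 where \<Lambda>0: "0 \<le> \<Lambda>0" "\<And>j s t \<zeta>. j \<le> m \<Longrightarrow> s \<in> {bp j<..<bp (Suc j)} \<Longrightarrow> t \<in> {bp j<..<bp (Suc j)} \<Longrightarrow>
    \<bar>\<zeta>\<bar> \<le> sqrt L * R \<Longrightarrow> \<bar>k t \<zeta> - k s \<zeta>\<bar> \<le> \<Lambda>0 * \<bar>t - s\<bar>"
    using k_local_Lipschitz[of "sqrt L * R"] by blast
  \<comment> \<open>\<open>\<Lambda>0\<close> accounts for the change of position,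
    \<open>CLip\<close> for the change of the value of uh.\<close>
  define \<Lambda> where "\<Lambda> = \<Lambda>0 + CLip"
  define \<beta> where "\<beta> = CLip * \<bar>B\<bar>"
  have cs: "0 < \<kappa>0" "0 \<le> \<kappa>1" "0 \<le> \<beta>" "0 \<le> \<Lambda>" "0 \<le> R"
    using \<kappa>0_pos \<kappa>1_nonneg CLip_nonneg \<Lambda>0(1) R0 by (auto simp: \<Lambda>_def \<beta>_def)
  define K where "K = (\<kappa>1 + \<beta> * L) *
    (2 * (exp (\<beta> / \<kappa>0 * L))\<^sup>2 * sqrt L * ((\<beta> + \<Lambda>) / \<kappa>0\<^sup>2) * (sqrt L + R) + 1 / \<kappa>0)"
  have K0: "0 \<le> K" unfolding K_def using cs L by (intro mult_nonneg_nonneg add_nonneg_nonneg) auto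
  \<comment> \<open>Ensures \<beta> K h \<le> \<kappa>0 / 2; the added 1 keeps the denominator
    positive when \<beta> = 0.\<close>
  define h0 where "h0 = \<kappa>0 / (2 * (\<beta> * K + 1))"
  have h0: "0 < h0" using cs K0 by (simp add: h0_def add_nonneg_pos)
  define T where "T = (K + 1) * (2 * (\<kappa>1 + \<beta> * L) / \<kappa>0)"
  have T0: "0 \<le> T" using cs K0 L by (simp add: T_def)
  have main: "L2_norm {0<..<L} (\<lambda>t. u t - uh t)
        + mesh_size N x * sobolev_seminorm 1 {0<..<L} (\<lambda>t. u t - uh t)
      \<le> (T + 1) * mesh_size N x ^ (p + 1) * S"
    if adm: "admissible_mesh L \<Gamma> N x" and small: "mesh_size N x < h0"
      and uh: "uh \<in> sgfem_space p L \<Gamma> N x"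
      and eq: "\<forall>wh\<in>sgfem_space p L \<Gamma> N x. diffusion_form L m \<gamma> \<kappa> uh uh wh = load_form L f wh" for N x uh
  proof -
    define h where "h = mesh_size N x"
    note xm = admissible_is_mesh[OF adm]
    \<comment> \<open>Nodes and interfaces together: on a cell between neighbouring points of this
      set a single \<open>\<kappa> j\<close> is in force.\<close>
    define N0 where "N0 = x ` {..N} \<union> \<Gamma>"
    have x0L: "0 \<in> x ` {..N}" "L \<in> x ` {..N}"
      using is_meshD(2,3)[OF xm] by (metis atMost_iff image_eqI le0, metis atMost_iff image_eqI le_refl)
    have N0: "finite N0" "0 \<in> N0" "L \<in> N0" "N0 \<subseteq> {0..L}"
      using x0L is_meshD(5,6)[OF xm] \<gamma>_in unfolding N0_def by (auto dest: subsetD)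
    obtain M y where y: "is_mesh L M y" "y ` {..M} = N0"
      using mesh_enumeration[OF N0] .
    have bpy: "bp ` {..Suc m} \<subseteq> y ` {..M}" unfolding bp_image y(2) using N0 by (auto simp: N0_def)
    have yh: "y (Suc i) - y i \<le> h" if "i < M" for i
      unfolding h_def using refined_mesh_size[OF y(1) _ xm that] y(2) by (auto simp: N0_def)
    have h_nonneg: "0 \<le> h"
    proof -
      have "M \<noteq> 0" using is_meshD(2,3)[OF y(1)] L by (metis less_irrefl)
      then show ?thesis using yh[of 0] is_meshD(4)[OF y(1), of 0] by auto
    qed
    obtain uh' where uh': "pwC1 0 L uh uh'" and uh0: "uh 0 = 0" "uh L = 0"
      using sgfem_space_pwC1[OF adm uh] by blast
    have disc: "integral {0..L} (\<lambda>t. k t (uh t) * uh' t * v' t) = integral {0..L} (\<lambda>t. f t * v t)"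
      if v: "v \<in> sgfem_space p L \<Gamma> N x" "pwC1 0 L v v'" for v v'
      using diffusion_form_eq[OF pwC1_cont[OF uh'] eq_ae_refl pwC1_pc'[OF uh'] weak_deriv_pwC1(2)[OF L uh' eq_ae_refl]
          pwC1_pc'[OF v(2)] weak_deriv_pwC1(2)[OF L v(2) eq_ae_refl]]
        load_form_eq[OF pwC1_pc[OF v(2)]] eq v(1) by simp
    have NR: "nrm L uh' \<le> R"
      unfolding R_def by (rule discrete_energy_bound[OF uh' uh0(1) disc[OF uh uh']])
    have uhR: "\<bar>uh t\<bar> \<le> sqrt L * R" if "t \<in> {0..L}" for t
      by (rule order_trans[OF pwC1_Poincare(1)[OF less_imp_le[OF L] uh' uh0(1) that] mult_left_mono[OF NR]])
        (use L in simp)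
    define A where "A = (\<lambda>t. k t (uh t))"
    define e where "e = (\<lambda>t. w t - uh t)"
    define e' where "e' = (\<lambda>t. w' t - uh' t)"
    define d where "d = (\<lambda>t. (k t (w t) - k t (uh t)) * w' t)"
    have uh'p: "pc 0 L uh'" by (rule pwC1_pc'[OF uh'])
    have Ap: "pc 0 L A" unfolding A_def by (rule k_pc[OF pwC1_cont[OF uh']])
    have ep: "pwC1 0 L e e'" unfolding e_def e'_def by (rule pwC1_diff[OF w uh'])
    have e'p: "pc 0 L e'" by (rule pwC1_pc'[OF ep])
    have kwp: "pc 0 L (\<lambda>t. k t (w t))" by (rule k_pc[OF pwC1_cont[OF w]])
    have dp: "pc 0 L d" unfolding d_def by (intro pc_mult pc_diff kwp Ap[unfolded A_def] w'p)
    have Fp: "pc 0 L (\<lambda>t. A t * e' t + d t)" by (intro pc_add pc_mult Ap e'p dp)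
    \<comment> \<open>Both equations are tested with the same v, that for u through
      \<open>flux_equation\<close> and that for uh through \<open>disc\<close>; the difference of
      the fluxes is A e' + d identically.\<close>
    have galerkin: "integral {0..L} (\<lambda>t. (A t * e' t + d t) * v' t) = 0"
      if v: "v \<in> sgfem_space p L \<Gamma> N x" "pwC1 0 L v v'" for v v'
    proof -
      have v'p: "pc 0 L v'" by (rule pwC1_pc'[OF v(2)])
      have "integral {0..L} (\<lambda>t. k t (w t) * w' t * v' t) = integral {0..L} (\<lambda>t. f t * v t)"
        using sgfem_space_pwC1(2,3)[OF adm v(1)] by (rule flux_equation[OF w w0(2) v(2)])
      then have "integral {0..L} (\<lambda>t. k t (w t) * w' t * v' t) - integral {0..L} (\<lambda>t. k t (uh t) * uh' t * v' t) = 0"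
        using disc[OF v] by simp
      also have "integral {0..L} (\<lambda>t. k t (w t) * w' t * v' t) - integral {0..L} (\<lambda>t. k t (uh t) * uh' t * v' t) =
        integral {0..L} (\<lambda>t. k t (w t) * w' t * v' t - k t (uh t) * uh' t * v' t)"
        by (intro integral_diff[symmetric] pc_integrable pc_mult kwp Ap[unfolded A_def] w'p uh'p v'p)
      also have "\<dots> = integral {0..L} (\<lambda>t. (A t * e' t + d t) * v' t)"
        by (intro integral_cong) (simp add: A_def e'_def d_def algebra_simps)
      finally show ?thesis .
    qed
    have orth: "(\<Sum>i<M. \<psi> i * integral {y i..y (Suc i)} (\<lambda>t. A t * e' t + d t)) = 0"
      if \<psi>: "(\<Sum>i<M. \<psi> i * (y (Suc i) - y i)) = 0" for \<psi>
    proof -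
      \<comment> \<open>The test function is the primitive of the cellwise constant \<psi>;
        constants have degree at most p - 1.\<close>
      let ?q = "\<lambda>i. [:\<psi> i:]"
      let ?c = "cellwise M y (\<lambda>i. poly (?q i))"
      have cp: "pc 0 L ?c" by (intro pc_cellwise continuous_intros)
      have cc: "?c t = \<psi> i" if "i < M" "t \<in> {y i<..<y (Suc i)}" for i t
        using cellwise_eq[OF y(1) that] by simp
      have "integral {0..L} ?c = (\<Sum>i<M. integral {y i..y (Suc i)} ?c)"
        by (rule integral_is_mesh[OF y(1) pc_integrable[OF cp]])
      also have "\<dots> = (\<Sum>i<M. \<psi> i * (y (Suc i) - y i))"
      proof (rule sum.cong)
        fix i assume "i \<in> {..<M}"
        then have i: "i < M" by simp
        have "integral {y i..y (Suc i)} ?c = integral {y i..y (Suc i)} (\<lambda>_. \<psi> i)"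
          by (rule integral_cong_finite[of "{y i, y (Suc i)}"]) (use cc[OF i] in auto)
        then show "integral {y i..y (Suc i)} ?c = \<psi> i * (y (Suc i) - y i)"
          using is_meshD(4)[OF y(1) i] by simp
      qed simp
      finally have c0: "integral {0..L} ?c = 0" using \<psi> by simp
      have "y ` {..M} = x ` {..N} \<union> \<Gamma>" using y(2) by (simp add: N0_def)
      note mem = cellwise_polynomial_in_sgfem_space[OF adm p y(1) this _ c0]
      have "0 = integral {0..L} (\<lambda>t. (A t * e' t + d t) * ?c t)"
        by (rule galerkin[OF mem, symmetric]) auto
      also have "\<dots> = (\<Sum>i<M. integral {y i..y (Suc i)} (\<lambda>t. (A t * e' t + d t) * ?c t))"
        by (intro integral_is_mesh[OF y(1)] pc_integrable pc_mult Fp cp)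
      also have "\<dots> = (\<Sum>i<M. \<psi> i * integral {y i..y (Suc i)} (\<lambda>t. A t * e' t + d t))"
      proof (rule sum.cong)
        fix i assume "i \<in> {..<M}"
        then have i: "i < M" by simp
        have "integral {y i..y (Suc i)} (\<lambda>t. (A t * e' t + d t) * ?c t) =
          integral {y i..y (Suc i)} (\<lambda>t. \<psi> i * (A t * e' t + d t))"
          by (rule integral_cong_finite[of "{y i, y (Suc i)}"]) (use cc[OF i] in auto)
        then show "integral {y i..y (Suc i)} (\<lambda>t. (A t * e' t + d t) * ?c t) =
          \<psi> i * integral {y i..y (Suc i)} (\<lambda>t. A t * e' t + d t)" by simp
      qed simp
      finally show ?thesis by simp
    qed
    have "\<exists>q :: nat \<Rightarrow> real poly. (\<forall>i<M. degree (q i) \<le> p - 1) \<and>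
      integral {0..L} (cellwise M y (\<lambda>i. poly (q i))) = 0 \<and>
      nrm L (\<lambda>t. w' t - cellwise M y (\<lambda>i. poly (q i)) t) \<le> h ^ p * S"
      unfolding S
      by (rule piecewise_polynomial_approximation[OF W w'_def w'p w'0 y(1) bpy yh h_nonneg])
    then obtain q :: "nat \<Rightarrow> real poly" where q: "\<And>i. i < M \<Longrightarrow> degree (q i) \<le> p - 1"
      "integral {0..L} (cellwise M y (\<lambda>i. poly (q i))) = 0"
      "nrm L (\<lambda>t. w' t - cellwise M y (\<lambda>i. poly (q i)) t) \<le> h ^ p * S"
      by blast
    define v' where "v' = cellwise M y (\<lambda>i. poly (q i))"
    define v where "v t = integral {0..t} v'" for t
    have yN: "y ` {..M} = x ` {..N} \<union> \<Gamma>" using y(2) by (simp add: N0_def)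
    have v: "v \<in> sgfem_space p L \<Gamma> N x" "pwC1 0 L v v'"
      using cellwise_polynomial_in_sgfem_space[OF adm p y(1) yN q(1,2)] by (simp_all add: v_def[abs_def] v'_def)
    \<comment> \<open>With this choice e' - gg = v' - uh', the derivative of a discrete
      function.\<close>
    define gg where "gg = (\<lambda>t. w' t - v' t)"
    have ggp: "pc 0 L gg" unfolding gg_def by (intro pc_diff w'p pwC1_pc'[OF v(2)])
    have orth2: "integral {0..L} (\<lambda>t. (A t * e' t + d t) * (e' t - gg t)) = 0"
      using galerkin[OF sgfem_space_diff[OF v(1) uh] pwC1_diff[OF v(2) uh']] by (simp add: e'_def gg_def)
    have ZG: "t \<in> {0..L} - bp ` {..Suc m}" if "t \<in> {0..L} - Z" for t
      using that by (auto simp: Z_def)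
    have Aosc: "\<bar>A t - A s\<bar> \<le> \<Lambda> * integral {y i..y (Suc i)} (\<lambda>r. 1 + \<bar>uh' r\<bar>)"
      if i: "i < M" and s: "s \<in> {y i<..<y (Suc i)} - Z" and t: "t \<in> {y i<..<y (Suc i)} - Z" for i s t
    proof -
      obtain j where j: "j \<le> m" "bp j \<le> y i" "y (Suc i) \<le> bp (Suc j)"
        using mesh_cell_in_subdomain[OF y(1) bpy i] .
      have yi: "0 \<le> y i" "y i < y (Suc i)" "y (Suc i) \<le> L"
        using is_meshD(5)[OF y(1), of i] is_meshD(4)[OF y(1) i] is_meshD(6)[OF y(1), of "Suc i"] i by auto
      have sL: "s \<in> {0..L} - Z" and tL: "t \<in> {0..L} - Z" using s t yi by auto
      have st: "s \<in> {bp j<..<bp (Suc j)}" "t \<in> {bp j<..<bp (Suc j)}" using s t j by auto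
      \<comment> \<open>First the position moves with the value uh t held fixed, then the value
        moves at the fixed position s.\<close>
      have "\<bar>k t (uh t) - k s (uh t)\<bar> \<le> \<Lambda>0 * \<bar>t - s\<bar>"
        using tL by (intro \<Lambda>0(2)[OF j(1) st] uhR) auto
      also have "\<dots> \<le> \<Lambda>0 * (y (Suc i) - y i)" using s t \<Lambda>0(1) by (intro mult_left_mono) auto
      finally have 1: "\<bar>k t (uh t) - k s (uh t)\<bar> \<le> \<Lambda>0 * (y (Suc i) - y i)" .
      have ui: "(\<lambda>r. \<bar>uh' r\<bar>) integrable_on {y i..y (Suc i)}"
        using yi by (intro pc_integrable_sub[OF pc_abs[OF uh'p]])
      define I where "I = integral {y i..y (Suc i)} (\<lambda>r. \<bar>uh' r\<bar>)"
      have I0: "0 \<le> I" unfolding I_def by (rule integral_nonneg[OF ui]) simp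
      have "\<bar>k s (uh t) - k s (uh s)\<bar> \<le> CLip * \<bar>uh t - uh s\<bar>" by (rule k_Lipschitz[OF ZG[OF sL]])
      also have "\<dots> \<le> CLip * I"
        unfolding I_def using s t yi CLip_nonneg by (intro mult_left_mono pwC1_osc[OF uh']) auto
      finally have "\<bar>A t - A s\<bar> \<le> \<Lambda>0 * (y (Suc i) - y i) + CLip * I"
        using 1 unfolding A_def by linarith
      also have "\<dots> \<le> \<Lambda> * ((y (Suc i) - y i) + I)"
        unfolding distrib_left using \<Lambda>0(1) CLip_nonneg I0 yi
        by (intro add_mono mult_right_mono) (simp_all add: \<Lambda>_def)
      also have "(y (Suc i) - y i) + I = integral {y i..y (Suc i)} (\<lambda>r. 1 + \<bar>uh' r\<bar>)"
        unfolding I_def using yi ui by (subst integral_add) auto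
      finally show ?thesis .
    qed
    have db: "\<bar>d t\<bar> \<le> \<beta> * \<bar>e t\<bar>" if t: "t \<in> {0..L} - Z" for t
    proof -
      have "\<bar>d t\<bar> \<le> (CLip * \<bar>e t\<bar>) * \<bar>B\<bar>"
        unfolding d_def abs_mult
        using k_Lipschitz[OF ZG[OF t], of "w t" "uh t"] Y(2)[of t] t CLip_nonneg
        by (intro mult_mono) (auto simp: Z_def e_def)
      then show ?thesis by (simp add: \<beta>_def mult_ac)
    qed
    have smallK: "\<beta> * K * h \<le> \<kappa>0 / 2"
    proof -
      have "\<beta> * K * h \<le> \<beta> * K * h0"
        using small cs K0 by (intro mult_left_mono) (auto simp: h_def)
      also have "\<dots> \<le> (\<beta> * K + 1) * h0" using h0 by simp
      also have "\<dots> = \<kappa>0 / 2"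
      proof -
        have "\<beta> * K + 1 \<noteq> 0" using cs K0 by (simp add: add_nonneg_eq_0_iff)
        moreover have "X * (\<kappa>0 / (2 * X)) = \<kappa>0 / 2" if "X \<noteq> 0" for X :: real
          using that by simp
        ultimately show ?thesis unfolding h0_def by blast
      qed
      finally show ?thesis .
    qed
    have e0: "e 0 = 0" "e L = 0" using w0(3,4) uh0 by (simp_all add: e_def)
    have "nrm L e + h * nrm L e' \<le> (K + 1) * (2 * (\<kappa>1 + \<beta> * L) / \<kappa>0) * h * nrm L gg"
      unfolding K_def
    proof (rule quasi_optimality[OF y(1) yh L cs h_nonneg ep e0 Z Ap _ _ uh'p NR Aosc dp db orth ggp orth2])
      show "\<kappa>0 \<le> A t" "A t \<le> \<kappa>1" if "t \<in> {0..L} - Z" for t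
        unfolding A_def using k_bounds[OF ZG[OF that]] by auto
    qed (use smallK in \<open>simp_all add: K_def\<close>)
    also have "\<dots> \<le> T * h * (h ^ p * S)"
      unfolding T_def[symmetric] gg_def v'_def
      using T0 h_nonneg by (intro mult_left_mono[OF q(3)]) simp
    also have "\<dots> \<le> (T + 1) * h ^ (p + 1) * S"
      using S0 h_nonneg by (simp add: algebra_simps)
    finally have fin: "nrm L e + h * nrm L e' \<le> (T + 1) * h ^ (p + 1) * S" .
    have ae: "eq_ae 0 L (\<lambda>t. u t - uh t) e"
      unfolding e_def using eq_ae_comp2[OF w0(2) eq_ae_refl[of 0 L uh], of "\<lambda>_ x y. x - y"] .
    have "L2_norm {0<..<L} (\<lambda>t. u t - uh t) = nrm L e"
      using L2_norm_eq_nrm[OF eq_ae_L2[OF pc_L2[OF pwC1_pc[OF ep]] eq_ae_sym[OF ae]]] eq_ae_nrm[OF ae] by simp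
    moreover have "sobolev_seminorm 1 {0<..<L} (\<lambda>t. u t - uh t) = nrm L e'"
      by (rule sobolev_seminorm_pwC1[OF L ep ae])
    ultimately show ?thesis using fin by (simp add: h_def)
  qed
  \<comment> \<open>\<open>T\<close> is only known to be nonnegative; T + 1 is a positive
    constant.\<close>
  show ?thesis
    using h0 T0 main unfolding S_def
    by (intro exI[of _ h0] conjI exI[of _ "T + 1"]) auto
qed

end

theorem theorem4p3:
  fixes L :: real and m :: nat and \<gamma> :: "nat \<Rightarrow> real"
    and \<kappa> :: "nat \<Rightarrow> real \<times> real \<Rightarrow> real"
    and \<kappa>min \<kappa>max CL :: "nat \<Rightarrow> real"
    and f u :: "real \<Rightarrow> real" and p :: nat
  assumes "0 < L"
    and "strict_mono_on {1..m} \<gamma>"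
    and "\<gamma> ` {1..m} \<subseteq> {0<..<L}"
    and "\<forall>j\<le>m. 0 < \<kappa>min j \<and> \<kappa>min j \<le> \<kappa>max j"
    and "\<forall>j\<le>m. continuous_on (closure (subdomain L m \<gamma> j) \<times> UNIV) (\<kappa> j)"
    and "\<forall>j\<le>m. \<forall>t\<in>closure (subdomain L m \<gamma> j). \<forall>\<zeta>. \<kappa> j (t, \<zeta>) \<in> {\<kappa>min j..\<kappa>max j}"
    and "\<forall>j\<le>m. \<forall>t\<in>subdomain L m \<gamma> j. \<forall>\<zeta>1 \<zeta>2.
           \<bar>\<kappa> j (t, \<zeta>1) - \<kappa> j (t, \<zeta>2)\<bar> \<le> CL j * \<bar>\<zeta>1 - \<zeta>2\<bar>"
    and "\<forall>j\<le>m. C1_on_closure (subdomain L m \<gamma> j \<times> UNIV) (\<kappa> j)"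
    and "f \<in> L2 {0<..<L}"
    and "1 \<le> p"
    and "u \<in> H10 {0<..<L}"
    and "\<forall>w\<in>H10 {0<..<L}. diffusion_form L m \<gamma> \<kappa> u u w = load_form L f w"
    and "u \<in> H_Gamma (p + 1) L m \<gamma>"
  shows "\<exists>h0>0. \<exists>C>0. \<forall>N x.
    admissible_mesh L (\<gamma> ` {1..m}) N x \<and> mesh_size N x < h0 \<longrightarrow>
    (\<forall>uh\<in>sgfem_space p L (\<gamma> ` {1..m}) N x.
      (\<forall>wh\<in>sgfem_space p L (\<gamma> ` {1..m}) N x.
         diffusion_form L m \<gamma> \<kappa> uh uh wh = load_form L f wh) \<longrightarrow>
      L2_norm {0<..<L} (\<lambda>t. u t - uh t)
        + mesh_size N x * sobolev_seminorm 1 {0<..<L} (\<lambda>t. u t - uh t)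
      \<le> C * mesh_size N x ^ (p + 1) *
          sqrt (\<Sum>j\<le>m. (sobolev_seminorm (p + 1) (subdomain L m \<gamma> j) u)\<^sup>2))"
proof -
  interpret quasilinear_problem L m \<gamma> \<kappa> \<kappa>min \<kappa>max CL f u p
    by (rule quasilinear_problem.intro[OF assms])
  show ?thesis by (rule sgfem_error_estimate)
qed

end
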